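(* Fix an integer $q\ge2$. For $c\in\mathbb{R}$ let $\nu_c$ be the unique maximizing measure of $f_c(x)=\log\left|\frac{\sin\pi q(x+c)}{\sin\pi(x+c)}\right|$, i.e. the unique $T$-invariant Borel probability measure $\mu$ on $\mathbb{T}$ maximizing $\int f_c\,d\mu$. Let $\mathcal{P}=\{c\in\mathbb{R}:\nu_c \text{ is not supported on a periodic orbit of } T\}$. Then the closure $\overline{\mathcal{P}}$ is nowhere dense and has Hausdorff dimension zero.
   Context: $\mathbb{T}=\mathbb{R}/\mathbb{Z}$, $T(x)=qx\bmod1$. (The existence and uniqueness of $\nu_c$ for every $c$ is established in the paper.) *)

theory Defs
  imports "HOL-Probability.Probability"
begin

text \<open>The circle R/Z is represented by the fundamental domain [0,1) inside the reals;
  Borel probability measures on the circle are Borel probability measures on the reals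
  concentrated on [0,1).\<close>

definition Tmap :: "nat \<Rightarrow> real \<Rightarrow> real" where
  "Tmap q x = frac (real q * x)"

text \<open>The ratio |sin(pi q y)/sin(pi y)|, continuously extended by its limit q at integers y.\<close>
definition dratio :: "nat \<Rightarrow> real \<Rightarrow> real \<Rightarrow> real" where
  "dratio q c x = (if sin (pi * (x + c)) = 0 then real q
                   else \<bar>sin (pi * real q * (x + c)) / sin (pi * (x + c))\<bar>)"

definition fc :: "nat \<Rightarrow> real \<Rightarrow> real \<Rightarrow> ereal" where
  "fc q c x = (if dratio q c x = 0 then - \<infinity> else ereal (ln (dratio q c x)))"

text \<open>Integral of fc (bounded above by ln q, possibly -infinity):
  int fc dmu = ln q - int (ln q - fc) dmu.\<close>
definition integral_fc :: "nat \<Rightarrow> real \<Rightarrow> real measure \<Rightarrow> ereal" where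
  "integral_fc q c \<mu> = ereal (ln (real q)) -
     enn2ereal (\<integral>\<^sup>+ x. e2ennreal (ereal (ln (real q)) - fc q c x) \<partial>\<mu>)"

definition invariant_prob :: "nat \<Rightarrow> real measure \<Rightarrow> bool" where
  "invariant_prob q \<mu> \<longleftrightarrow> prob_space \<mu> \<and> sets \<mu> = sets borel \<and>
     emeasure \<mu> {0..<1} = 1 \<and> distr \<mu> borel (Tmap q) = \<mu>"

definition maximizing :: "nat \<Rightarrow> real \<Rightarrow> real measure \<Rightarrow> bool" where
  "maximizing q c \<mu> \<longleftrightarrow> invariant_prob q \<mu> \<and>
     (\<forall>\<eta>. invariant_prob q \<eta> \<longrightarrow> integral_fc q c \<eta> \<le> integral_fc q c \<mu>)"

definition nu :: "nat \<Rightarrow> real \<Rightarrow> real measure" where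
  "nu q c = (THE \<mu>. maximizing q c \<mu>)"

definition supported_on_periodic_orbit :: "nat \<Rightarrow> real measure \<Rightarrow> bool" where
  "supported_on_periodic_orbit q \<mu> \<longleftrightarrow>
     (\<exists>x n. 0 < n \<and> x \<in> {0..<1} \<and> (Tmap q ^^ n) x = x \<and>
        emeasure \<mu> {(Tmap q ^^ k) x | k. k < n} = 1)"

definition Pset :: "nat \<Rightarrow> real set" where
  "Pset q = {c. \<not> supported_on_periodic_orbit q (nu q c)}"

definition nowhere_dense :: "'a::topological_space set \<Rightarrow> bool" where
  "nowhere_dense S \<longleftrightarrow> interior (closure S) = {}"

definition hausdorff_pre :: "real \<Rightarrow> real \<Rightarrow> 'a::metric_space set \<Rightarrow> ennreal" where
  "hausdorff_pre s \<delta> A = (INF U \<in> {U :: nat \<Rightarrow> 'a set. A \<subseteq> (\<Union>i. U i) \<and>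
       (\<forall>i. bounded (U i) \<and> diameter (U i) \<le> \<delta>)}. \<Sum>i. ennreal (diameter (U i) powr s))"

definition hausdorff_measure :: "real \<Rightarrow> 'a::metric_space set \<Rightarrow> ennreal" where
  "hausdorff_measure s A = (SUP \<delta> \<in> {0<..}. hausdorff_pre s \<delta> A)"

definition hausdorff_dim :: "'a::metric_space set \<Rightarrow> real" where
  "hausdorff_dim A = Inf {s. 0 \<le> s \<and> hausdorff_measure s A = 0}"

end

theory Submission
  imports Defs "HOL-Real_Asymp.Real_Asymp"
begin

text \<open>
  For \<open>\<gamma>\<close> real let \<open>\<tau>\<close> be the inverse branch of \<open>T\<close> with values in the arc
  \<open>[\<gamma>, \<gamma> + 1/q)\<close>. The series \<open>\<Sum>n\<ge>1. q^-n f_c'(\<tau>^n x)\<close> is the derivative of a function \<open>\<psi>\<close> with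
  \<open>\<psi> = f_c \<circ> \<tau> + \<psi> \<circ> \<tau> - const\<close>, and \<open>\<psi>\<close> is continuous on the circle iff that derivative has mean zero.
  The mean is strictly decreasing in \<open>c\<close>, so it vanishes for exactly one phase \<open>c = c(\<gamma>)\<close>; an
  \<open>L\<^sup>2\<close> contraction argument shows that \<open>c\<close> is locally Hoelder continuous, and it is onto since
  \<open>c(\<gamma>) + \<gamma>\<close> is bounded.

  For \<open>c = c(\<gamma>)\<close> the function \<open>\<psi>\<close> is a sub-action: \<open>f_c + \<psi> - \<psi> \<circ> T\<close> is maximal exactly on the arc.
  Indeed \<open>\<bar>sin (\<pi> q y)\<bar>\<close> is constant on fibres of \<open>T\<close>, so on a fibre \<open>f_c + \<psi>\<close> agrees up to a
  constant with \<open>\<psi> - ln \<bar>sin \<pi> y\<bar>\<close>, and a bound on the decrease of \<open>\<psi>'\<close> over a step \<open>1/q\<close> makes the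
  latter discretely convex along the fibre. Hence a measure is maximizing iff it lives on the arc.

  If some \<open>T^k \<gamma>\<close> lies off the closed arc, then \<open>T\<close> is injective and expanding on the set of orbits
  trapped in the arc, which is therefore finite; order preservation makes it a single periodic orbit.
  The remaining \<open>\<gamma>\<close> form a closed set on which integer winding numbers are monotone in \<open>\<gamma>\<close>, so at scale
  \<open>q^-n\<close> it is covered locally by \<open>O(n^2)\<close> intervals; its Hoelder image has dimension zero.
\<close>

section \<open>Preliminaries\<close>

text \<open>The hard point is the bound on the decrease of \<psi>' (\<open>subder_gap\<close>),
  which has to hold for every arc. \<open>dpeak\<close> has poles at distance 1/q from the peak, so
  an arc with the peak close to one end would ruin every estimate. The remedy is that mean zero of
  \<psi>' itself forces the two ends of the arc to be nearly equidistant from the peak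
  (\<open>apriori\<close>, \<open>endpoints_close\<close>). On such arcs a bound on the second
  derivative suffices for q \<ge> 4, while q = 2 and q = 3 leave so little room that exact formulas
  are used. Only the inclusion of P in the image of the exceptional set is proved; no maximizing
  measure is determined for exceptional \<gamma>. That image is closed, so it contains the closure
  of P. Any Hoelder exponent would do, since it changes dimension by a factor and the dimension is
  0. A set of dimension zero contains no interval, which gives the topological claim. For q = 2 the
  measures carried by such arcs are the Sturmian measures.\<close>

lemma cmod_cis_diff: "cmod (cis a - cis b) = 2 * \<bar>sin ((a - b) / 2)\<bar>"
proof -
  have "(cmod (cis a - cis b))\<^sup>2 = (cos a - cos b)\<^sup>2 + (sin a - sin b)\<^sup>2"
    by (simp add: cmod_power2)
  also have "\<dots> = 2 - 2 * cos (a - b)"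
    by (simp add: power2_diff cos_diff algebra_simps sin_squared_eq)
  also have "cos (a - b) = 1 - 2 * (sin ((a - b) / 2))\<^sup>2"
    using cos_double_sin[of "(a - b) / 2"] by (simp add: diff_divide_distrib)
  finally have "(cmod (cis a - cis b))\<^sup>2 = (2 * \<bar>sin ((a - b) / 2)\<bar>)\<^sup>2"
    by (simp add: power_mult_distrib)
  thus ?thesis by (rule power2_eq_imp_eq) auto
qed

text \<open>Both sides are monic polynomials of degree \<open>n\<close> in \<open>z\<close>, and
  both vanish at the \<open>n\<close> roots of unity.\<close>

lemma prod_minus_roots_unity:
  assumes "n > 0"
  shows "(\<Prod>k<n. z - cis (2 * pi * real k / real n)) = z ^ n - 1"
proof -
  let ?w = "\<lambda>k. cis (2 * pi * real k / real n)"
  let ?r = "\<Prod>k<n. [:- ?w k, 1:]"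
  let ?u = "monom 1 n - 1 :: complex poly"
  have deg: "degree ?r = n" by (subst degree_prod_sum_eq) auto
  have "lead_coeff ?r = (\<Prod>k<n. lead_coeff [:- ?w k, 1:])" by (rule lead_coeff_prod)
  hence r: "degree ?r = n" "poly.coeff ?r n = 1" unfolding deg by simp_all
  have "?r = ?u"
  proof (rule poly_eqI_degree_lead_coeff[where n = n and A = "{z. z ^ n = 1}"])
    show "poly.coeff ?r n = poly.coeff ?u n" using r assms by simp
    show "degree ?u \<le> n" by (rule degree_diff_le) (simp_all add: degree_monom_eq)
    show "poly ?r z = poly ?u z" if "z \<in> {z. z ^ n = 1}" for z
    proof -
      have "z \<in> ?w ` {..<n}"
        using that unfolding bij_betw_imp_surj_on[OF Complex.bij_betw_roots_unity[OF assms]] .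
      then obtain k where "k < n" "z = ?w k" by auto
      hence "poly ?r z = 0" unfolding poly_prod by (intro prod_zero bexI[of _ k]) auto
      thus ?thesis using that by (simp add: poly_monom)
    qed
  qed (use r card_roots_unity_eq[OF assms] in auto)
  hence "poly ?r z = poly ?u z" by simp
  thus ?thesis by (simp add: poly_prod poly_monom)
qed

text \<open>Take moduli in \<open>prod_minus_roots_unity\<close> at \<open>cis (- 2 * x)\<close> and
  turn each factor into a sine by \<open>cmod_cis_diff\<close>.\<close>

lemma abs_sin_mult_prod:
  assumes "n > 0"
  shows "2 * \<bar>sin (real n * x)\<bar> = (\<Prod>k<n. 2 * \<bar>sin (x + pi * real k / real n)\<bar>)"
proof -
  have "cmod (cis (- 2 * x) ^ n - 1) = 2 * \<bar>sin (real n * (- 2 * x) / 2)\<bar>"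
    unfolding Complex.DeMoivre using cmod_cis_diff[of "real n * (- 2 * x)" 0]
    by (simp only: cis_zero diff_zero)
  also have "real n * (- 2 * x) / 2 = - (real n * x)" by simp
  finally have "2 * \<bar>sin (real n * x)\<bar> = cmod (cis (- 2 * x) ^ n - 1)" by simp
  also have "\<dots> = (\<Prod>k<n. cmod (cis (- 2 * x) - cis (2 * pi * real k / real n)))"
    by (simp add: prod_minus_roots_unity[OF assms, symmetric] prod_norm)
  also have "\<dots> = (\<Prod>k<n. 2 * \<bar>sin (x + pi * real k / real n)\<bar>)"
  proof (intro prod.cong refl)
    fix k assume "k \<in> {..<n}"
    have "(- 2 * x - 2 * pi * real k / real n) / 2 = - (x + pi * real k / real n)" by simp
    thus "cmod (cis (- 2 * x) - cis (2 * pi * real k / real n)) = 2 * \<bar>sin (x + pi * real k / real n)\<bar>"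
      by (simp only: cmod_cis_diff sin_minus abs_minus)
  qed
  finally show ?thesis .
qed

section \<open>Inequalities for sine and cotangent\<close>

lemma x_cos_less_sin:
  fixes x :: real
  assumes "0 < x" "x \<le> pi"
  shows "x * cos x < sin x"
proof -
  have "sin 0 - 0 * cos 0 < sin x - x * cos x"
  proof (rule DERIV_pos_imp_increasing_open[OF assms(1)])
    fix t :: real assume t: "0 < t" "t < x"
    have "((\<lambda>x. sin x - x * cos x) has_real_derivative t * sin t) (at t)"
      by (auto intro!: derivative_eq_intros)
    moreover have "0 < t * sin t" using t assms by (intro mult_pos_pos sin_gt_zero) auto
    ultimately show "\<exists>y. ((\<lambda>x. sin x - x * cos x) has_real_derivative y) (at t) \<and> 0 < y" by blast
  qed (intro continuous_intros)
  thus ?thesis by simp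
qed

text \<open>Halving the angle, sin x = 2 sin (x/2) cos (x/2) \<ge> x cos^2 (x/2), and cos^2 (x/2) =
  1 - sin^2 (x/2) \<ge> 1 - x^2/4.\<close>

lemma sin_ge_cubic:
  fixes x :: real
  assumes "0 \<le> x" "x \<le> pi"
  shows "x * (1 - x\<^sup>2 / 4) \<le> sin x"
proof (cases "x = 0")
  case False
  have s: "0 \<le> sin (x / 2)" "sin (x / 2) \<le> x / 2" "0 \<le> cos (x / 2)"
    using assms sin_x_le_x[of "x / 2"] by (auto intro!: sin_ge_zero cos_ge_zero)
  have "(cos (x / 2))\<^sup>2 = 1 - (sin (x / 2))\<^sup>2" by (rule cos_squared_eq)
  moreover have "(sin (x / 2))\<^sup>2 \<le> (x / 2)\<^sup>2" using s by (intro power_mono)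
  ultimately have "x * (1 - x\<^sup>2 / 4) \<le> x * (cos (x / 2))\<^sup>2"
    using assms by (intro mult_left_mono) (auto simp: power_divide)
  also have "\<dots> = 2 * (x / 2 * cos (x / 2)) * cos (x / 2)" by (simp add: power2_eq_square)
  also have "\<dots> \<le> 2 * sin (x / 2) * cos (x / 2)"
    using x_cos_less_sin[of "x / 2"] False assms s by (intro mult_right_mono) auto
  also have "\<dots> = sin x" using sin_double[of "x / 2"] by simp
  finally show ?thesis .
qed simp

text \<open>The right side is the integral of \<open>cot\<close> over [m - d, m + d], the left side
  its length times the midpoint value. Differentiating in d leaves midpoint convexity of
  \<open>cot\<close>, which holds because sin (m + t) sin (m - t) \<le> sin^2 m.\<close>

lemma ln_sin_ratio_ge:
  assumes "0 < m" "m < pi / 2" "0 \<le> d" "d < m"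
  shows "2 * d * cot m \<le> ln (sin (m + d)) - ln (sin (m - d))"
proof -
  let ?f = "\<lambda>d. ln (sin (m + d)) - ln (sin (m - d)) - 2 * d * cot m"
  have "?f 0 \<le> ?f d"
  proof (rule DERIV_nonneg_imp_nondecreasing[OF assms(3)])
    fix t assume t: "0 \<le> t" "t \<le> d"
    have pos: "0 < sin (m + t)" "0 < sin (m - t)" "0 < sin m"
      using t assms by (auto intro!: sin_gt_zero)
    have "sin (m + t) * sin (m - t) = (sin m * cos t)\<^sup>2 - (cos m * sin t)\<^sup>2"
      by (simp add: sin_add sin_diff algebra_simps power2_eq_square)
    also have "\<dots> = (sin m)\<^sup>2 - (sin t)\<^sup>2"
      by (simp add: power_mult_distrib cos_squared_eq algebra_simps)
    finally have le: "sin (m + t) * sin (m - t) \<le> (sin m)\<^sup>2" by simp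
    have "cot (m + t) + cot (m - t) = sin ((m + t) + (m - t)) / (sin (m + t) * sin (m - t))"
      unfolding cot_def sin_add[of "m + t" "m - t"] using pos by (simp add: field_simps)
    also have "\<dots> = 2 * sin m * cos m / (sin (m + t) * sin (m - t))" by (simp add: sin_double)
    also have "\<dots> \<ge> 2 * sin m * cos m / (sin m)\<^sup>2"
      using pos le cos_gt_zero[of m] assms by (intro divide_left_mono mult_nonneg_nonneg mult_pos_pos) auto
    finally have "0 \<le> cot (m + t) + cot (m - t) - 2 * cot m"
      using pos by (simp add: cot_def power2_eq_square)
    moreover have "(?f has_real_derivative cos (m + t) / sin (m + t) - (- cos (m - t)) / sin (m - t) - 2 * cot m) (at t)"
      using pos by (auto intro!: derivative_eq_intros simp: divide_inverse)
    ultimately show "\<exists>y. (?f has_real_derivative y) (at t) \<and> 0 \<le> y"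
      by (intro exI conjI) (auto simp: cot_def)
  qed
  thus ?thesis by simp
qed

lemma cot_antimono:
  fixes x y :: real
  assumes "0 < x" "x \<le> y" "y < pi"
  shows "cot y \<le> cot x"
proof -
  have "0 < sin x" "0 < sin y" "0 \<le> sin (y - x)"
    using assms by (auto intro!: sin_gt_zero sin_ge_zero)
  moreover have "sin (y - x) = (cot x - cot y) * (sin x * sin y)"
    using calculation by (simp add: sin_diff cot_def field_simps)
  ultimately show ?thesis by (simp add: zero_le_mult_iff mult_le_0_iff not_less)
qed

section \<open>Discrete convexity, and cycles of an injective map\<close>

lemma floor_cases:
  fixes x y g :: real
  assumes "x \<le> y" "y \<le> x + 1"
  shows "\<lfloor>y - g\<rfloor> = \<lfloor>x - g\<rfloor> \<or> \<lfloor>y - g\<rfloor> = \<lfloor>x - g\<rfloor> + 1"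
  using assms by linarith

text \<open>If the step into \<open>k\<close> goes down, all earlier steps go down and
  \<open>w 0\<close> is larger; otherwise all later steps go up and \<open>w n\<close> is
  larger.\<close>

lemma discrete_strict_convex:
  fixes w :: "nat \<Rightarrow> real"
  assumes conv: "\<And>i j. i < j \<Longrightarrow> j < n \<Longrightarrow> w j - w (Suc j) < w i - w (Suc i)" and k: "0 < k" "k < n"
  shows "w k < max (w 0) (w n)"
proof (cases "0 < w (k - 1) - w k")
  case True
  have "0 < w j - w (Suc j)" if "j < k" for j
  proof (cases "j = k - 1")
    case False
    hence "j < k - 1" "k - 1 < n" using that k by linarith+
    thus ?thesis using conv[of j "k - 1"] True k by simp
  qed (use True k in auto)
  note pos = this
  have "w j < w 0 \<or> j = 0" if "j \<le> k" for j
    using that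
  proof (induction j)
    case (Suc j)
    hence "w (Suc j) < w j" "w j \<le> w 0" using pos[of j] by (auto simp: less_imp_le)
    thus ?case by simp
  qed auto
  from this[of k] k show ?thesis by auto
next
  case False
  have neg: "w j - w (Suc j) < 0" if "k \<le> j" "j < n" for j
    using conv[of "k - 1" j] False that k by fastforce
  have "w k < w j \<or> j = k" if "k \<le> j" "j \<le> n" for j
    using that
  proof (induction j)
    case (Suc j)
    show ?case
    proof (cases "k = Suc j")
      case False
      hence "w k \<le> w j" "w j < w (Suc j)" using Suc neg[of j] by auto
      thus ?thesis by simp
    qed auto
  qed auto
  from this[of n] k show ?thesis by auto
qed

text \<open>\<open>S a\<close> also reaches \<open>a\<close>, so \<open>a\<close> is periodic. A
  point that reaches \<open>a\<close> is then located on the cycle by injectivity.\<close>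

lemma transitive_finite_cycle:
  assumes inj: "inj_on S X" and map: "S ` X \<subseteq> X" and a: "a \<in> X"
    and reach: "\<And>x. x \<in> X \<Longrightarrow> \<exists>m. (S ^^ m) x = a"
  obtains n where "0 < n" "(S ^^ n) a = a" "X = {(S ^^ k) a | k. k < n}"
proof -
  have iter: "(S ^^ m) x \<in> X" if "x \<in> X" for m x
    using that map by (induction m) auto
  have inj_iter: "x = y" if "(S ^^ m) x = (S ^^ m) y" "x \<in> X" "y \<in> X" for m x y
    using that
  proof (induction m)
    case (Suc m)
    thus ?case using inj_onD[OF inj _ iter iter] by auto
  qed auto
  obtain m where "(S ^^ m) (S a) = a" using reach[of "S a"] a map by auto
  hence n: "(S ^^ Suc m) a = a" by (simp add: funpow_swap1)
  have "x \<in> {(S ^^ k) a | k. k < Suc m}" if x: "x \<in> X" for x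
  proof -
    obtain l where l: "(S ^^ l) x = a" using reach[OF x] by blast
    have per: "(S ^^ (l * Suc m)) a = a" using funpow_mod_eq[OF n, of "l * Suc m"] by (simp del: mult_Suc_right)
    \<comment> \<open>\<open>l * Suc m\<close> is a multiple of the period, so from
      \<open>(S ^^ (l * m)) a\<close> exactly \<open>l\<close> steps lead back to \<open>a\<close>,
      just as from \<open>x\<close>.\<close>
    have "(S ^^ l) ((S ^^ (l * m)) a) = (S ^^ (l * Suc m)) a" by (simp add: funpow_add)
    hence "(S ^^ l) x = (S ^^ l) ((S ^^ (l * m)) a)" using l per by simp
    hence "x = (S ^^ (l * m)) a" using inj_iter x iter[OF a] by blast
    also have "\<dots> = (S ^^ (l * m mod Suc m)) a" using funpow_mod_eq[OF n] by simp
    finally show ?thesis by (metis (mono_tags, lifting) mem_Collect_eq mod_less_divisor zero_less_Suc)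
  qed
  moreover have "{(S ^^ k) a | k. k < Suc m} \<subseteq> X" using iter[OF a] by auto
  ultimately show thesis using that[of "Suc m"] n by blast
qed

lemma abs_sin_mult_le: "\<bar>sin (real n * x)\<bar> \<le> real n * \<bar>sin x\<bar>"
proof (induction n)
  case (Suc n)
  have "sin (real (Suc n) * x) = sin (real n * x) * cos x + cos (real n * x) * sin x"
    by (simp add: distrib_right sin_add add.commute)
  also have "\<bar>\<dots>\<bar> \<le> \<bar>sin (real n * x) * cos x\<bar> + \<bar>cos (real n * x) * sin x\<bar>" by (rule abs_triangle_ineq)
  also have "\<dots> \<le> \<bar>sin (real n * x)\<bar> * 1 + 1 * \<bar>sin x\<bar>"
    unfolding abs_mult by (intro add_mono mult_mono) auto
  also have "\<dots> \<le> real (Suc n) * \<bar>sin x\<bar>" using Suc by (simp add: distrib_right)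
  finally show ?case .
qed simp

lemma abs_sin_add_int: "\<bar>sin (x + pi * of_int k)\<bar> = \<bar>sin x\<bar>"
proof -
  have s0: "sin (pi * of_int k) = 0" using sin_zero_iff_int2[of "pi * of_int k"] by (auto simp: mult.commute)
  have "\<bar>cos (pi * of_int k)\<bar> = 1"
    using sin_cos_squared_add[of "pi * of_int k"] s0 by (simp add: abs_square_eq_1)
  thus ?thesis using s0 by (simp add: sin_add abs_mult)
qed

lemma frac_add_of_int: "frac (x + of_int k) = frac (x :: real)"
  unfolding frac_def by simp

section \<open>Finitely supported measures, and integrals over a period\<close>

lemma emeasure_finite_support:
  assumes sets: "sets M = sets borel" and X: "finite X" "AE x in M. x \<in> X"
    and A: "(A :: real set) \<in> sets borel"
  shows "emeasure M A = (\<Sum>x\<in>A \<inter> X. emeasure M {x})"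
proof -
  have "X \<in> sets borel" using X(1) by (intro borel_closed finite_imp_closed)
  hence "A \<in> sets M" "A \<inter> X \<in> sets M" using A by (simp_all add: sets)
  moreover have "AE x in M. x \<in> A \<longleftrightarrow> x \<in> A \<inter> X" using X(2) by eventually_elim simp
  ultimately have "emeasure M A = emeasure M (A \<inter> X)" by (intro emeasure_eq_AE)
  also have "\<dots> = (\<Sum>x\<in>A \<inter> X. emeasure M {x})"
    using X(1) by (intro emeasure_eq_sum_singleton) (auto simp: sets)
  finally show ?thesis .
qed

text \<open>\<open>subder\<close> need not be continuous, so its integrability comes from
  measurability and a bound.\<close>

lemma integrable_on_bounded_borel:
  fixes f :: "real \<Rightarrow> real"
  assumes "f \<in> borel_measurable borel" "\<And>x. \<bar>f x\<bar> \<le> M"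
  shows "f integrable_on {a..b}"
proof (rule measurable_bounded_by_integrable_imp_integrable_real)
  show "f \<in> borel_measurable (lebesgue_on {a..b})"
    using assms(1) by (intro measurable_restrict_space1 borel_measurable_if_D) (simp add: measurable_completion)
  show "(\<lambda>_. M) integrable_on {a..b}" by (rule integrable_const_ivl)
qed (use assms in auto)

lemma integral_shift_real:
  fixes f :: "real \<Rightarrow> real"
  assumes "f integrable_on {a + c..b + c}"
  shows "integral {a..b} (\<lambda>x. f (x + c)) = integral {a + c..b + c} f"
proof -
  have "(f has_integral integral {a + c..b + c} f) {a + c..b + c}"
    using assms by (rule integrable_integral)
  hence "((f \<circ> ((+) c)) has_integral integral {a + c..b + c} f) {a..b}"
    by (simp only: has_integral_shift_Icc_real)
  thus ?thesis by (simp add: o_def add.commute integral_unique)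
qed

lemma integral_divide_real:
  fixes f :: "real \<Rightarrow> real"
  assumes "f integrable_on {a / m..b / m}" "m > 0"
  shows "integral {a..b} (\<lambda>x. f (x / m)) = m * integral {a / m..b / m} f"
    and "(\<lambda>x. f (x / m)) integrable_on {a..b}"
proof -
  have "(f has_integral integral {a / m..b / m} f) (cbox (a / m) (b / m))"
    using assms(1) by (simp add: has_integral_integral)
  from has_integral_affinity'[OF this, of "1 / m" 0] assms(2)
  have "((\<lambda>x. f (x / m)) has_integral m * integral {a / m..b / m} f) {a..b}"
    by (simp add: field_simps)
  thus "integral {a..b} (\<lambda>x. f (x / m)) = m * integral {a / m..b / m} f"
    and "(\<lambda>x. f (x / m)) integrable_on {a..b}"
    by (auto simp: integral_unique integrable_on_def)
qed

lemma periodic_of_int: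
  fixes f :: "real \<Rightarrow> 'a"
  assumes "\<And>x. f (x + 1) = f x"
  shows "f (x + of_int k) = f x"
proof (induction k rule: int_induct[where k = 0])
  case (step1 i)
  show ?case using assms[of "x + of_int i"] step1 by (simp add: add.assoc)
next
  case (step2 i)
  have "f (x + of_int (i - 1) + 1) = f (x + of_int i)" by (simp add: algebra_simps)
  thus ?case using assms[of "x + of_int (i - 1)"] step2 by simp
qed auto

lemma integral_period:
  fixes f :: "real \<Rightarrow> real"
  assumes per: "\<And>x. f (x + 1) = f x" and int: "\<And>a b. f integrable_on {a..b}"
  shows "integral {b..b + 1} f = integral {a..a + 1} f"
proof -
  \<comment> \<open>The integer translate of \<open>b\<close> in [a, a + 1]; the part of its period
    beyond \<open>a + 1\<close> is moved back by 1.\<close>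
  define b' where "b' = b - of_int \<lfloor>b - a\<rfloor>"
  have b': "a \<le> b'" "b' \<le> a + 1" unfolding b'_def by linarith+
  have b: "b = b' + of_int \<lfloor>b - a\<rfloor>" by (simp add: b'_def)
  have sh: "integral {x + of_int k..y + of_int k} f = integral {x..y} f" for x y k
    using integral_shift_real[OF int, of x y "of_int k"] periodic_of_int[of f, OF per] by simp
  have "integral {b..b + 1} f = integral {b'..b' + 1} f"
    using sh[of b' "\<lfloor>b - a\<rfloor>" "b' + 1"] b by (simp add: add_ac)
  also have "\<dots> = integral {b'..a + 1} f + integral {a + 1..b' + 1} f"
    using b' int by (subst Henstock_Kurzweil_Integration.integral_combine) auto
  also have "integral {a + 1..b' + 1} f = integral {a..b'} f"
    using sh[of a 1 b'] by simp
  also have "integral {b'..a + 1} f + integral {a..b'} f = integral {a..a + 1} f"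
    using b' int Henstock_Kurzweil_Integration.integral_combine[of a b' "a + 1" f] by simp
  finally show ?thesis .
qed

section \<open>Hausdorff pre-measures\<close>

lemma hausdorff_pre_mono: "A \<subseteq> B \<Longrightarrow> hausdorff_pre s d A \<le> hausdorff_pre s d B"
  unfolding hausdorff_pre_def by (intro INF_superset_mono) auto

text \<open>Cover \<open>A i\<close> at cost below e / 2^(i + 1) and list the double family of
  covering sets by \<open>prod_decode\<close>; the total cost is at most e.\<close>

lemma hausdorff_pre_UN_null:
  fixes A :: "nat \<Rightarrow> 'a::metric_space set"
  assumes null: "\<And>i. hausdorff_pre s d (A i) = 0"
  shows "hausdorff_pre s d (\<Union>i. A i) = 0"
proof -
  have le: "hausdorff_pre s d (\<Union>i. A i) \<le> ennreal e" if e: "0 < e" for e :: real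
  proof -
    have "\<exists>U. A i \<subseteq> (\<Union>k. U k) \<and> (\<forall>k. bounded (U k) \<and> diameter (U k) \<le> d) \<and>
        (\<Sum>k. ennreal (diameter (U k) powr s)) < ennreal (e * (1 / 2) ^ Suc i)" for i
    proof -
      have "hausdorff_pre s d (A i) < ennreal (e * (1 / 2) ^ Suc i)" using null[of i] e by simp
      thus ?thesis unfolding hausdorff_pre_def INF_less_iff by blast
    qed
    then obtain U where U: "\<And>i. A i \<subseteq> (\<Union>k. U i k)" "\<And>i k. bounded (U i k)" "\<And>i k. diameter (U i k) \<le> d"
      "\<And>i. (\<Sum>k. ennreal (diameter (U i k) powr s)) < ennreal (e * (1 / 2) ^ Suc i)" by metis
    define V where "V n = (case prod_decode n of (i, k) \<Rightarrow> U i k)" for n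
    have cov: "(\<Union>i. A i) \<subseteq> (\<Union>n. V n)"
    proof
      fix x assume "x \<in> (\<Union>i. A i)"
      then obtain i k where "x \<in> U i k" using U(1) by blast
      hence "x \<in> V (prod_encode (i, k))" by (simp add: V_def)
      thus "x \<in> (\<Union>n. V n)" by blast
    qed
    have "hausdorff_pre s d (\<Union>i. A i) \<le> (\<Sum>n. ennreal (diameter (V n) powr s))"
      unfolding hausdorff_pre_def using cov U(2,3) by (intro INF_lower) (auto simp: V_def split: prod.split)
    also have "\<dots> = (\<Sum>n. (\<lambda>(i, k). ennreal (diameter (U i k) powr s)) (prod_decode n))"
      by (intro suminf_cong) (simp add: V_def split: prod.split)
    also have "\<dots> = (\<Sum>i. \<Sum>k. ennreal (diameter (U i k) powr s))" by (rule suminf_ennreal_2dimen) simp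
    also have "\<dots> \<le> (\<Sum>i. ennreal (e * (1 / 2) ^ Suc i))" using U(4) by (intro suminf_le) (auto simp: less_imp_le)
    also have "\<dots> = ennreal e"
    proof (rule suminf_ennreal_eq)
      show "(\<lambda>i. e * (1 / 2) ^ Suc i) sums e" using sums_mult[OF power_half_series, of e] by simp
    qed (use e in auto)
    finally show ?thesis .
  qed
  have "hausdorff_pre s d (\<Union>i. A i) \<le> 0"
    by (rule ennreal_le_epsilon) (use le in simp)
  thus ?thesis by simp
qed

lemma hausdorff_pre_finite_cover:
  fixes U :: "nat \<Rightarrow> 'a::metric_space set"
  assumes cov: "A \<subseteq> (\<Union>i<m. U i)" and r: "\<And>i x y. i < m \<Longrightarrow> x \<in> U i \<Longrightarrow> y \<in> U i \<Longrightarrow> dist x y \<le> r"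
    and rd: "0 \<le> r" "r \<le> d" "0 < s"
  shows "hausdorff_pre s d A \<le> ennreal (real m * r powr s)"
proof -
  \<comment> \<open>The definition asks for a sequence of sets, so the finite cover is padded with
    empty sets, each contributing \<open>0 powr s = 0\<close>.\<close>
  define V where "V i = (if i < m then U i else {})" for i
  have diam: "diameter (V i) \<le> r" for i
  proof (cases "V i = {}")
    case False
    thus ?thesis using r[of i] unfolding diameter_def V_def by (auto intro!: cSUP_least split: if_splits)
  qed (use rd in simp)
  have bnd: "bounded (V i)" for i
    unfolding bounded_two_points using r[of i] by (intro exI[of _ r]) (auto simp: V_def)
  have "hausdorff_pre s d A \<le> (\<Sum>i. ennreal (diameter (V i) powr s))"
    unfolding hausdorff_pre_def
  proof (intro INF_lower CollectI conjI allI)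
    show "A \<subseteq> (\<Union>i. V i)" using cov by (force simp: V_def)
    show "diameter (V i) \<le> d" for i using diam[of i] rd by linarith
  qed (rule bnd)
  also have "\<dots> = (\<Sum>i<m. ennreal (diameter (V i) powr s))"
    by (rule suminf_finite) (auto simp: V_def)
  also have "\<dots> \<le> (\<Sum>i<m. ennreal (r powr s))"
    using diam rd diameter_ge_0[OF bnd] by (intro sum_mono ennreal_leI powr_mono2) auto
  also have "\<dots> = ennreal (real m * r powr s)" by (simp add: ennreal_of_nat_eq_real_of_nat ennreal_mult)
  finally show ?thesis .
qed

text \<open>A set of diameter d has outer Lebesgue measure at most 2 d, so sets of total diameter
  below r cannot cover an interval of length 2 r.\<close>

lemma hausdorff_null_interior:
  fixes Z :: "real set"
  assumes "hausdorff_pre 1 1 Z = 0"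
  shows "interior Z = {}"
proof (rule ccontr)
  assume "interior Z \<noteq> {}"
  then obtain x r where r: "0 < r" "cball x r \<subseteq> Z" using mem_interior_cball by blast
  have "hausdorff_pre 1 1 Z < ennreal r" using assms r by simp
  then obtain U where U: "Z \<subseteq> (\<Union>i. U i)" "\<And>i. bounded (U i)" "(\<Sum>i. ennreal (diameter (U i) powr 1)) < ennreal r"
    unfolding hausdorff_pre_def INF_less_iff by blast
  \<comment> \<open>The \<open>U i\<close> need not be measurable; each is enlarged to a closed ball
    around one of its points with its diameter as radius.\<close>
  define V where "V i = (if U i = {} then {} else cball (SOME y. y \<in> U i) (diameter (U i)))" for i
  have UV: "U i \<subseteq> V i" for i
  proof
    fix z assume z: "z \<in> U i"
    hence "(SOME y. y \<in> U i) \<in> U i" by (rule someI)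
    thus "z \<in> V i" using z diameter_bounded_bound[OF U(2)] by (auto simp: V_def)
  qed
  have "cball x r \<subseteq> (\<Union>i. U i)" using U(1) r(2) by (rule order_trans[rotated])
  also have "\<dots> \<subseteq> (\<Union>i. V i)" using UV by (intro UN_mono) auto
  finally have "emeasure lborel (cball x r) \<le> emeasure lborel (\<Union>i. V i)"
    by (rule emeasure_mono) (auto intro!: sets.countable_UN simp: V_def)
  also have "\<dots> \<le> (\<Sum>i. emeasure lborel (V i))" by (rule emeasure_subadditive_countably) (auto simp: V_def)
  also have "\<dots> \<le> (\<Sum>i. ennreal 2 * ennreal (diameter (U i) powr 1))"
  proof (intro suminf_le)
    fix i show "emeasure lborel (V i) \<le> ennreal 2 * ennreal (diameter (U i) powr 1)"
    proof (cases "U i = {}")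
      case False
      have d: "0 \<le> diameter (U i)" by (rule diameter_ge_0[OF U(2)])
      hence "emeasure lborel (V i) = ennreal (2 * diameter (U i))" using False by (simp add: V_def cball_eq_atLeastAtMost)
      also have "\<dots> = ennreal 2 * ennreal (diameter (U i))" using d by (intro ennreal_mult) auto
      finally show ?thesis using d by simp
    qed (simp add: V_def)
  qed auto
  also have "\<dots> = ennreal 2 * (\<Sum>i. ennreal (diameter (U i) powr 1))" by (rule ennreal_suminf_cmult)
  also have "\<dots> < ennreal 2 * ennreal r" using U(3) by (intro ennreal_mult_strict_left_mono) auto
  also have "\<dots> = ennreal (2 * r)" using r by (intro ennreal_mult[symmetric]) auto
  also have "\<dots> = emeasure lborel (cball x r)" using r by (simp add: cball_eq_atLeastAtMost)
  finally show False by simp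
qed

section \<open>The potential near its peak\<close>

locale times_q =
  fixes q :: nat
  assumes q2: "2 \<le> q"
begin

lemma q_pos: "0 < real q" and q_ge2: "2 \<le> real q"
  using q2 by auto

text \<open>This is \<open>fc\<close> as a function of y = x + c on (-1/q, 1/q). Dividing by sin (pi
  y) removes the factor k = 0 of \<open>abs_sin_mult_prod\<close>, which leaves a form that is
  smooth at y = 0.\<close>

definition peak :: "real \<Rightarrow> real" where
  "peak y = (\<Sum>k=1..<q. ln (2 * sin (pi * (y + real k / real q))))"

definition dpeak :: "real \<Rightarrow> real" where
  "dpeak y = pi * (\<Sum>k=1..<q. cot (pi * (y + real k / real q)))"

text \<open>Minus the second derivative of \<open>peak\<close>, so that concavity reads as
  positivity.\<close>

definition ddpeak :: "real \<Rightarrow> real" where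
  "ddpeak y = pi\<^sup>2 * (\<Sum>k=1..<q. 1 / (sin (pi * (y + real k / real q)))\<^sup>2)"

lemma peak_arg:
  assumes "\<bar>y\<bar> < 1 / real q" "k \<in> {1..<q}"
  shows "0 < sin (pi * (y + real k / real q))"
proof -
  have "1 / real q \<le> real k / real q" "real k / real q + 1 / real q \<le> 1"
    using assms(2) q_pos by (auto simp: field_simps)
  hence "0 < y + real k / real q" "y + real k / real q < 1" using assms(1) by linarith+
  thus ?thesis by (intro sin_gt_zero) auto
qed

lemma peak_deriv:
  assumes "\<bar>y\<bar> < 1 / real q"
  shows "(peak has_real_derivative dpeak y) (at y)"
proof -
  have "((\<lambda>y. ln (2 * sin (pi * (y + real k / real q)))) has_real_derivative
      pi * cot (pi * (y + real k / real q))) (at y)" if "k \<in> {1..<q}" for k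
  proof -
    have "((\<lambda>y. 2 * sin (pi * (y + real k / real q))) has_real_derivative
        2 * (cos (pi * (y + real k / real q)) * pi)) (at y)"
      by (intro DERIV_cmult DERIV_chain2[OF DERIV_sin]) (auto intro!: derivative_eq_intros)
    from DERIV_ln_divide[THEN DERIV_chain2, OF _ this] show ?thesis
      using peak_arg[OF assms that] by (simp add: cot_def mult.commute)
  qed
  hence "((\<lambda>y. \<Sum>k=1..<q. ln (2 * sin (pi * (y + real k / real q)))) has_real_derivative
      (\<Sum>k=1..<q. pi * cot (pi * (y + real k / real q)))) (at y)"
    by (intro DERIV_sum) auto
  thus ?thesis by (simp add: peak_def[abs_def] dpeak_def sum_distrib_left)
qed

lemma dpeak_deriv:
  assumes "\<bar>y\<bar> < 1 / real q"
  shows "(dpeak has_real_derivative - ddpeak y) (at y)"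
proof -
  have "((\<lambda>y. cot (pi * (y + real k / real q))) has_real_derivative
      - inverse ((sin (pi * (y + real k / real q)))\<^sup>2) * pi) (at y)" if "k \<in> {1..<q}" for k
    by (rule DERIV_chain2[OF DERIV_cot])
       (use peak_arg[OF assms that] in \<open>auto intro!: derivative_eq_intros\<close>)
  hence "(dpeak has_real_derivative
     pi * (\<Sum>k=1..<q. - inverse ((sin (pi * (y + real k / real q)))\<^sup>2) * pi)) (at y)"
    unfolding dpeak_def[abs_def] by (intro DERIV_cmult DERIV_sum) auto
  moreover have "pi * (\<Sum>k=1..<q. - inverse ((sin (pi * (y + real k / real q)))\<^sup>2) * pi) = - ddpeak y"
    by (simp add: ddpeak_def sum_distrib_left sum_negf power2_eq_square field_simps)
  ultimately show ?thesis by simp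
qed

lemma ddpeak_ge:
  assumes "\<bar>y\<bar> < 1 / real q"
  shows "pi\<^sup>2 \<le> ddpeak y"
proof -
  have "1 \<le> 1 / (sin (pi * (y + real k / real q)))\<^sup>2" if "k \<in> {1..<q}" for k
    using peak_arg[OF assms that]
    by (simp add: abs_square_le_1 zero_less_power)
  hence "(\<Sum>k=1..<q. 1) \<le> (\<Sum>k=1..<q. 1 / (sin (pi * (y + real k / real q)))\<^sup>2)"
    by (intro sum_mono) auto
  hence "1 \<le> (\<Sum>k=1..<q. 1 / (sin (pi * (y + real k / real q)))\<^sup>2)" using q2 by simp
  thus ?thesis by (simp add: ddpeak_def)
qed

lemma dpeak_minus: "dpeak (- y) = - dpeak y"
proof -
  have "(\<Sum>k=1..<q. cot (pi * (- y + real k / real q))) = (\<Sum>k=1..<q. - cot (pi * (y + real k / real q)))"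
  proof (rule sum.reindex_bij_witness[of _ "\<lambda>k. q - k" "\<lambda>k. q - k"])
    fix k assume k: "k \<in> {1..<q}"
    have "pi * (y + real (q - k) / real q) = - (pi * (- y + real k / real q)) + pi"
      using k by (simp add: of_nat_diff field_simps)
    moreover have "cot (- x + pi) = - cot x" for x :: real by (simp add: cot_def)
    ultimately show "- cot (pi * (y + real (q - k) / real q)) = cot (pi * (- y + real k / real q))"
      by simp
  qed (use q2 in auto)
  thus ?thesis by (simp add: dpeak_def sum_negf)
qed

lemma dpeak_0 [simp]: "dpeak 0 = 0"
  using dpeak_minus[of 0] by simp

lemma dpeak_diff:
  assumes "- (1 / real q) < x" "x < y" "y < 1 / real q"
  obtains z where "x < z" "z < y" "dpeak x - dpeak y = (y - x) * ddpeak z"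
proof -
  have "\<exists>z. z > x \<and> z < y \<and> dpeak y - dpeak x = (y - x) * (- ddpeak z)"
    by (rule MVT2[OF assms(2)], rule dpeak_deriv) (use assms in linarith)
  then obtain z where z: "x < z" "z < y" "dpeak y - dpeak x = - ((y - x) * ddpeak z)" by auto
  from z(3) have "dpeak x - dpeak y = (y - x) * ddpeak z" by linarith
  thus ?thesis using that z by blast
qed

text \<open>Uniform strong concavity of \<open>peak\<close>; it later makes the phase of an arc
  unique and turns bounds on \<open>jump\<close> into bounds on the phase.\<close>

lemma dpeak_strong_antimono:
  assumes "- (1 / real q) < x" "x \<le> y" "y < 1 / real q"
  shows "pi\<^sup>2 * (y - x) \<le> dpeak x - dpeak y"
proof (cases "x = y")
  case False
  then obtain z where z: "x < z" "z < y" "dpeak x - dpeak y = (y - x) * ddpeak z"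
    using dpeak_diff[of x y] assms by auto
  have "pi\<^sup>2 \<le> ddpeak z" by (rule ddpeak_ge) (use z assms in auto)
  thus ?thesis using z by (simp add: mult.commute mult_left_mono)
qed auto

lemma dpeak_antimono:
  assumes "- (1 / real q) < x" "x \<le> y" "y < 1 / real q"
  shows "dpeak y \<le> dpeak x"
proof -
  have "0 \<le> pi\<^sup>2 * (y - x)" using assms(2) by (intro mult_nonneg_nonneg) auto
  thus ?thesis using dpeak_strong_antimono[OF assms] by linarith
qed

lemma abs_sin_split:
  "\<bar>sin (pi * real q * y)\<bar> = \<bar>sin (pi * y)\<bar> * (\<Prod>k=1..<q. 2 * \<bar>sin (pi * (y + real k / real q))\<bar>)"
proof -
  have "{..<q} = insert 0 {1..<q}" using q2 by auto
  hence "2 * \<bar>sin (real q * (pi * y))\<bar> =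
    2 * \<bar>sin (pi * y)\<bar> * (\<Prod>k=1..<q. 2 * \<bar>sin (pi * y + pi * real k / real q)\<bar>)"
    using abs_sin_mult_prod[of q "pi * y"] q2 by simp
  moreover have "pi * y + pi * real k / real q = pi * (y + real k / real q)" for k
    by (simp add: distrib_left)
  moreover have "real q * (pi * y) = pi * real q * y" by simp
  ultimately show ?thesis by simp
qed

lemma sin_nz: "0 < \<bar>y\<bar> \<Longrightarrow> \<bar>y\<bar> < 1 \<Longrightarrow> sin (pi * y) \<noteq> 0"
proof -
  assume "0 < \<bar>y\<bar>" "\<bar>y\<bar> < 1"
  hence "0 < sin (pi * \<bar>y\<bar>)" by (intro sin_gt_zero) auto
  thus ?thesis by (cases "y \<ge> 0") auto
qed

lemma peak_eq:
  assumes "y \<noteq> 0" "\<bar>y\<bar> < 1 / real q"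
  shows "peak y = ln (\<bar>sin (pi * real q * y)\<bar> / \<bar>sin (pi * y)\<bar>)"
proof -
  have "1 / real q \<le> 1" using q2 by simp
  hence nz: "sin (pi * y) \<noteq> 0" using assms by (intro sin_nz) auto
  have "peak y = ln (\<Prod>k=1..<q. 2 * sin (pi * (y + real k / real q)))"
    unfolding peak_def by (subst ln_prod) (use peak_arg[OF assms(2)] in force)+
  also have "(\<Prod>k=1..<q. 2 * sin (pi * (y + real k / real q))) =
     (\<Prod>k=1..<q. 2 * \<bar>sin (pi * (y + real k / real q))\<bar>)"
    by (intro prod.cong) (use peak_arg[OF assms(2)] in force)+
  also have "\<dots> = \<bar>sin (pi * real q * y)\<bar> / \<bar>sin (pi * y)\<bar>"
    using abs_sin_split[of y] nz by simp
  finally show ?thesis .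
qed

lemma peak_minus: "\<bar>y\<bar> < 1 / real q \<Longrightarrow> peak (- y) = peak y"
  by (cases "y = 0") (simp_all add: peak_eq)

text \<open>The quotient in \<open>peak_eq\<close> is undefined at 0, but it tends to q there and
  \<open>peak\<close> is continuous.\<close>

lemma peak_0: "peak 0 = ln (real q)"
proof -
  have lim: "((\<lambda>y. sin (a * y) / y) \<longlongrightarrow> a) (at 0)" for a :: real
  proof -
    have "((\<lambda>y. sin (a * y)) has_real_derivative cos (a * 0) * a) (at 0)"
      by (rule DERIV_chain2[OF DERIV_sin]) (rule DERIV_cmult_Id)
    thus ?thesis by (simp add: has_field_derivative_iff)
  qed
  have "((\<lambda>y. (sin (pi * real q * y) / y) / (sin (pi * y) / y)) \<longlongrightarrow> pi * real q / pi) (at 0)"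
    by (intro tendsto_divide lim) simp
  moreover have "eventually (\<lambda>y. (sin (pi * real q * y) / y) / (sin (pi * y) / y) =
      sin (pi * real q * y) / sin (pi * y)) (at (0::real))"
    by (simp add: eventually_at_filter)
  ultimately have "((\<lambda>y. sin (pi * real q * y) / sin (pi * y)) \<longlongrightarrow> pi * real q / pi) (at 0)"
    by (rule Lim_transform_eventually)
  hence "((\<lambda>y. sin (pi * real q * y) / sin (pi * y)) \<longlongrightarrow> real q) (at 0)" by simp
  hence "((\<lambda>y. ln (\<bar>sin (pi * real q * y) / sin (pi * y)\<bar>)) \<longlongrightarrow> ln \<bar>real q\<bar>) (at 0)"
    using q_pos by (intro tendsto_intros) auto
  moreover have "eventually (\<lambda>y. ln (\<bar>sin (pi * real q * y) / sin (pi * y)\<bar>) = peak y) (at 0)"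
    unfolding eventually_at
  proof (intro exI[of _ "1 / real q"] conjI ballI impI)
    show "0 < 1 / real q" using q_pos by simp
    fix y :: real assume "y \<noteq> 0 \<and> dist y 0 < 1 / real q"
    thus "ln (\<bar>sin (pi * real q * y) / sin (pi * y)\<bar>) = peak y" by (simp add: peak_eq)
  qed
  ultimately have "(peak \<longlongrightarrow> ln \<bar>real q\<bar>) (at 0)" by (rule Lim_transform_eventually)
  hence "(peak \<longlongrightarrow> ln (real q)) (at 0)" by simp
  moreover have "(peak \<longlongrightarrow> peak 0) (at 0)"
    using DERIV_isCont[OF peak_deriv[of 0]] q_pos by (simp add: isCont_def)
  ultimately show ?thesis by (rule LIM_unique[symmetric])
qed

text \<open>Differentiate both expressions for \<open>peak\<close>, the sum in its definition and
  the quotient of \<open>peak_eq\<close>, on (0, 1/q).\<close>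

lemma dpeak_eq:
  assumes "0 < y" "y < 1 / real q"
  shows "dpeak y = pi * (real q * cot (pi * real q * y) - cot (pi * y))"
proof -
  have le1: "1 / real q \<le> 1" using q2 by simp
  have pos: "0 < sin (pi * real q * z)" "0 < sin (pi * z)" if "z \<in> {0<..<1 / real q}" for z
  proof -
    have "real q * z < 1" "z < 1"
      using that q_pos less_le_trans[OF _ le1, of z] by (auto simp: field_simps)
    hence "pi * (real q * z) < pi * 1" "pi * z < pi * 1"
      by (intro mult_strict_left_mono; simp)+
    thus "0 < sin (pi * real q * z)" "0 < sin (pi * z)"
      using that q_pos by (auto intro!: sin_gt_zero simp: mult.assoc)
  qed
  let ?g = "\<lambda>z. ln (sin (pi * real q * z)) - ln (sin (pi * z))"
  have lns: "((\<lambda>z. ln (sin (a * z))) has_real_derivative a * cot (a * y)) (at y)"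
    if "0 < sin (a * y)" for a
  proof -
    have "((\<lambda>z. sin (a * z)) has_real_derivative cos (a * y) * a) (at y)"
      by (intro DERIV_chain2[OF DERIV_sin] DERIV_cmult_Id)
    from DERIV_ln_divide[THEN DERIV_chain2, OF _ this] that show ?thesis
      by (simp add: cot_def mult.commute)
  qed
  have "(?g has_real_derivative (pi * real q) * cot (pi * real q * y) - pi * cot (pi * y)) (at y)"
    using pos[of y] assms by (intro DERIV_diff lns) auto
  hence "(?g has_real_derivative pi * (real q * cot (pi * real q * y) - cot (pi * y))) (at y)"
    by (simp add: right_diff_distrib mult.assoc)
  moreover have "(peak has_real_derivative dpeak y) (at y)" using assms by (intro peak_deriv) auto
  hence "(?g has_real_derivative dpeak y) (at y)"
  proof (rule has_field_derivative_transform_within_open[where S = "{0<..<1 / real q}"])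
    fix z assume z: "z \<in> {0<..<1 / real q}"
    thus "peak z = ?g z" using pos[OF z] peak_eq[of z] by (simp add: ln_div)
  qed (use assms in auto)
  ultimately show ?thesis by (rule DERIV_unique[symmetric])
qed

lemma ddpeak_eq:
  assumes "0 < y" "y < 1 / real q"
  shows "ddpeak y = pi\<^sup>2 * ((real q)\<^sup>2 / (sin (pi * real q * y))\<^sup>2 - 1 / (sin (pi * y))\<^sup>2)"
proof -
  have le1: "1 / real q \<le> 1" using q2 by simp
  have "real q * y < 1" "y < 1"
    using assms q_pos less_le_trans[OF assms(2) le1] by (auto simp: field_simps)
  hence "pi * (real q * y) < pi * 1" "pi * y < pi * 1"
    by (intro mult_strict_left_mono; simp)+
  hence pos: "0 < sin (pi * real q * y)" "0 < sin (pi * y)"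
    using assms q_pos by (auto intro!: sin_gt_zero simp: mult.assoc)
  let ?g = "\<lambda>y. pi * (real q * cot (pi * real q * y) - cot (pi * y))"
  have "(?g has_real_derivative pi * (real q * (- inverse ((sin (pi * real q * y))\<^sup>2) * (pi * real q))
      - (- inverse ((sin (pi * y))\<^sup>2) * pi))) (at y)"
    using pos by (intro DERIV_cmult DERIV_diff DERIV_chain2[OF DERIV_cot])
      (auto intro!: derivative_eq_intros)
  moreover have "(dpeak has_real_derivative - ddpeak y) (at y)" using assms by (intro dpeak_deriv) auto
  hence "(?g has_real_derivative - ddpeak y) (at y)"
    by (rule has_field_derivative_transform_within_open[where S = "{0<..<1 / real q}"])
       (use assms dpeak_eq in auto)
  ultimately have "- ddpeak y = pi * (real q * (- inverse ((sin (pi * real q * y))\<^sup>2) * (pi * real q))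
      - (- inverse ((sin (pi * y))\<^sup>2) * pi))" by (rule DERIV_unique[symmetric])
  also have "\<dots> = - (pi\<^sup>2 * ((real q)\<^sup>2 * inverse ((sin (pi * real q * y))\<^sup>2) - inverse ((sin (pi * y))\<^sup>2)))"
    by algebra
  finally show ?thesis by (simp add: divide_inverse)
qed

section \<open>The derivative of the sub-action\<close>

text \<open>A 1-periodic function on the line: subtracting the floor moves x into [q \<gamma>, q
  \<gamma> + 1), which division by q maps onto [\<gamma>, \<gamma> + 1/q).\<close>

definition branch :: "real \<Rightarrow> real \<Rightarrow> real" where
  "branch \<gamma> x = (x - of_int \<lfloor>x - real q * \<gamma>\<rfloor>) / real q"

text \<open>The derivative of the sub-action; \<open>jump\<close> below is its increment over one turn of the circle.\<close>
definition subder :: "real \<Rightarrow> real \<Rightarrow> real \<Rightarrow> real" where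
  "subder \<gamma> c x = (\<Sum>n. dpeak ((branch \<gamma> ^^ Suc n) x + c) / real q ^ Suc n)"

text \<open>The arc shifted by c has the peak 0 in its interior and stays inside (-1/q, 1/q), where
  \<open>peak\<close> is smooth.\<close>

definition adm :: "real \<Rightarrow> real \<Rightarrow> bool" where
  "adm \<gamma> c \<longleftrightarrow> - (1 / real q) < \<gamma> + c \<and> \<gamma> + c < 0"

definition jump :: "real \<Rightarrow> real \<Rightarrow> real" where
  "jump \<gamma> c = integral {real q * \<gamma>..real q * \<gamma> + 1} (subder \<gamma> c)"

lemma branch_ge: "\<gamma> \<le> branch \<gamma> x" and branch_less: "branch \<gamma> x < \<gamma> + 1 / real q"
proof -
  have "real q * \<gamma> \<le> x - of_int \<lfloor>x - real q * \<gamma>\<rfloor>" "x - of_int \<lfloor>x - real q * \<gamma>\<rfloor> < real q * \<gamma> + 1"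
    by linarith+
  hence "real q * \<gamma> / real q \<le> branch \<gamma> x" "branch \<gamma> x < (real q * \<gamma> + 1) / real q"
    unfolding branch_def using q_pos by (intro divide_right_mono divide_strict_right_mono; simp)+
  thus "\<gamma> \<le> branch \<gamma> x" "branch \<gamma> x < \<gamma> + 1 / real q"
    using q_pos by (simp_all add: add_divide_distrib)
qed

lemma branch_periodic: "branch \<gamma> (x + 1) = branch \<gamma> x"
proof -
  have "\<lfloor>x + 1 - real q * \<gamma>\<rfloor> = \<lfloor>x - real q * \<gamma>\<rfloor> + 1" by linarith
  thus ?thesis by (simp add: branch_def)
qed

lemma branch_eq: "real q * \<gamma> \<le> x \<Longrightarrow> x < real q * \<gamma> + 1 \<Longrightarrow> branch \<gamma> x = x / real q"
proof -
  assume "real q * \<gamma> \<le> x" "x < real q * \<gamma> + 1"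
  hence "\<lfloor>x - real q * \<gamma>\<rfloor> = 0" by linarith
  thus ?thesis by (simp add: branch_def)
qed

lemma branch_iter_ge: "\<gamma> \<le> (branch \<gamma> ^^ Suc n) x"
  and branch_iter_less: "(branch \<gamma> ^^ Suc n) x < \<gamma> + 1 / real q"
  by (simp_all add: branch_ge branch_less)

lemma branch_measurable [measurable]: "branch \<gamma> \<in> borel_measurable borel"
  unfolding branch_def[abs_def] by measurable

lemma branch_iter_measurable [measurable]: "(branch \<gamma> ^^ n) \<in> borel_measurable borel"
proof (induction n)
  case (Suc n)
  have "(\<lambda>x. branch \<gamma> ((branch \<gamma> ^^ n) x)) \<in> borel_measurable borel"
    using Suc by measurable
  thus ?case by (simp add: o_def)
qed (simp add: id_def)

lemma dpeak_measurable [measurable]: "dpeak \<in> borel_measurable borel"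
  unfolding dpeak_def[abs_def] cot_def by measurable

lemma subder_measurable [measurable]: "subder \<gamma> c \<in> borel_measurable borel"
  unfolding subder_def[abs_def] by measurable

lemma adm_dpeak:
  assumes "adm \<gamma> c" "\<gamma> \<le> x" "x \<le> \<gamma> + 1 / real q"
  shows "dpeak (\<gamma> + c + 1 / real q) \<le> dpeak (x + c)" "dpeak (x + c) \<le> dpeak (\<gamma> + c)"
  using assms by (auto intro!: dpeak_antimono simp: adm_def)

lemma adm_sign:
  assumes "adm \<gamma> c"
  shows "dpeak (\<gamma> + c + 1 / real q) < 0" "0 < dpeak (\<gamma> + c)"
proof -
  have "0 < pi\<^sup>2 * (\<gamma> + c + 1 / real q - 0)" "0 < pi\<^sup>2 * (0 - (\<gamma> + c))"
    using assms by (auto simp: adm_def intro!: mult_pos_neg)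
  moreover have "pi\<^sup>2 * (\<gamma> + c + 1 / real q - 0) \<le> dpeak 0 - dpeak (\<gamma> + c + 1 / real q)"
     "pi\<^sup>2 * (0 - (\<gamma> + c)) \<le> dpeak (\<gamma> + c) - dpeak 0"
    using assms q_pos by (intro dpeak_strong_antimono; simp add: adm_def)+
  ultimately show "dpeak (\<gamma> + c + 1 / real q) < 0" "0 < dpeak (\<gamma> + c)" by simp_all
qed

lemma geo_sums: "(\<lambda>n. C / real q ^ Suc n) sums (C / (real q - 1))"
proof -
  have "(\<lambda>n. (C / real q) * (1 / real q) ^ n) sums ((C / real q) * (1 / (1 - 1 / real q)))"
    using q_ge2 by (intro sums_mult geometric_sums) auto
  moreover have "(C / real q) * (1 / (1 - 1 / real q)) = C / (real q - 1)"
    using q_ge2 by (simp add: divide_simps)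
  moreover have "(\<lambda>n. (C / real q) * (1 / real q) ^ n) = (\<lambda>n. C / real q ^ Suc n)"
    by (simp add: power_divide fun_eq_iff)
  ultimately show ?thesis by (simp only:)
qed

lemma subder_summable:
  assumes "adm \<gamma> c"
  shows "summable (\<lambda>n. dpeak ((branch \<gamma> ^^ Suc n) x + c) / real q ^ Suc n)"
proof (rule summable_comparison_test)
  let ?C = "dpeak (\<gamma> + c) - dpeak (\<gamma> + c + 1 / real q)"
  show "summable (\<lambda>n. ?C / real q ^ Suc n)" using geo_sums sums_summable by blast
  have "\<bar>dpeak ((branch \<gamma> ^^ Suc n) x + c)\<bar> \<le> ?C" for n
    using adm_dpeak[OF assms branch_iter_ge less_imp_le[OF branch_iter_less], of n x]
      adm_sign[OF assms] by linarith
  thus "\<exists>N. \<forall>n\<ge>N. norm (dpeak ((branch \<gamma> ^^ Suc n) x + c) / real q ^ Suc n) \<le> ?C / real q ^ Suc n"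
    using q_pos by (auto simp: norm_divide divide_right_mono simp del: funpow.simps power_Suc)
qed

lemma subder_le:
  assumes "adm \<gamma> c"
  shows "subder \<gamma> c x \<le> dpeak (\<gamma> + c) / (real q - 1)"
proof -
  have "subder \<gamma> c x \<le> (\<Sum>n. dpeak (\<gamma> + c) / real q ^ Suc n)"
    unfolding subder_def
    using adm_dpeak[OF assms branch_iter_ge less_imp_le[OF branch_iter_less]] q_pos
    by (intro suminf_le subder_summable[OF assms] sums_summable[OF geo_sums] divide_right_mono)
       (auto simp del: funpow.simps)
  thus ?thesis using sums_unique[OF geo_sums] by simp
qed

lemma subder_ge:
  assumes "adm \<gamma> c"
  shows "dpeak (\<gamma> + c + 1 / real q) / (real q - 1) \<le> subder \<gamma> c x"
proof -
  have "(\<Sum>n. dpeak (\<gamma> + c + 1 / real q) / real q ^ Suc n) \<le> subder \<gamma> c x"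
    unfolding subder_def
    using adm_dpeak[OF assms branch_iter_ge less_imp_le[OF branch_iter_less]] q_pos
    by (intro suminf_le subder_summable[OF assms] sums_summable[OF geo_sums] divide_right_mono)
       (auto simp del: funpow.simps)
  thus ?thesis using sums_unique[OF geo_sums] by simp
qed

lemma subder_rec:
  assumes "adm \<gamma> c"
  shows "subder \<gamma> c x = (dpeak (branch \<gamma> x + c) + subder \<gamma> c (branch \<gamma> x)) / real q"
proof -
  have "subder \<gamma> c x = dpeak (branch \<gamma> x + c) / real q +
     (\<Sum>n. dpeak ((branch \<gamma> ^^ Suc (Suc n)) x + c) / real q ^ Suc (Suc n))"
    unfolding subder_def using suminf_split_head[OF subder_summable[OF assms, of x]]
    by (simp del: funpow.simps(2)) simp
  also have "(\<lambda>n. dpeak ((branch \<gamma> ^^ Suc (Suc n)) x + c) / real q ^ Suc (Suc n)) =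
     (\<lambda>n. 1 / real q * (dpeak ((branch \<gamma> ^^ Suc n) (branch \<gamma> x) + c) / real q ^ Suc n))"
    by (simp add: fun_eq_iff funpow_swap1)
  also have "suminf \<dots> = 1 / real q * subder \<gamma> c (branch \<gamma> x)"
    unfolding subder_def by (rule suminf_mult[OF subder_summable[OF assms]])
  finally show ?thesis by (simp add: add_divide_distrib)
qed

lemma subder_periodic: "subder \<gamma> c (x + 1) = subder \<gamma> c x"
  unfolding subder_def funpow_Suc_right o_def branch_periodic ..

lemma subder_bounded:
  assumes "adm \<gamma> c"
  shows "\<bar>subder \<gamma> c x\<bar> \<le> (dpeak (\<gamma> + c) - dpeak (\<gamma> + c + 1 / real q)) / (real q - 1)"
proof -
  have "dpeak (\<gamma> + c + 1 / real q) / (real q - 1) \<le> 0" "0 \<le> dpeak (\<gamma> + c) / (real q - 1)"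
    using adm_sign[OF assms] q_ge2 by (simp_all add: divide_nonpos_pos)
  thus ?thesis using subder_le[OF assms, of x] subder_ge[OF assms, of x]
    unfolding diff_divide_distrib by linarith
qed

lemma subder_integrable: "adm \<gamma> c \<Longrightarrow> subder \<gamma> c integrable_on {a..b}"
  by (rule integrable_on_bounded_borel[OF subder_measurable subder_bounded])

text \<open>\<open>subder_rec\<close> integrated with the substitution t = x/q; it becomes the
  cohomological equation \<open>psi_branch\<close>.\<close>

lemma subder_integral_branch:
  assumes "adm \<gamma> c" "real q * \<gamma> \<le> x" "x \<le> real q * \<gamma> + 1"
  shows "integral {real q * \<gamma>..x} (subder \<gamma> c) =
     peak (x / real q + c) - peak (\<gamma> + c) + integral {\<gamma>..x / real q} (subder \<gamma> c)"
proof -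
  let ?h = "\<lambda>t. dpeak (t + c) + subder \<gamma> c t"
  have x: "\<gamma> \<le> x / real q" "x / real q \<le> \<gamma> + 1 / real q"
    using assms q_pos by (auto simp: field_simps)
  have ftc: "((\<lambda>t. dpeak (t + c)) has_integral (peak (x / real q + c) - peak (\<gamma> + c))) {\<gamma>..x / real q}"
  proof (rule fundamental_theorem_of_calculus[OF x(1)])
    fix t assume "t \<in> {\<gamma>..x / real q}"
    hence "\<bar>t + c\<bar> < 1 / real q" using x assms(1) by (auto simp: adm_def)
    from peak_deriv[OF this]
    have "((\<lambda>t. peak (t + c)) has_real_derivative dpeak (t + c)) (at t)"
      by (simp add: DERIV_shift)
    thus "((\<lambda>t. peak (t + c)) has_vector_derivative dpeak (t + c)) (at t within {\<gamma>..x / real q})"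
      by (auto simp: has_real_derivative_iff_has_vector_derivative intro: has_vector_derivative_at_within)
  qed
  have hi: "(?h has_integral (peak (x / real q + c) - peak (\<gamma> + c) + integral {\<gamma>..x / real q} (subder \<gamma> c))) {\<gamma>..x / real q}"
    by (intro has_integral_add ftc integrable_integral subder_integrable assms)
  have "integral {real q * \<gamma>..x} (subder \<gamma> c) = integral {real q * \<gamma>..x} (\<lambda>t. ?h (t / real q) / real q)"
  \<comment> \<open>\<open>branch\<close> jumps back to \<gamma> at the right end of the period, so
    this single point is left out.\<close>
  proof (rule integral_spike[of "{real q * \<gamma> + 1}"])
    fix t assume "t \<in> {real q * \<gamma>..x} - {real q * \<gamma> + 1}"
    hence "branch \<gamma> t = t / real q" using assms by (intro branch_eq) auto
    thus "?h (t / real q) / real q = subder \<gamma> c t" using subder_rec[OF assms(1), of t] by simp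
  qed auto
  also have "\<dots> = integral {real q * \<gamma>..x} (\<lambda>t. ?h (t / real q)) / real q" by simp
  also have "\<dots> = integral {real q * \<gamma> / real q..x / real q} ?h"
    using integral_divide_real(1)[of ?h "real q * \<gamma>" "real q" x] hi q_pos
    by (auto simp: integrable_on_def)
  also have "\<dots> = peak (x / real q + c) - peak (\<gamma> + c) + integral {\<gamma>..x / real q} (subder \<gamma> c)"
    using integral_unique[OF hi] q_pos by simp
  finally show ?thesis .
qed

lemma jump_eq:
  assumes "adm \<gamma> c"
  shows "jump \<gamma> c = peak (\<gamma> + c + 1 / real q) - peak (\<gamma> + c) + integral {\<gamma>..\<gamma> + 1 / real q} (subder \<gamma> c)"
proof -
  have "(real q * \<gamma> + 1) / real q = \<gamma> + 1 / real q" using q_pos by (simp add: field_simps)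
  moreover have "\<gamma> + 1 / real q + c = \<gamma> + c + 1 / real q" by simp
  ultimately show ?thesis
    using subder_integral_branch[OF assms, of "real q * \<gamma> + 1"] by (simp only: jump_def)
qed

lemma jump_le:
  assumes "adm \<gamma> c"
  shows "jump \<gamma> c \<le> peak (\<gamma> + c + 1 / real q) - peak (\<gamma> + c) + dpeak (\<gamma> + c) / (real q * (real q - 1))"
proof -
  have "integral {\<gamma>..\<gamma> + 1 / real q} (subder \<gamma> c) \<le> integral {\<gamma>..\<gamma> + 1 / real q} (\<lambda>_. dpeak (\<gamma> + c) / (real q - 1))"
    using subder_integrable[OF assms] subder_le[OF assms] by (intro integral_le) auto
  thus ?thesis using q_pos by (simp add: jump_eq[OF assms])
qed

lemma jump_ge:
  assumes "adm \<gamma> c"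
  shows "peak (\<gamma> + c + 1 / real q) - peak (\<gamma> + c) + dpeak (\<gamma> + c + 1 / real q) / (real q * (real q - 1)) \<le> jump \<gamma> c"
proof -
  have "integral {\<gamma>..\<gamma> + 1 / real q} (\<lambda>_. dpeak (\<gamma> + c + 1 / real q) / (real q - 1)) \<le> integral {\<gamma>..\<gamma> + 1 / real q} (subder \<gamma> c)"
    using subder_integrable[OF assms] subder_ge[OF assms] by (intro integral_le) auto
  thus ?thesis using q_pos by (simp add: jump_eq[OF assms])
qed

section \<open>The phase of an arc\<close>

text \<open>The numerator |sin (pi q y)| of \<open>peak_eq\<close> has the same value at -a and at
  1/q - a, so only the denominators remain.\<close>

lemma peak_diff_end:
  assumes "0 < a" "a < 1 / real q"
  shows "peak (1 / real q - a) - peak (- a) = ln (sin (pi * a)) - ln (sin (pi * (1 / real q - a)))"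
proof -
  define b where "b = 1 / real q - a"
  have le1: "1 / real q \<le> 1" using q2 by simp
  have ab: "0 < b" "b < 1 / real q" "a + b = 1 / real q" using assms by (auto simp: b_def)
  have pos: "0 < sin (pi * real q * x)" "0 < sin (pi * x)" if "0 < x" "x < 1 / real q" for x
  proof -
    have "real q * x < 1" "x < 1"
      using that q_pos less_le_trans[OF _ le1, of x] by (auto simp: field_simps)
    hence "pi * (real q * x) < pi * 1" "pi * x < pi * 1"
      by (intro mult_strict_left_mono; simp)+
    thus "0 < sin (pi * real q * x)" "0 < sin (pi * x)"
      using that q_pos by (auto intro!: sin_gt_zero simp: mult.assoc)
  qed
  have pk: "peak x = ln (sin (pi * real q * x)) - ln (sin (pi * x))" if "0 < x" "x < 1 / real q" for x
    using pos[OF that] peak_eq[of x] that by (simp add: ln_div)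
  have "pi * real q * b = pi - pi * real q * a"
    using q_pos by (simp add: b_def field_simps)
  hence "sin (pi * real q * b) = sin (pi * real q * a)" by simp
  thus ?thesis using pk[of a] pk[of b] peak_minus[of a] assms ab
    by (simp add: b_def[symmetric])
qed

text \<open>When an end of the arc approaches the peak, the logarithm in
  \<open>peak_diff_end\<close> diverges while the \<open>dpeak\<close> term of
  \<open>jump_le\<close> or \<open>jump_ge\<close> stays bounded. The threshold \<open>a0\<close> is
  uniform in \<gamma>.\<close>

lemma jump_sign:
  obtains a0 where "0 < a0" "a0 < 1 / (2 * real q)"
    "\<And>\<gamma> c. adm \<gamma> c \<Longrightarrow> - (\<gamma> + c) \<le> a0 \<Longrightarrow> jump \<gamma> c < 0"
    "\<And>\<gamma> c. adm \<gamma> c \<Longrightarrow> \<gamma> + c + 1 / real q \<le> a0 \<Longrightarrow> 0 < jump \<gamma> c"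
proof -
  define A where "A = dpeak (- (1 / (2 * real q))) / (real q * (real q - 1))"
  \<comment> \<open>ln S = ln (sin (pi/(2 q))) - A is exactly the value below which ln (sin (pi a))
    makes \<open>key\<close> positive.\<close>
  define S where "S = sin (pi * (1 / (2 * real q))) * exp (- A)"
  define m where "m = min (1 / (2 * real q)) (S / pi)"
  define a0 where "a0 = m / 2"
  have h: "0 < 1 / (2 * real q)" "1 / (2 * real q) < 1 / 2" "1 / (2 * real q) \<le> 1 / 4" using q_ge2
    by (auto simp: field_simps)
  have qh: "1 / real q = 2 * (1 / (2 * real q))" by simp
  have "pi * (1 / (2 * real q)) < pi * 1" using h by (intro mult_strict_left_mono) auto
  hence sh: "0 < sin (pi * (1 / (2 * real q)))" using h by (intro sin_gt_zero) auto
  hence "0 < S" by (simp add: S_def)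
  hence a0: "0 < a0" "a0 < 1 / (2 * real q)" and "a0 < S / pi"
  proof -
    have "0 < m" "m \<le> 1 / (2 * real q)" "m \<le> S / pi" using h \<open>0 < S\<close> by (auto simp: m_def)
    thus "0 < a0" "a0 < 1 / (2 * real q)" "a0 < S / pi" unfolding a0_def by linarith+
  qed
  hence a0': "pi * a0 < S" by (simp add: field_simps)
  have key: "0 < ln (sin (pi * (1 / real q - a))) - ln (sin (pi * a)) - dpeak (- a) / (real q * (real q - 1))"
    if a: "0 < a" "a \<le> a0" for a
  proof -
    have sa: "0 < sin (pi * a)" "sin (pi * a) < S"
    proof -
      have "a < 1" using a a0 h by linarith
      hence "pi * a < pi * 1" by (intro mult_strict_left_mono) auto
      thus "0 < sin (pi * a)" using a by (intro sin_gt_zero) auto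
      have "sin (pi * a) \<le> pi * a" using a by (intro sin_x_le_x) auto
      also have "\<dots> \<le> pi * a0" using a by simp
      also have "\<dots> < S" by (rule a0')
      finally show "sin (pi * a) < S" .
    qed
    have "dpeak (- a) / (real q * (real q - 1)) \<le> A"
      unfolding A_def using a a0 qh h q_ge2 by (intro divide_right_mono dpeak_antimono) auto
    moreover have "ln (sin (pi * (1 / (2 * real q)))) \<le> ln (sin (pi * (1 / real q - a)))"
    proof -
      have "1 / real q - a \<le> 1 / 2" "1 / (2 * real q) \<le> 1 / real q - a" using a a0 qh h by linarith+
      hence "pi * (1 / real q - a) \<le> pi * (1 / 2)" "pi * (1 / (2 * real q)) \<le> pi * (1 / real q - a)"
        by (intro mult_left_mono; simp)+
      moreover have "- pi / 2 \<le> 0" "0 \<le> pi * (1 / (2 * real q))" using h by simp_all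
      hence "- pi / 2 \<le> pi * (1 / (2 * real q))" by linarith
      ultimately have "sin (pi * (1 / (2 * real q))) \<le> sin (pi * (1 / real q - a))"
        by (intro sin_monotone_2pi_le) auto
      thus ?thesis using sh by simp
    qed
    moreover have "ln (sin (pi * a)) < ln S" using sa by simp
    moreover have "ln S = ln (sin (pi * (1 / (2 * real q)))) - A"
      unfolding S_def using sh by (simp add: ln_mult)
    ultimately show ?thesis by linarith
  qed
  show thesis
  proof (rule that[OF a0(1,2)])
    fix \<gamma> c assume adm: "adm \<gamma> c"
    define a where "a = - (\<gamma> + c)"
    have a: "0 < a" "a < 1 / real q" using adm by (auto simp: adm_def a_def)
    have eq: "\<gamma> + c = - a" "\<gamma> + c + 1 / real q = 1 / real q - a" by (auto simp: a_def)
    note J = jump_le[OF adm, unfolded eq] jump_ge[OF adm, unfolded eq] peak_diff_end[OF a]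
    show "jump \<gamma> c < 0" if "- (\<gamma> + c) \<le> a0"
      using key[of a] J a that unfolding eq by simp
    \<comment> \<open>The other end is the mirror image: \<open>dpeak\<close> is odd, so
      \<open>key\<close> applies with \<open>1 / real q - a\<close> in place of
      \<open>a\<close>.\<close>
    have "dpeak (- (1 / real q - a)) = - dpeak (1 / real q - a)" by (rule dpeak_minus)
    thus "0 < jump \<gamma> c" if "\<gamma> + c + 1 / real q \<le> a0"
      using key[of "1 / real q - a"] J a that unfolding eq by simp
  qed
qed

text \<open>Each term drops at rate at least pi^2 in c, and the weights q^-(n + 1) sum to 1/(q -
  1).\<close>

lemma subder_diff_c:
  assumes "adm \<gamma> c" "adm \<gamma> c'" "c \<le> c'"
  shows "pi\<^sup>2 * (c' - c) / (real q - 1) \<le> subder \<gamma> c x - subder \<gamma> c' x"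
proof -
  have "pi\<^sup>2 * (c' - c) / real q ^ Suc n \<le>
      dpeak ((branch \<gamma> ^^ Suc n) x + c) / real q ^ Suc n - dpeak ((branch \<gamma> ^^ Suc n) x + c') / real q ^ Suc n" for n
  proof -
    have "pi\<^sup>2 * (((branch \<gamma> ^^ Suc n) x + c') - ((branch \<gamma> ^^ Suc n) x + c)) \<le>
       dpeak ((branch \<gamma> ^^ Suc n) x + c) - dpeak ((branch \<gamma> ^^ Suc n) x + c')"
      using assms branch_iter_ge[where \<gamma> = \<gamma> and n = n and x = x] branch_iter_less[where \<gamma> = \<gamma> and n = n and x = x]
      by (intro dpeak_strong_antimono) (auto simp: adm_def simp del: funpow.simps)
    thus ?thesis unfolding diff_divide_distrib[symmetric] by (intro divide_right_mono) auto
  qed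
  hence "(\<Sum>n. pi\<^sup>2 * (c' - c) / real q ^ Suc n) \<le> (\<Sum>n. dpeak ((branch \<gamma> ^^ Suc n) x + c) / real q ^ Suc n -
       dpeak ((branch \<gamma> ^^ Suc n) x + c') / real q ^ Suc n)"
    by (intro suminf_le summable_diff subder_summable sums_summable[OF geo_sums] assms)
  thus ?thesis unfolding sums_unique[OF geo_sums, symmetric] subder_def
    by (simp only: suminf_diff[OF subder_summable[OF assms(1)] subder_summable[OF assms(2)]])
qed

lemma jump_diff_c:
  assumes "adm \<gamma> c" "adm \<gamma> c'" "c \<le> c'"
  shows "pi\<^sup>2 * (c' - c) / (real q - 1) \<le> jump \<gamma> c - jump \<gamma> c'"
proof -
  have "integral {real q * \<gamma>..real q * \<gamma> + 1} (\<lambda>x. pi\<^sup>2 * (c' - c) / (real q - 1)) \<le>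
     integral {real q * \<gamma>..real q * \<gamma> + 1} (\<lambda>x. subder \<gamma> c x - subder \<gamma> c' x)"
    using subder_diff_c[OF assms] subder_integrable assms by (intro integral_le integrable_diff) auto
  also have "\<dots> = jump \<gamma> c - jump \<gamma> c'"
    unfolding jump_def using subder_integrable assms by (intro Henstock_Kurzweil_Integration.integral_diff) auto
  finally show ?thesis by simp
qed

text \<open>\<open>dpeak\<close> has poles at 1/q and -1/q; the margin \<open>e\<close> keeps the
  arguments away from them.\<close>

lemma dpeak_lipschitz:
  assumes "0 < e"
  obtains K where "0 < K" "\<And>x y. \<bar>x\<bar> \<le> 1 / real q - e \<Longrightarrow> \<bar>y\<bar> \<le> 1 / real q - e \<Longrightarrow> \<bar>dpeak x - dpeak y\<bar> \<le> K * \<bar>x - y\<bar>"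
proof -
  let ?I = "{- (1 / real q - e)..1 / real q - e}"
  have "continuous_on ?I ddpeak"
    unfolding ddpeak_def[abs_def]
  proof (intro continuous_intros ballI)
    fix y k assume "y \<in> ?I" "k \<in> {1..<q}"
    hence "0 < sin (pi * (y + real k / real q))" using assms by (intro peak_arg) auto
    thus "(sin (pi * (y + real k / real q)))\<^sup>2 \<noteq> 0" by simp
  qed
  hence "bounded (ddpeak ` ?I)" by (intro compact_imp_bounded compact_continuous_image) auto
  then obtain K where K: "0 < K" "\<And>y. y \<in> ?I \<Longrightarrow> \<bar>ddpeak y\<bar> \<le> K"
    unfolding bounded_pos by auto
  have *: "\<bar>dpeak x - dpeak y\<bar> \<le> K * \<bar>x - y\<bar>" if "x < y" "\<bar>x\<bar> \<le> 1 / real q - e" "\<bar>y\<bar> \<le> 1 / real q - e" for x y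
  proof -
    have "- (1 / real q) < x" "x < y" "y < 1 / real q" using that assms by linarith+
    then obtain z where z: "x < z" "z < y" "dpeak x - dpeak y = (y - x) * ddpeak z"
      by (rule dpeak_diff)
    have "\<bar>dpeak x - dpeak y\<bar> = \<bar>ddpeak z\<bar> * \<bar>x - y\<bar>" unfolding z(3) abs_mult by (simp add: abs_minus_commute)
    also have "\<dots> \<le> K * \<bar>x - y\<bar>" using z that by (intro mult_right_mono K) auto
    finally show ?thesis .
  qed
  show thesis
  proof (rule that[OF K(1)])
    fix x y assume a: "\<bar>x\<bar> \<le> 1 / real q - e" "\<bar>y\<bar> \<le> 1 / real q - e"
    show "\<bar>dpeak x - dpeak y\<bar> \<le> K * \<bar>x - y\<bar>"
      using *[of x y] *[of y x] a by (cases x y rule: linorder_cases) (auto simp: abs_minus_commute)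
  qed
qed

lemma adm_margin:
  assumes "0 < e" "- (1 / real q) + e \<le> \<gamma> + c" "\<gamma> + c \<le> - e"
  shows "adm \<gamma> c" "\<gamma> \<le> x \<Longrightarrow> x \<le> \<gamma> + 1 / real q \<Longrightarrow> \<bar>x + c\<bar> \<le> 1 / real q - e"
  using assms by (auto simp: adm_def abs_le_iff)

lemma jump_continuous_c:
  assumes "0 < e"
  shows "continuous_on {- (1 / real q) + e - \<gamma>..- e - \<gamma>} (jump \<gamma>)"
proof -
  obtain K where K: "0 < K" "\<And>x y. \<bar>x\<bar> \<le> 1 / real q - e \<Longrightarrow> \<bar>y\<bar> \<le> 1 / real q - e \<Longrightarrow> \<bar>dpeak x - dpeak y\<bar> \<le> K * \<bar>x - y\<bar>"
    using dpeak_lipschitz[OF assms] by blast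
  have main: "jump \<gamma> c - jump \<gamma> c' \<le> K / (real q - 1) * \<bar>c - c'\<bar>"
    if c: "c \<in> {- (1 / real q) + e - \<gamma>..- e - \<gamma>}" "c' \<in> {- (1 / real q) + e - \<gamma>..- e - \<gamma>}" for c c'
  proof -
    have c1: "- (1 / real q) + e \<le> \<gamma> + c" "\<gamma> + c \<le> - e" "- (1 / real q) + e \<le> \<gamma> + c'" "\<gamma> + c' \<le> - e"
      using c by auto
    note adm = adm_margin(1)[OF assms c1(1,2)] adm_margin(1)[OF assms c1(3,4)]
    note mar = adm_margin(2)[OF assms c1(1,2)] adm_margin(2)[OF assms c1(3,4)]
    have D: "subder \<gamma> c x - subder \<gamma> c' x \<le> K * \<bar>c - c'\<bar> / (real q - 1)" for x
    proof -
      have "dpeak ((branch \<gamma> ^^ Suc n) x + c) / real q ^ Suc n - dpeak ((branch \<gamma> ^^ Suc n) x + c') / real q ^ Suc n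
         \<le> K * \<bar>c - c'\<bar> / real q ^ Suc n" for n
      proof -
        have "\<bar>dpeak ((branch \<gamma> ^^ Suc n) x + c) - dpeak ((branch \<gamma> ^^ Suc n) x + c')\<bar> \<le>
          K * \<bar>((branch \<gamma> ^^ Suc n) x + c) - ((branch \<gamma> ^^ Suc n) x + c')\<bar>"
          by (intro K(2) mar branch_iter_ge less_imp_le[OF branch_iter_less])
        thus ?thesis unfolding diff_divide_distrib[symmetric] by (intro divide_right_mono) auto
      qed
      hence "(\<Sum>n. dpeak ((branch \<gamma> ^^ Suc n) x + c) / real q ^ Suc n -
           dpeak ((branch \<gamma> ^^ Suc n) x + c') / real q ^ Suc n) \<le> (\<Sum>n. K * \<bar>c - c'\<bar> / real q ^ Suc n)"
        by (intro suminf_le summable_diff subder_summable sums_summable[OF geo_sums] adm)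
      thus ?thesis unfolding sums_unique[OF geo_sums, symmetric] subder_def
        by (simp only: suminf_diff[OF subder_summable[OF adm(1)] subder_summable[OF adm(2)]])
    qed
    have "jump \<gamma> c - jump \<gamma> c' = integral {real q * \<gamma>..real q * \<gamma> + 1} (\<lambda>x. subder \<gamma> c x - subder \<gamma> c' x)"
      unfolding jump_def using subder_integrable adm by (intro Henstock_Kurzweil_Integration.integral_diff[symmetric]) auto
    also have "\<dots> \<le> integral {real q * \<gamma>..real q * \<gamma> + 1} (\<lambda>x. K * \<bar>c - c'\<bar> / (real q - 1))"
      using D subder_integrable adm by (intro integral_le integrable_diff) auto
    finally show ?thesis by simp
  qed
  have "(K / (real q - 1))-lipschitz_on {- (1 / real q) + e - \<gamma>..- e - \<gamma>} (jump \<gamma>)"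
  proof (rule lipschitz_onI)
    fix x y assume xy: "x \<in> {- (1 / real q) + e - \<gamma>..- e - \<gamma>}" "y \<in> {- (1 / real q) + e - \<gamma>..- e - \<gamma>}"
    show "dist (jump \<gamma> x) (jump \<gamma> y) \<le> K / (real q - 1) * dist x y"
      using main[OF xy] main[OF xy(2,1)] by (simp add: dist_real_def abs_minus_commute abs_le_iff)
  qed (use K q_ge2 in simp)
  thus ?thesis by (rule lipschitz_on_continuous_on)
qed

lemma jump_root_unique:
  assumes "adm \<gamma> c" "adm \<gamma> c'" "jump \<gamma> c = jump \<gamma> c'"
  shows "c = c'"
proof -
  have "x = y" if "adm \<gamma> x" "adm \<gamma> y" "jump \<gamma> x = jump \<gamma> y" "x \<le> y" for x y
  proof (rule ccontr)
    assume "x \<noteq> y"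
    hence "0 < pi\<^sup>2 * (y - x) / (real q - 1)" using that q_ge2 by simp
    thus False using jump_diff_c[OF that(1,2,4)] that(3) by simp
  qed
  from this[of c c'] this[of c' c] show ?thesis using assms by linarith
qed

lemma jump_root_exists: "\<exists>c. adm \<gamma> c \<and> jump \<gamma> c = 0"
proof -
  obtain a0 where a0: "0 < a0" "a0 < 1 / (2 * real q)"
    "\<And>\<gamma> c. adm \<gamma> c \<Longrightarrow> - (\<gamma> + c) \<le> a0 \<Longrightarrow> jump \<gamma> c < 0"
    "\<And>\<gamma> c. adm \<gamma> c \<Longrightarrow> \<gamma> + c + 1 / real q \<le> a0 \<Longrightarrow> 0 < jump \<gamma> c"
    by (rule jump_sign) blast
  have qh: "1 / real q = 2 * (1 / (2 * real q))" by simp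
  define l where "l = - (1 / real q) + a0 - \<gamma>"
  define r where "r = - a0 - \<gamma>"
  have lr: "l \<le> r" "adm \<gamma> l" "adm \<gamma> r" using a0(1,2) qh by (auto simp: adm_def l_def r_def)
  have "0 < jump \<gamma> l" "jump \<gamma> r < 0" using a0(3,4) lr by (auto simp: l_def r_def)
  moreover have "continuous_on {l..r} (jump \<gamma>)"
    unfolding l_def r_def by (rule jump_continuous_c[OF a0(1)])
  ultimately obtain c where c: "l \<le> c" "c \<le> r" "jump \<gamma> c = 0"
    using IVT2'[of "jump \<gamma>" r 0 l] lr(1) by auto
  moreover have "adm \<gamma> c" using c lr by (auto simp: adm_def)
  ultimately show ?thesis by blast
qed

definition cphase :: "real \<Rightarrow> real" where
  "cphase \<gamma> = (THE c. adm \<gamma> c \<and> jump \<gamma> c = 0)"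

lemma cphase: "adm \<gamma> (cphase \<gamma>)" "jump \<gamma> (cphase \<gamma>) = 0"
proof -
  have "\<exists>!c. adm \<gamma> c \<and> jump \<gamma> c = 0"
    using jump_root_exists jump_root_unique by metis
  from theI'[OF this] show "adm \<gamma> (cphase \<gamma>)" "jump \<gamma> (cphase \<gamma>) = 0"
    by (auto simp: cphase_def)
qed

text \<open>The two functions satisfy the same recursion off a set of measure \<open>q * (\<gamma>' - \<gamma>)\<close> per period,
  and in \<open>L\<^sup>2\<close> the recursion contracts by the factor \<open>1 / q\<close>.\<close>
lemma subder_L2_diff:
  assumes "adm \<gamma> c" "adm \<gamma>' c" "\<gamma> \<le> \<gamma>'" "\<gamma>' < \<gamma> + 1 / real q"
    and M: "\<And>x. \<bar>subder \<gamma> c x\<bar> \<le> M" "\<And>x. \<bar>subder \<gamma>' c x\<bar> \<le> M"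
  shows "integral {real q * \<gamma>..real q * \<gamma> + 1} (\<lambda>x. (subder \<gamma> c x - subder \<gamma>' c x)\<^sup>2) \<le> 8 * M\<^sup>2 * real q * (\<gamma>' - \<gamma>)"
proof -
  let ?w = "\<lambda>x. (subder \<gamma> c x - subder \<gamma>' c x)\<^sup>2"
  let ?E = "integral {real q * \<gamma>..real q * \<gamma> + 1} ?w"
  have wb: "?w x \<le> (2 * M)\<^sup>2" for x
  proof -
    have "\<bar>subder \<gamma> c x - subder \<gamma>' c x\<bar> \<le> \<bar>2 * M\<bar>" using M(1)[of x] M(2)[of x] by linarith
    thus ?thesis by (simp add: abs_le_square_iff)
  qed
  have wi: "?w integrable_on {a..b}" for a b
    by (rule integrable_on_bounded_borel[of _ "(2 * M)\<^sup>2"]) (use wb in auto)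
  have order: "real q * \<gamma> \<le> real q * \<gamma>'" "real q * \<gamma>' \<le> real q * \<gamma> + 1"
    using assms q_pos by (auto simp: field_simps)
  \<comment> \<open>Here the two branches differ and only the trivial bound on the integrand is
    available; the interval has length q (\<gamma>' - \<gamma>).\<close>
  have "integral {real q * \<gamma>..real q * \<gamma>'} ?w \<le> integral {real q * \<gamma>..real q * \<gamma>'} (\<lambda>_. (2 * M)\<^sup>2)"
    by (intro integral_le wi wb) auto
  hence 1: "integral {real q * \<gamma>..real q * \<gamma>'} ?w \<le> 4 * M\<^sup>2 * real q * (\<gamma>' - \<gamma>)"
    using order by (simp add: power_mult_distrib algebra_simps)
  have "integral {real q * \<gamma>'..real q * \<gamma> + 1} ?w = integral {real q * \<gamma>'..real q * \<gamma> + 1} (\<lambda>x. ?w (x / real q) / (real q)\<^sup>2)"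
  proof (rule integral_spike[of "{real q * \<gamma> + 1}"])
    fix x assume "x \<in> {real q * \<gamma>'..real q * \<gamma> + 1} - {real q * \<gamma> + 1}"
    hence "branch \<gamma> x = x / real q" "branch \<gamma>' x = x / real q"
      using order by (auto intro!: branch_eq)
    hence "subder \<gamma> c x - subder \<gamma>' c x = (subder \<gamma> c (x / real q) - subder \<gamma>' c (x / real q)) / real q"
      using subder_rec[OF assms(1), of x] subder_rec[OF assms(2), of x] by (simp add: diff_divide_distrib[symmetric])
    thus "?w (x / real q) / (real q)\<^sup>2 = ?w x" by (simp add: power_divide)
  qed auto
  also have "\<dots> = integral {real q * \<gamma>'..real q * \<gamma> + 1} (\<lambda>x. ?w (x / real q)) / (real q)\<^sup>2" by simp
  \<comment> \<open>The square gives 1/q^2 and the change of variables gives back q, a net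
    contraction by 1/q.\<close>
  also have "\<dots> = integral {\<gamma>'..\<gamma> + 1 / real q} ?w / real q"
    using integral_divide_real(1)[OF wi q_pos, of "real q * \<gamma>'" "real q * \<gamma> + 1"] q_pos
    by (simp add: power2_eq_square add_divide_distrib)
  also have "\<dots> \<le> integral {\<gamma>..\<gamma> + 1} ?w / real q"
  proof (intro divide_right_mono integral_subset_le wi)
    have "1 / real q \<le> 1" using q_ge2 by simp
    thus "{\<gamma>'..\<gamma> + 1 / real q} \<subseteq> {\<gamma>..\<gamma> + 1}" using assms(3) by auto
  qed auto
  also have "integral {\<gamma>..\<gamma> + 1} ?w = ?E"
    by (rule integral_period[OF _ wi]) (simp add: subder_periodic)
  finally have 2: "integral {real q * \<gamma>'..real q * \<gamma> + 1} ?w \<le> ?E / real q" .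
  have "?E = integral {real q * \<gamma>..real q * \<gamma>'} ?w + integral {real q * \<gamma>'..real q * \<gamma> + 1} ?w"
    by (rule Henstock_Kurzweil_Integration.integral_combine[symmetric]) (use order wi in auto)
  hence 3: "?E \<le> 4 * M\<^sup>2 * real q * (\<gamma>' - \<gamma>) + ?E / real q" using 1 2 by linarith
  have "0 \<le> ?E" by (intro integral_nonneg wi) auto
  hence "?E / real q \<le> ?E / 2" using q_ge2 by (intro divide_left_mono) auto
  with 3 show ?thesis by linarith
qed

text \<open>The L^2 bound is of order e^2 with e = sqrt (\<gamma>' - \<gamma>). The pointwise
  inequality |d| \<le> e/2 + d^2/(2 e) turns it into an L^1 bound of order e.\<close>

lemma jump_holder:
  assumes "adm \<gamma> c" "adm \<gamma>' c" "\<gamma> \<le> \<gamma>'" "\<gamma>' < \<gamma> + 1 / real q"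
    and M: "\<And>x. \<bar>subder \<gamma> c x\<bar> \<le> M" "\<And>x. \<bar>subder \<gamma>' c x\<bar> \<le> M"
  shows "\<bar>jump \<gamma> c - jump \<gamma>' c\<bar> \<le> (1 + 4 * M\<^sup>2 * real q) * sqrt (\<gamma>' - \<gamma>)"
proof (cases "\<gamma> = \<gamma>'")
  case False
  define e where "e = sqrt (\<gamma>' - \<gamma>)"
  have e: "0 < e" "e\<^sup>2 = \<gamma>' - \<gamma>" using False assms(3) by (auto simp: e_def)
  let ?d = "\<lambda>x. subder \<gamma> c x - subder \<gamma>' c x"
  let ?J = "{real q * \<gamma>..real q * \<gamma> + 1}"
  have di: "?d integrable_on {a..b}" for a b by (intro integrable_diff subder_integrable assms)
  have dM: "\<bar>?d x\<bar> \<le> 2 * M" for x using M(1)[of x] M(2)[of x] by linarith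
  have wi: "(\<lambda>x. (?d x)\<^sup>2) integrable_on {a..b}" for a b
  proof (rule integrable_on_bounded_borel)
    show "\<bar>(?d x)\<^sup>2\<bar> \<le> (2 * M)\<^sup>2" for x
      using order_trans[OF dM abs_ge_self, of x] unfolding abs_le_square_iff by simp
  qed measurable
  have pt: "\<bar>?d x\<bar> \<le> e / 2 + (?d x)\<^sup>2 / (2 * e)" for x
  proof -
    have "2 * e * \<bar>z\<bar> \<le> e\<^sup>2 + z\<^sup>2" for z :: real
      using zero_le_power2[of "\<bar>z\<bar> - e"] by (simp add: power2_diff mult_ac)
    hence "2 * e * \<bar>?d x\<bar> / (2 * e) \<le> (e\<^sup>2 + (?d x)\<^sup>2) / (2 * e)"
      using e(1) by (intro divide_right_mono) auto
    thus ?thesis using e(1) by (simp add: add_divide_distrib power2_eq_square)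
  qed
  have "jump \<gamma>' c = integral ?J (subder \<gamma>' c)"
    unfolding jump_def by (rule integral_period) (auto intro: subder_periodic subder_integrable assms)
  hence "jump \<gamma> c - jump \<gamma>' c = integral ?J ?d"
    unfolding jump_def[of \<gamma>] by (simp add: Henstock_Kurzweil_Integration.integral_diff subder_integrable assms)
  also have "\<bar>\<dots>\<bar> \<le> integral ?J (\<lambda>x. e / 2 + (?d x)\<^sup>2 / (2 * e))"
    unfolding real_norm_def[symmetric]
    by (rule integral_norm_bound_integral) (use pt wi di in \<open>auto intro!: integrable_add integrable_on_divide\<close>)
  also have "\<dots> = e / 2 + integral ?J (\<lambda>x. (?d x)\<^sup>2) / (2 * e)"
    using wi by (subst Henstock_Kurzweil_Integration.integral_add) (auto intro: integrable_on_divide)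
  also have "\<dots> \<le> e / 2 + (8 * M\<^sup>2 * real q * e\<^sup>2) / (2 * e)"
    using subder_L2_diff[OF assms] e by (intro add_left_mono divide_right_mono) auto
  also have "\<dots> = (1 / 2 + 4 * M\<^sup>2 * real q) * e" using e(1) by (simp add: power2_eq_square algebra_simps)
  also have "\<dots> \<le> (1 + 4 * M\<^sup>2 * real q) * e" using e(1) by (intro mult_right_mono) auto
  finally show ?thesis by (simp add: e_def)
qed simp

text \<open>By \<open>jump_sign\<close> every root keeps distance \<open>a0\<close> from the ends of
  the admissible range, uniformly in \<gamma>. Half of this margin is spent on moving \<gamma> with
  c fixed, where \<open>jump_holder\<close> applies; \<open>jump_diff_c\<close> converts the change
  of \<open>jump\<close> into a change of c.\<close>

lemma cphase_holder:
  obtains d H where "0 < d" "0 < H"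
    "\<And>\<gamma> \<gamma>'. \<bar>\<gamma> - \<gamma>'\<bar> \<le> d \<Longrightarrow> \<bar>cphase \<gamma> - cphase \<gamma>'\<bar> \<le> H * sqrt \<bar>\<gamma> - \<gamma>'\<bar>"
proof -
  obtain a0 where a0: "0 < a0" "a0 < 1 / (2 * real q)"
    "\<And>\<gamma> c. adm \<gamma> c \<Longrightarrow> - (\<gamma> + c) \<le> a0 \<Longrightarrow> jump \<gamma> c < 0"
    "\<And>\<gamma> c. adm \<gamma> c \<Longrightarrow> \<gamma> + c + 1 / real q \<le> a0 \<Longrightarrow> 0 < jump \<gamma> c"
    by (rule jump_sign) blast
  have qh: "1 / real q = 2 * (1 / (2 * real q))" by simp
  define L where "L = dpeak (- (1 / real q) + a0 / 2)"
  have dp: "\<bar>dpeak y\<bar> \<le> L" if "- (1 / real q) + a0 / 2 \<le> y" "y \<le> 1 / real q - a0 / 2" for y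
  proof -
    have "dpeak y \<le> L" "dpeak (- y) \<le> L" unfolding L_def
      using that a0(1,2) qh by (intro dpeak_antimono; linarith)+
    thus ?thesis by (simp add: dpeak_minus)
  qed
  have Db: "\<bar>subder \<gamma> c x\<bar> \<le> 2 * L"
    if "- (1 / real q) + a0 / 2 \<le> \<gamma> + c" "\<gamma> + c \<le> - (a0 / 2)" for \<gamma> c x
  proof -
    have adm: "adm \<gamma> c" using that a0(1) by (auto simp: adm_def)
    have "\<bar>subder \<gamma> c x\<bar> \<le> (dpeak (\<gamma> + c) - dpeak (\<gamma> + c + 1 / real q)) / (real q - 1)"
      by (rule subder_bounded[OF adm])
    also have "\<dots> \<le> (dpeak (\<gamma> + c) - dpeak (\<gamma> + c + 1 / real q)) / 1"
      using adm_sign[OF adm] q_ge2 by (intro divide_left_mono) auto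
    also have "(dpeak (\<gamma> + c) - dpeak (\<gamma> + c + 1 / real q)) / 1 \<le> 2 * L"
    proof -
      have "\<bar>dpeak (\<gamma> + c)\<bar> \<le> L" "\<bar>dpeak (\<gamma> + c + 1 / real q)\<bar> \<le> L"
        using that a0(1,2) qh by (intro dp; linarith)+
      thus ?thesis by simp
    qed
    finally show ?thesis .
  qed
  define B where "B = 1 + 4 * (2 * L)\<^sup>2 * real q"
  define H where "H = B * (real q - 1) / pi\<^sup>2"
  have "0 < B" unfolding B_def using q_pos by (intro add_pos_nonneg mult_nonneg_nonneg) auto
  hence "0 < H" using q_ge2 by (simp add: H_def)
  have *: "\<bar>cphase \<gamma> - cphase \<gamma>'\<bar> \<le> H * sqrt (\<gamma>' - \<gamma>)" if g: "\<gamma> \<le> \<gamma>'" "\<gamma>' \<le> \<gamma> + a0 / 2" for \<gamma> \<gamma>'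
  proof -
    define c where "c = cphase \<gamma>"
    have adm: "adm \<gamma> c" "jump \<gamma> c = 0" using cphase by (auto simp: c_def)
    have m: "a0 < - (\<gamma> + c)" "a0 < \<gamma> + c + 1 / real q"
      using a0(3)[OF adm(1)] a0(4)[OF adm(1)] adm(2) by force+
    have adm': "adm \<gamma>' c" using m g a0(1) by (auto simp: adm_def)
    have "\<bar>jump \<gamma> c - jump \<gamma>' c\<bar> \<le> B * sqrt (\<gamma>' - \<gamma>)"
      unfolding B_def by (intro jump_holder adm(1) adm' Db) (use m g a0(1,2) qh in linarith)+
    hence j: "\<bar>jump \<gamma>' c - jump \<gamma>' (cphase \<gamma>')\<bar> \<le> B * sqrt (\<gamma>' - \<gamma>)"
      using adm(2) cphase(2)[of \<gamma>'] by simp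
    have "pi\<^sup>2 * \<bar>c - cphase \<gamma>'\<bar> / (real q - 1) \<le> \<bar>jump \<gamma>' c - jump \<gamma>' (cphase \<gamma>')\<bar>"
      using jump_diff_c[OF adm' cphase(1)[of \<gamma>']] jump_diff_c[OF cphase(1)[of \<gamma>'] adm']
      by (cases "c \<le> cphase \<gamma>'") auto
    hence "pi\<^sup>2 * \<bar>c - cphase \<gamma>'\<bar> / (real q - 1) \<le> B * sqrt (\<gamma>' - \<gamma>)" using j by linarith
    thus ?thesis using q_ge2 by (simp add: H_def c_def field_simps)
  qed
  show thesis
  proof (rule that[of "a0 / 2" H])
    fix \<gamma> \<gamma>' assume "\<bar>\<gamma> - \<gamma>'\<bar> \<le> a0 / 2"
    thus "\<bar>cphase \<gamma> - cphase \<gamma>'\<bar> \<le> H * sqrt \<bar>\<gamma> - \<gamma>'\<bar>"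
      using *[of \<gamma> \<gamma>'] *[of \<gamma>' \<gamma>] by (cases "\<gamma> \<le> \<gamma>'") (auto simp: abs_minus_commute)
  qed (use a0 \<open>0 < H\<close> in auto)
qed

lemma cphase_continuous: "continuous_on UNIV cphase"
  unfolding continuous_on_eq_continuous_at[OF open_UNIV]
proof
  fix \<gamma> :: real
  obtain d H where dH: "0 < d" "0 < H"
    "\<And>\<gamma> \<gamma>'. \<bar>\<gamma> - \<gamma>'\<bar> \<le> d \<Longrightarrow> \<bar>cphase \<gamma> - cphase \<gamma>'\<bar> \<le> H * sqrt \<bar>\<gamma> - \<gamma>'\<bar>"
    by (rule cphase_holder) blast
  have "((\<lambda>x. cphase x - cphase \<gamma>) \<longlongrightarrow> 0) (at \<gamma>)"
  proof (rule Lim_null_comparison)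
    show "eventually (\<lambda>x. norm (cphase x - cphase \<gamma>) \<le> H * sqrt \<bar>x - \<gamma>\<bar>) (at \<gamma>)"
      unfolding eventually_at using dH by (auto intro!: exI[of _ d] simp: dist_real_def)
    show "((\<lambda>x. H * sqrt \<bar>x - \<gamma>\<bar>) \<longlongrightarrow> 0) (at \<gamma>)"
      by (auto intro!: tendsto_eq_intros)
  qed
  thus "isCont cphase \<gamma>" by (simp add: isCont_def LIM_zero_iff)
qed

lemma cphase_surj: "\<exists>\<gamma>. cphase \<gamma> = c"
proof -
  have "\<exists>x. - c - 1 \<le> x \<and> x \<le> - c \<and> cphase x = c"
  proof (rule IVT2')
    have "1 / real q \<le> 1" using q_ge2 by simp
    thus "cphase (- c) \<le> c" "c \<le> cphase (- c - 1)"
      using cphase(1)[of "- c"] cphase(1)[of "- c - 1"] by (auto simp: adm_def)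
    show "continuous_on {- c - 1..- c} cphase"
      using cphase_continuous continuous_on_subset by blast
  qed auto
  thus ?thesis by blast
qed

section \<open>One-sided bounds on the derivative\<close>

text \<open>In the case \<open>cut\<close> a discontinuity of the branch lies in (x, y].\<close>

lemma branch_cases:
  assumes "x \<le> y" "y \<le> x + 1"
  obtains (uncut) "branch \<gamma> y = branch \<gamma> x + (y - x) / real q"
  | (cut) "branch \<gamma> y = branch \<gamma> x + (y - x) / real q - 1 / real q"
  using floor_cases[OF assms, of "real q * \<gamma>"]
  by (auto simp: branch_def diff_divide_distrib add_divide_distrib algebra_simps)

lemma subder_diff_le:
  assumes "adm \<gamma> c"
  shows "subder \<gamma> c x - subder \<gamma> c y \<le> (dpeak (\<gamma> + c) - dpeak (\<gamma> + c + 1 / real q)) / (real q - 1)"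
  using subder_le[OF assms, of x] subder_ge[OF assms, of y] by (simp add: diff_divide_distrib)

text \<open>When \<open>branch \<gamma>\<close> jumps between \<open>x\<close> and \<open>y\<close>, the derivative jumps upwards, which only helps.\<close>
lemma subder_semiconvex:
  assumes adm: "adm \<gamma> c" and K: "0 \<le> K"
    and lip: "\<And>u v. \<gamma> \<le> u \<Longrightarrow> u \<le> v \<Longrightarrow> v \<le> \<gamma> + 1 / real q \<Longrightarrow> dpeak (u + c) - dpeak (v + c) \<le> K * (v - u)"
    and xy: "x \<le> y" "y \<le> x + 1"
  shows "subder \<gamma> c x - subder \<gamma> c y \<le> K / ((real q)\<^sup>2 - 1) * (y - x)"
proof -
  \<comment> \<open>The fixed point of the recursion: (K + k) / q^2 = k.\<close>
  define k where "k = K / ((real q)\<^sup>2 - 1)"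
  define C where "C = (dpeak (\<gamma> + c) - dpeak (\<gamma> + c + 1 / real q)) / (real q - 1)"
  have q1: "1 < (real q)\<^sup>2" using q_ge2 by (intro one_less_power) auto
  have k0: "0 \<le> k" using K q1 by (simp add: k_def)
  have kK: "K + k = k * (real q)\<^sup>2" using q1 by (simp add: k_def field_simps)
  have C0: "0 \<le> C" "C * (real q - 1) = dpeak (\<gamma> + c) - dpeak (\<gamma> + c + 1 / real q)"
    using adm_sign[OF adm] q_ge2 by (auto simp: C_def)
  have CA: "C \<le> dpeak (\<gamma> + c) - dpeak (\<gamma> + c + 1 / real q)"
    using C0 q_ge2 mult_left_mono[of 1 "real q - 1" C] by simp
  \<comment> \<open>The crude bound C by the total range gains a factor 1/q with each use of the
    recursion, so the error vanishes in the limit.\<close>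
  have "subder \<gamma> c x - subder \<gamma> c y - k * (y - x) \<le> C / real q ^ n" if "x \<le> y" "y \<le> x + 1" for n x y
    using that
  proof (induction n arbitrary: x y)
    case 0
    have "0 \<le> k * (y - x)" using 0 k0 by simp
    thus ?case using subder_diff_le[OF adm, of x y] by (simp add: C_def)
  next
    case (Suc n)
    let ?x = "branch \<gamma> x" and ?y = "branch \<gamma> y"
    let ?d = "subder \<gamma> c ?x - subder \<gamma> c ?y"
    have rec: "subder \<gamma> c x - subder \<gamma> c y = (dpeak (?x + c) - dpeak (?y + c) + ?d) / real q"
      using subder_rec[OF adm, of x] subder_rec[OF adm, of y] by (simp add: diff_divide_distrib add_divide_distrib)
    have r: "\<gamma> \<le> ?x" "?x \<le> \<gamma> + 1 / real q" "\<gamma> \<le> ?y" "?y \<le> \<gamma> + 1 / real q"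
      using branch_ge branch_less less_imp_le by blast+
    have e: "((K + k) * ((y - x) / real q)) / real q = k * (y - x)"
      using q_pos by (simp add: kK power2_eq_square)
    have len: "0 \<le> (y - x) / real q" "(y - x) / real q \<le> 1"
      using Suc.prems q_ge2 by (auto simp: field_simps)
    show ?case
    proof (cases rule: branch_cases[OF Suc.prems, of \<gamma>])
      case 1
      note uncut = this
      have "dpeak (?x + c) - dpeak (?y + c) \<le> K * ((y - x) / real q)"
        using lip[of ?x ?y] r uncut len by simp
      moreover have "?d - k * ((y - x) / real q) \<le> C / real q ^ n"
        using Suc.IH[of ?x ?y] uncut len by simp
      ultimately have "dpeak (?x + c) - dpeak (?y + c) + ?d \<le> (K + k) * ((y - x) / real q) + C / real q ^ n"
        unfolding distrib_right by linarith
      hence "subder \<gamma> c x - subder \<gamma> c y \<le> ((K + k) * ((y - x) / real q) + C / real q ^ n) / real q"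
        unfolding rec using q_pos by (intro divide_right_mono) auto
      thus ?thesis using e by (simp add: add_divide_distrib mult.commute)
    next
      case 2
      note cut = this
      \<comment> \<open>Go from \<open>?x\<close> to the right end of the arc and from the left end
        to \<open>?y\<close>, a total length of (y - x)/q. Passing between the ends contributes
        minus the whole drop of \<open>dpeak\<close> over the arc, which outweighs \<open>?d\<close>
        by \<open>CA\<close>.\<close>
      have "dpeak (?x + c) - dpeak (\<gamma> + 1 / real q + c) \<le> K * (\<gamma> + 1 / real q - ?x)"
        "dpeak (\<gamma> + c) - dpeak (?y + c) \<le> K * (?y - \<gamma>)"
        using r by (intro lip; simp)+
      moreover have "K * (\<gamma> + 1 / real q - ?x) + K * (?y - \<gamma>) = K * ((y - x) / real q)"
        unfolding cut by (simp add: algebra_simps)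
      moreover have "?d \<le> C" using subder_diff_le[OF adm] by (simp add: C_def)
      moreover have "\<gamma> + 1 / real q + c = \<gamma> + c + 1 / real q" by simp
      moreover have "0 \<le> k * ((y - x) / real q)" using k0 len(1) by (rule mult_nonneg_nonneg)
      ultimately have "dpeak (?x + c) - dpeak (?y + c) + ?d \<le> (K + k) * ((y - x) / real q)"
        using CA by (simp only: distrib_right)
      hence "subder \<gamma> c x - subder \<gamma> c y \<le> ((K + k) * ((y - x) / real q)) / real q"
        unfolding rec using q_pos by (intro divide_right_mono) auto
      moreover have "0 \<le> C / real q ^ Suc n" using C0 by simp
      ultimately show ?thesis using e by linarith
    qed
  qed
  note * = this[OF xy]
  have "(\<lambda>n. C / real q ^ n) \<longlonglongrightarrow> 0"
    using q_ge2 by (intro LIMSEQ_divide_realpow_zero) auto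
  hence "subder \<gamma> c x - subder \<gamma> c y - k * (y - x) \<le> 0"
    by (rule LIMSEQ_le_const) (use * in auto)
  thus ?thesis by (simp add: k_def)
qed

text \<open>The branch shrinks a step 1/q to 1/q^2: then \<open>E1\<close> bounds the first term of
  the series and semiconvexity the rest. If the branch cuts the step, the first term does not drop
  and the total range of \<open>subder\<close> bounds the rest.\<close>

lemma subder_step:
  assumes adm: "adm \<gamma> c" and K: "0 \<le> K"
    and lip: "\<And>u v. \<gamma> \<le> u \<Longrightarrow> u \<le> v \<Longrightarrow> v \<le> \<gamma> + 1 / real q \<Longrightarrow> dpeak (u + c) - dpeak (v + c) \<le> K * (v - u)"
    and step: "\<And>u. \<gamma> \<le> u \<Longrightarrow> u + 1 / (real q)\<^sup>2 \<le> \<gamma> + 1 / real q \<Longrightarrow>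
      dpeak (u + c) - dpeak (u + c + 1 / (real q)\<^sup>2) \<le> E1"
    and E: "(E1 + K / ((real q)\<^sup>2 * ((real q)\<^sup>2 - 1))) / real q \<le> E"
      "(dpeak (\<gamma> + c) - dpeak (\<gamma> + c + 1 / real q)) / (real q * (real q - 1)) \<le> E"
  shows "subder \<gamma> c x - subder \<gamma> c (x + 1 / real q) \<le> E"
proof -
  let ?y = "x + 1 / real q"
  let ?d = "subder \<gamma> c (branch \<gamma> x) - subder \<gamma> c (branch \<gamma> ?y)"
  have q1: "1 / real q \<le> 1" using q_ge2 by simp
  have xy: "x \<le> ?y" "?y \<le> x + 1" using q1 q_pos by auto
  have sq: "(?y - x) / real q = 1 / (real q)\<^sup>2" by (simp add: power2_eq_square)
  have sq1: "1 / (real q)\<^sup>2 \<le> 1 / real q" using q_ge2 by (simp add: power2_eq_square divide_simps)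
  have rec: "subder \<gamma> c x - subder \<gamma> c ?y = (dpeak (branch \<gamma> x + c) - dpeak (branch \<gamma> ?y + c) + ?d) / real q"
    using subder_rec[OF adm, of x] subder_rec[OF adm, of ?y] by (simp add: diff_divide_distrib add_divide_distrib)
  have r: "\<gamma> \<le> branch \<gamma> x" "branch \<gamma> x \<le> \<gamma> + 1 / real q" "\<gamma> \<le> branch \<gamma> ?y" "branch \<gamma> ?y \<le> \<gamma> + 1 / real q"
    using branch_ge branch_less less_imp_le by blast+
  show ?thesis
  proof (cases rule: branch_cases[OF xy, of \<gamma>])
    case 1
    hence y: "branch \<gamma> ?y = branch \<gamma> x + 1 / (real q)\<^sup>2" by (simp only: sq)
    have "dpeak (branch \<gamma> x + c) - dpeak (branch \<gamma> ?y + c) \<le> E1"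
      using step[OF r(1)] r(4) unfolding y by (simp add: add_ac)
    moreover have "?d \<le> K / ((real q)\<^sup>2 - 1) * (branch \<gamma> ?y - branch \<gamma> x)"
      by (rule subder_semiconvex[OF adm K lip]) (use q1 sq1 in \<open>auto simp: y\<close>)
    hence "?d \<le> K / ((real q)\<^sup>2 * ((real q)\<^sup>2 - 1))" unfolding y by (simp add: mult.commute)
    ultimately have "subder \<gamma> c x - subder \<gamma> c ?y \<le> (E1 + K / ((real q)\<^sup>2 * ((real q)\<^sup>2 - 1))) / real q"
      unfolding rec using q_pos by (intro divide_right_mono) auto
    thus ?thesis using E by linarith
  next
    case 2
    hence "branch \<gamma> ?y \<le> branch \<gamma> x" unfolding sq using sq1 by linarith
    hence "dpeak (branch \<gamma> x + c) \<le> dpeak (branch \<gamma> ?y + c)"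
      using r adm by (intro dpeak_antimono) (auto simp: adm_def)
    moreover have "?d \<le> (dpeak (\<gamma> + c) - dpeak (\<gamma> + c + 1 / real q)) / (real q - 1)"
      by (rule subder_diff_le[OF adm])
    ultimately have "subder \<gamma> c x - subder \<gamma> c ?y \<le>
       ((dpeak (\<gamma> + c) - dpeak (\<gamma> + c + 1 / real q)) / (real q - 1)) / real q"
      unfolding rec using q_pos by (intro divide_right_mono) auto
    thus ?thesis using E(2) by (simp add: mult.commute)
  qed
qed

text \<open>\<open>dpeak\<close> is odd, so a bound on (0, m) serves both sides, and an interval
  around 0 is split there.\<close>

lemma dpeak_lip_symmetric:
  assumes m: "m < 1 / real q" and dd: "\<And>z. 0 < z \<Longrightarrow> z < m \<Longrightarrow> ddpeak z \<le> K"
    and uv: "- m \<le> u" "u \<le> v" "v \<le> m"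
  shows "dpeak u - dpeak v \<le> K * (v - u)"
proof -
  have pos: "dpeak u - dpeak v \<le> K * (v - u)" if "0 \<le> u" "u \<le> v" "v \<le> m" for u v
  proof (cases "u = v")
    case False
    hence "- (1 / real q) < u" "u < v" "v < 1 / real q" using that m q_pos by auto
    then obtain z where z: "u < z" "z < v" "dpeak u - dpeak v = (v - u) * ddpeak z" by (rule dpeak_diff)
    have "(v - u) * ddpeak z \<le> (v - u) * K" using z that by (intro mult_left_mono dd) auto
    thus ?thesis using z(3) by (simp add: mult.commute)
  qed simp
  consider "0 \<le> u" | "v \<le> 0" | "u < 0" "0 < v" by linarith
  thus ?thesis
  proof cases
    case 2
    thus ?thesis using pos[of "- v" "- u"] uv by (simp add: dpeak_minus)
  next
    case 3
    have "dpeak u - dpeak 0 \<le> K * - u" using pos[of 0 "- u"] uv 3 by (simp add: dpeak_minus)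
    moreover have "dpeak 0 - dpeak v \<le> K * v" using pos[of 0 v] uv 3 by simp
    ultimately show ?thesis by (simp add: algebra_simps)
  qed (use pos uv in auto)
qed

section \<open>How far the peak can be from the middle of the arc\<close>

lemma dpeak_half: "dpeak (1 / (2 * real q)) = - (pi * cot (pi / (2 * real q)))"
proof -
  have "pi * real q * (1 / (2 * real q)) = pi / 2" using q_pos by simp
  hence "cot (pi * real q * (1 / (2 * real q))) = 0" by (simp add: cot_def)
  thus ?thesis using dpeak_eq[of "1 / (2 * real q)"] q_pos by (simp add: divide_strict_left_mono)
qed

lemma ln_sin_ratio_ge':
  assumes "0 < l" "l \<le> m" "l + m = 1 / real q"
  shows "pi * (m - l) * cot (pi / (2 * real q)) \<le> ln (sin (pi * m)) - ln (sin (pi * l))"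
proof -
  have mid: "pi / (2 * real q) + pi * (m - l) / 2 = pi * m" "pi / (2 * real q) - pi * (m - l) / 2 = pi * l"
  proof -
    have "pi / (2 * real q) = pi * (l + m) / 2" using assms(3) by simp
    thus "pi / (2 * real q) + pi * (m - l) / 2 = pi * m" "pi / (2 * real q) - pi * (m - l) / 2 = pi * l"
      by (simp_all add: field_simps)
  qed
  have "0 < pi * l" using assms by simp
  hence "pi * (m - l) / 2 < pi / (2 * real q)" using mid by linarith
  moreover have "pi / (2 * real q) < pi / 2" using q_ge2 by (intro divide_strict_left_mono) auto
  moreover have "0 \<le> pi * (m - l) / 2" using assms by simp
  ultimately show ?thesis
    using ln_sin_ratio_ge[of "pi / (2 * real q)" "pi * (m - l) / 2"] q_pos by (simp add: mid)
qed

text \<open>Since l \<le> 1/(2 q), \<open>dpeak (- l)\<close> is at most pi cot (pi/(2 q)); the same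
  cotangent stands in \<open>ln_sin_ratio_ge'\<close> and cancels.\<close>

lemma endpoints_close:
  assumes "0 < l" "l \<le> m" "l + m = 1 / real q"
    "ln (sin (pi * m)) - ln (sin (pi * l)) \<le> dpeak (- l) / (real q * (real q - 1))"
  shows "m - l \<le> 1 / (real q * (real q - 1))"
proof -
  have l: "l \<le> 1 / (2 * real q)" using assms by (simp add: field_simps)
  have h: "1 / (2 * real q) < 1 / real q" using q_pos by (intro divide_strict_left_mono) auto
  have "dpeak (- l) \<le> dpeak (- (1 / (2 * real q)))"
    using l h assms q_pos by (intro dpeak_antimono) auto
  also have "\<dots> = pi * cot (pi / (2 * real q))" by (simp add: dpeak_minus dpeak_half)
  finally have "dpeak (- l) / (real q * (real q - 1)) \<le> pi * cot (pi / (2 * real q)) / (real q * (real q - 1))"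
    using q_ge2 by (intro divide_right_mono) auto
  hence "pi * (m - l) * cot (pi / (2 * real q)) \<le> pi * cot (pi / (2 * real q)) / (real q * (real q - 1))"
    using ln_sin_ratio_ge'[OF assms(1-3)] assms(4) by linarith
  hence "(m - l) * (pi * cot (pi / (2 * real q))) \<le> (1 / (real q * (real q - 1))) * (pi * cot (pi / (2 * real q)))"
    by (simp add: mult_ac)
  moreover have "0 < pi * cot (pi / (2 * real q))"
    using q_ge2 by (intro mult_pos_pos cot_gt_zero divide_strict_left_mono) auto
  ultimately show ?thesis by (metis mult_le_cancel_right_pos)
qed

text \<open>\<open>jump_le\<close> and \<open>jump_ge\<close> at a zero of \<open>jump\<close>. Here
  a and b are the distances from the peak to the ends of the arc, and a very lopsided arc would make
  the logarithmic ratio too large.\<close>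

lemma apriori:
  assumes "adm \<gamma> c" "jump \<gamma> c = 0"
  defines "a \<equiv> - (\<gamma> + c)" and "b \<equiv> \<gamma> + c + 1 / real q"
  shows "ln (sin (pi * b)) - ln (sin (pi * a)) \<le> dpeak (- a) / (real q * (real q - 1))"
    and "ln (sin (pi * a)) - ln (sin (pi * b)) \<le> dpeak (- b) / (real q * (real q - 1))"
proof -
  have a: "0 < a" "a < 1 / real q" using assms by (auto simp: adm_def)
  have na: "- a = \<gamma> + c" by (simp add: a_def)
  have "jump \<gamma> c \<le> peak b - peak (- a) + dpeak (- a) / (real q * (real q - 1))"
    "peak b - peak (- a) + dpeak b / (real q * (real q - 1)) \<le> jump \<gamma> c"
    unfolding na b_def using jump_le[OF assms(1)] jump_ge[OF assms(1)] by simp_all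
  moreover have "1 / real q - a = b" by (simp add: a_def b_def)
  hence "peak b - peak (- a) = ln (sin (pi * a)) - ln (sin (pi * b))" using peak_diff_end[OF a] by simp
  ultimately show "ln (sin (pi * b)) - ln (sin (pi * a)) \<le> dpeak (- a) / (real q * (real q - 1))"
    "ln (sin (pi * a)) - ln (sin (pi * b)) \<le> dpeak (- b) / (real q * (real q - 1))"
    using assms(2) by (simp_all add: dpeak_minus[of b])
qed

text \<open>Reflection maps the step from u to u + d onto the one from -(u + d) to -u with the same
  drop, so steps with midpoint \<ge> 0 suffice.\<close>

lemma step_symmetric:
  assumes d: "0 < d" and step: "\<And>u. - (d / 2) \<le> u \<Longrightarrow> u + d \<le> m \<Longrightarrow> dpeak u - dpeak (u + d) \<le> E"
    and u: "- m \<le> u" "u + d \<le> m"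
  shows "dpeak u - dpeak (u + d) \<le> E"
proof (cases "- (d / 2) \<le> u")
  case False
  have "dpeak (- (u + d)) - dpeak (- (u + d) + d) \<le> E" using u False by (intro step) auto
  also have "- (u + d) + d = - u" by simp
  finally show ?thesis unfolding dpeak_minus by linarith
qed (use step u in auto)

text \<open>The cases \<open>q = 2, 3\<close> of \<open>subder_gap\<close>: the constant of \<open>subder_semiconvex\<close> is too large there, so
  the first term of the series is estimated exactly (by \<open>E1\<close>) and only the rest by semiconvexity.\<close>
definition gap_bound :: "real \<Rightarrow> real \<Rightarrow> bool" where
  "gap_bound l m \<longleftrightarrow> (\<exists>K E1 E. 0 \<le> K \<and> (\<forall>u v. - m \<le> u \<longrightarrow> u \<le> v \<longrightarrow> v \<le> m \<longrightarrow> dpeak u - dpeak v \<le> K * (v - u)) \<and>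
     (\<forall>u. - m \<le> u \<longrightarrow> u + 1 / (real q)\<^sup>2 \<le> m \<longrightarrow> dpeak u - dpeak (u + 1 / (real q)\<^sup>2) \<le> E1) \<and>
     (E1 + K / ((real q)\<^sup>2 * ((real q)\<^sup>2 - 1))) / real q \<le> E \<and>
     (dpeak (- l) - dpeak m) / (real q * (real q - 1)) \<le> E \<and> E < 2 * pi * tan (pi / (2 * real q)))"

lemma gap_bound_2:
  assumes q: "q = 2" and lm: "0 < l" "l \<le> m" "l + m = 1 / real q"
    and apr: "ln (sin (pi * m)) - ln (sin (pi * l)) \<le> dpeak (- l) / (real q * (real q - 1))"
  shows "gap_bound l m"
proof -
  have lm': "l = 1 / 2 - m" "1 / 4 \<le> m" "m < 1 / 2" using lm q by auto
  have dp: "dpeak y = - (pi * tan (pi * y))" for y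
  proof -
    have "{1..<2::nat} = {1}" by auto
    hence "dpeak y = pi * cot (pi * y + pi / 2)" unfolding dpeak_def unfolding q by (simp add: distrib_left)
    thus ?thesis by (simp add: cot_def tan_def cos_add sin_add)
  qed
  have ddp: "ddpeak y = pi\<^sup>2 / (cos (pi * y))\<^sup>2" for y
  proof -
    have "{1..<2::nat} = {1}" by auto
    hence "ddpeak y = pi\<^sup>2 * (1 / (sin (pi * y + pi / 2))\<^sup>2)" unfolding ddpeak_def unfolding q by (simp add: distrib_left)
    thus ?thesis by (simp add: sin_add)
  qed
  \<comment> \<open>For q = 2 all quantities on the arc are expressed by this tangent;
    \<open>apr\<close> becomes ln t \<le> pi/(2 t), which forces t \<le> 5/2.\<close>
  define t where "t = tan (pi * m)"
  have pm: "pi / 4 \<le> pi * m" "pi * m < pi / 2"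
    using mult_left_mono[of "1 / 4" m pi] mult_strict_left_mono[of m "1 / 2" pi] lm' by auto
  have c0: "0 < cos (pi * m)" using pm by (intro cos_gt_zero_pi) linarith+
  have s0: "0 < sin (pi * m)" using pm by (intro sin_gt_zero) linarith+
  have t1: "1 \<le> t" unfolding t_def tan_45[symmetric] using pm by (intro tan_mono_le) linarith+
  have pl: "pi * l = pi / 2 - pi * m" by (simp add: lm' right_diff_distrib)
  have "sin (pi * l) = cos (pi * m)" "tan (pi * l) = inverse t"
    unfolding pl t_def by (simp_all add: sin_diff tan_cot)
  hence tl: "sin (pi * l) = cos (pi * m)" "dpeak (- l) = pi / t" by (simp_all add: dp dpeak_minus divide_inverse)
  have "ln t = ln (sin (pi * m)) - ln (cos (pi * m))" unfolding t_def tan_def using c0 s0 by (simp add: ln_div)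
  moreover have "real q * (real q - 1) = 2" by (simp add: q)
  ultimately have lnt: "ln t \<le> pi / t / 2" using apr unfolding tl by simp
  have t2: "t \<le> 5 / 2"
  proof (rule ccontr)
    assume "\<not> t \<le> 5 / 2"
    hence t: "5 / 2 < t" by simp
    \<comment> \<open>5/2 = 25/16 * 8/5, and ln x \<ge> 1 - 1/x on each factor gives ln (5/2) \<ge>
      0.36 + 0.375, above pi/5.\<close>
    have "ln (25 / 16 :: real) \<ge> 1 - 16 / 25" "ln (8 / 5 :: real) \<ge> 1 - 5 / 8"
      using ln_ge_iff ln_add_one_self_le_self2 ln_le_minus_one[of "16 / 25 :: real"] ln_le_minus_one[of "5 / 8 :: real"]
      by (simp_all add: ln_div)
    moreover have "ln (5 / 2 :: real) = ln (25 / 16) + ln (8 / 5)"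
      using ln_mult[of "25 / 16 :: real" "8 / 5"] by simp
    ultimately have "0.7 < ln (5 / 2 :: real)" by simp
    also have "\<dots> \<le> ln t" using t by simp
    also have "\<dots> \<le> pi / t / 2" by (rule lnt)
    also have "pi / t \<le> pi / (5 / 2)" using t by (intro divide_left_mono) auto
    hence "pi / t / 2 \<le> 0.7" using pi_approx by simp
    finally show False by simp
  qed
  \<comment> \<open>\<open>K\<close> bounds \<open>ddpeak\<close> on [-m, m], \<open>E1\<close> the
    drop of \<open>dpeak\<close> over a step 1/4, and \<open>E\<close> is the larger of the two
    bounds that \<open>subder_step\<close> requires.\<close>
  define K where "K = pi\<^sup>2 * (1 + t\<^sup>2)"
  define E1 where "E1 = pi * ((t\<^sup>2 + 1) / (t + 1))"
  define E where "E = max ((E1 + K / 12) / 2) ((pi / t + pi * t) / 2)"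
  have step: "dpeak u - dpeak (u + 1 / 4) \<le> E1" if u: "- (1 / 4 / 2) \<le> u" "u + 1 / 4 \<le> m" for u
  proof -
    define v where "v = u + 1 / 4"
    define w where "w = tan (pi * v)"
    have pv: "0 < pi * v" "pi * v \<le> pi * m" using u by (auto simp: v_def)
    have w: "0 < w" "w \<le> t" unfolding w_def t_def using pv pm
      by (intro tan_gt_zero tan_mono_le; linarith)+
    have "pi * u = pi * v - pi / 4" by (simp add: v_def algebra_simps)
    moreover have "cos (pi * v) \<noteq> 0" using cos_gt_zero_pi[of "pi * v"] pv pm by force
    moreover have "pi / 8 \<le> pi * v" using mult_left_mono[of "1 / 8" v pi] u by (simp add: v_def)
    hence "cos (pi * v - pi / 4) \<noteq> 0" using cos_gt_zero_pi[of "pi * v - pi / 4"] pv pm by force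
    ultimately have "tan (pi * u) = (w - 1) / (1 + w)"
      by (simp add: w_def tan_diff tan_45 cos_45)
    hence "dpeak u - dpeak v = pi * (w - (w - 1) / (1 + w))" by (simp add: dp w_def algebra_simps)
    also have "w - (w - 1) / (1 + w) = (w\<^sup>2 + 1) / (w + 1)" using w by (simp add: field_simps power2_eq_square)
    also have "\<dots> \<le> (t\<^sup>2 + 1) / (t + 1)"
    proof -
      \<comment> \<open>The difference of the cross products, factored. The fraction is not monotone
        near 0; t \<ge> 1 is what gives the sign.\<close>
      have "0 \<le> (t - w) * (t * w + w + (t - 1))" using t1 w by (intro mult_nonneg_nonneg add_nonneg_nonneg) auto
      also have "\<dots> = (t\<^sup>2 + 1) * (w + 1) - (w\<^sup>2 + 1) * (t + 1)" by (simp add: algebra_simps power2_eq_square)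
      finally show ?thesis using w t1 by (simp add: divide_simps)
    qed
    finally show ?thesis by (simp add: E1_def v_def)
  qed
  have dd: "ddpeak z \<le> K" if "0 < z" "z < m" for z
  proof -
    have "0 < pi * z" "pi * z < pi * m" using that by auto
    hence "cos (pi * m) \<le> cos (pi * z)" using pm by (intro cos_monotone_0_pi_le) linarith+
    hence "(cos (pi * m))\<^sup>2 \<le> (cos (pi * z))\<^sup>2" using c0 by (intro power_mono) auto
    hence "ddpeak z \<le> pi\<^sup>2 / (cos (pi * m))\<^sup>2" unfolding ddp using c0
      by (intro divide_left_mono mult_pos_pos) auto
    also have "1 / (cos (pi * m))\<^sup>2 = 1 + t\<^sup>2"
    proof -
      have "1 + t\<^sup>2 = (inverse (cos (pi * m)))\<^sup>2" unfolding t_def using c0 by (intro tan_sec) simp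
      thus ?thesis by (simp add: power_divide inverse_eq_divide)
    qed
    hence "pi\<^sup>2 * (1 / (cos (pi * m))\<^sup>2) = K" unfolding K_def by (rule arg_cong)
    hence "pi\<^sup>2 / (cos (pi * m))\<^sup>2 = K" by simp
    finally show ?thesis .
  qed
  have E: "E < 2 * pi"
  proof -
    have "t\<^sup>2 \<le> 5 / 2 * t" unfolding power2_eq_square using t1 t2 by (intro mult_right_mono) auto
    hence b: "1 + t\<^sup>2 \<le> 1 + 5 / 2 * t" by simp
    \<comment> \<open>0.2625 is a rational upper bound for pi/12.\<close>
    have "(1 + t\<^sup>2) * (1 + 0.2625 * (t + 1)) \<le> (1 + 5 / 2 * t) * (1 + 0.2625 * (t + 1))"
      using b t1 by (intro mult_right_mono) auto
    also have "\<dots> = 1.2625 + 3.41875 * t + 0.65625 * t\<^sup>2" by (simp add: field_simps power2_eq_square)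
    also have "\<dots> \<le> 1.2625 + 3.41875 * t + 0.65625 * (5 / 2 * t)" using b by simp
    also have "\<dots> < 4 * (t + 1)" using t2 by simp
    finally have "(1 + t\<^sup>2) * (1 + 0.2625 * (t + 1)) / (2 * (t + 1)) < 2" using t1 by (simp add: divide_simps)
    moreover have "(1 + t\<^sup>2) * (1 + pi / 12 * (t + 1)) \<le> (1 + t\<^sup>2) * (1 + 0.2625 * (t + 1))"
      using pi_approx t1 by (intro mult_left_mono add_left_mono mult_right_mono) auto
    hence "(1 + t\<^sup>2) * (1 + pi / 12 * (t + 1)) / (2 * (t + 1)) \<le> (1 + t\<^sup>2) * (1 + 0.2625 * (t + 1)) / (2 * (t + 1))"
      using t1 by (intro divide_right_mono) auto
    ultimately have "(1 + t\<^sup>2) * (1 + pi / 12 * (t + 1)) / (2 * (t + 1)) < 2" by linarith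
    moreover have "(E1 + K / 12) / 2 = pi * ((1 + t\<^sup>2) * (1 + pi / 12 * (t + 1)) / (2 * (t + 1)))"
      unfolding E1_def K_def using t1 by (simp add: divide_simps) (simp add: algebra_simps power2_eq_square)
    ultimately have 1: "(E1 + K / 12) / 2 < 2 * pi"
      using mult_strict_left_mono[of "(1 + t\<^sup>2) * (1 + pi / 12 * (t + 1)) / (2 * (t + 1))" 2 pi] pi_gt_zero
      by linarith
    have "1 / t \<le> 1" using t1 by simp
    hence "pi * (1 / t + t) < pi * 4" using t2 by (intro mult_strict_left_mono) auto
    hence "(pi / t + pi * t) / 2 < 2 * pi" by (simp add: distrib_left)
    with 1 show ?thesis by (simp add: E_def)
  qed
  have q4: "(real q)\<^sup>2 = 4" "real q = 2" by (simp_all add: q)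
  have "0 \<le> K" by (simp add: K_def)
  moreover have "dpeak u - dpeak v \<le> K * (v - u)" if "- m \<le> u" "u \<le> v" "v \<le> m" for u v
      using that lm' q by (intro dpeak_lip_symmetric[of m] dd) auto
  moreover have "dpeak u - dpeak (u + 1 / 4) \<le> E1" if "- m \<le> u" "u + 1 / 4 \<le> m" for u
      by (rule step_symmetric[of "1 / 4" m]) (use step that in auto)
  moreover have "(E1 + K / (4 * (4 - 1))) / 2 \<le> E" by (simp add: E_def)
  moreover have "(dpeak (- l) - dpeak m) / (2 * (2 - 1)) \<le> E" by (simp add: E_def tl dp[of m] t_def)
  moreover have "E < 2 * pi * tan (pi / (2 * 2))" using E by (simp add: tan_45)
  ultimately show ?thesis unfolding gap_bound_def q4(1) unfolding q4(2) by blast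
qed

lemma gap_bound_3:
  assumes q: "q = 3" and lm: "0 < l" "l \<le> m" "l + m = 1 / real q"
    and apr: "ln (sin (pi * m)) - ln (sin (pi * l)) \<le> dpeak (- l) / (real q * (real q - 1))"
  shows "gap_bound l m"
proof -
  \<comment> \<open>\<open>endpoints_close\<close> gives m - l \<le> 1/6 for q = 3, and with l + m =
    1/3 this confines m to [1/6, 1/4].\<close>
  have lm': "1 / 6 \<le> m" "m \<le> 1 / 4" "l \<le> 1 / 6" using lm q endpoints_close[OF lm apr] by auto
  have ss: "sin (pi * (y + 1 / 3)) * sin (pi * (y + 2 / 3)) = (1 + 2 * cos (2 * pi * y)) / 4" for y
  proof -
    have "sin (pi * (y + 1 / 3)) * sin (pi * (y + 2 / 3)) =
       (cos (pi * (y + 1 / 3) - pi * (y + 2 / 3)) - cos (pi * (y + 1 / 3) + pi * (y + 2 / 3))) / 2"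
      by (rule sin_times_sin)
    also have "pi * (y + 1 / 3) - pi * (y + 2 / 3) = - (pi / 3)" by (simp add: algebra_simps)
    also have "pi * (y + 1 / 3) + pi * (y + 2 / 3) = 2 * pi * y + pi" by (simp add: algebra_simps)
    finally show ?thesis by (simp add: cos_60)
  qed
  have pos: "0 < 1 + 2 * cos (2 * pi * y)" "0 < sin (pi * (y + 1 / 3))" "0 < sin (pi * (y + 2 / 3))"
    if "\<bar>y\<bar> < 1 / 3" for y
  proof -
    show *: "0 < sin (pi * (y + 1 / 3))" "0 < sin (pi * (y + 2 / 3))"
      using peak_arg[of y 1] peak_arg[of y 2] that by (simp_all add: q)
    show "0 < 1 + 2 * cos (2 * pi * y)" using mult_pos_pos[OF *] unfolding ss by simp
  qed
  have set: "{1..<3::nat} = {1, 2}" by auto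
  have dp: "dpeak y = - (4 * pi * sin (2 * pi * y) / (1 + 2 * cos (2 * pi * y)))" if "\<bar>y\<bar> < 1 / 3" for y
  proof -
    have "dpeak y = pi * (cot (pi * (y + 1 / 3)) + cot (pi * (y + 2 / 3)))" unfolding dpeak_def unfolding q set by simp
    also have "cot (pi * (y + 1 / 3)) + cot (pi * (y + 2 / 3)) =
       sin (pi * (y + 1 / 3) + pi * (y + 2 / 3)) / (sin (pi * (y + 1 / 3)) * sin (pi * (y + 2 / 3)))"
      unfolding sin_add[of "pi * (y + 1 / 3)"] cot_def using pos[OF that] by (simp add: divide_simps)
    also have "pi * (y + 1 / 3) + pi * (y + 2 / 3) = 2 * pi * y + pi" by (simp add: algebra_simps)
    finally show ?thesis unfolding ss by simp
  qed
  have ddp: "ddpeak y = 8 * pi\<^sup>2 * ((2 + cos (2 * pi * y)) / (1 + 2 * cos (2 * pi * y))\<^sup>2)" if "\<bar>y\<bar> < 1 / 3" for y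
  proof -
    let ?A = "pi * (y + 1 / 3)" and ?B = "pi * (y + 2 / 3)"
    have "(sin ?A)\<^sup>2 + (sin ?B)\<^sup>2 = 1 - (cos (2 * ?A) + cos (2 * ?B)) / 2"
      unfolding cos_double_sin by (simp add: field_simps)
    also have "cos (2 * ?A) + cos (2 * ?B) = 2 * cos ((2 * ?A + 2 * ?B) / 2) * cos ((2 * ?A - 2 * ?B) / 2)"
      by (rule cos_plus_cos)
    also have "(2 * ?A + 2 * ?B) / 2 = 2 * pi * y + pi" by (simp add: algebra_simps)
    also have "(2 * ?A - 2 * ?B) / 2 = - (pi / 3)" by (simp add: algebra_simps)
    finally have s2: "(sin ?A)\<^sup>2 + (sin ?B)\<^sup>2 = (2 + cos (2 * pi * y)) / 2" by (simp add: cos_60)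
    have "ddpeak y = pi\<^sup>2 * (1 / (sin ?A)\<^sup>2 + 1 / (sin ?B)\<^sup>2)" unfolding ddpeak_def unfolding q set by simp
    also have "1 / (sin ?A)\<^sup>2 + 1 / (sin ?B)\<^sup>2 = ((sin ?A)\<^sup>2 + (sin ?B)\<^sup>2) / (sin ?A * sin ?B)\<^sup>2"
      using pos[OF that] by (simp add: divide_simps power_mult_distrib)
    also have "\<dots> = 8 * ((2 + cos (2 * pi * y)) / (1 + 2 * cos (2 * pi * y))\<^sup>2)"
      unfolding ss s2 power_divide using pos(1)[OF that] by (simp add: field_simps)
    finally show ?thesis by simp
  qed
  have frac: "(2 + x) / (1 + 2 * x)\<^sup>2 \<le> (2 + y) / (1 + 2 * y)\<^sup>2" if "0 \<le> y" "y \<le> x" for x y :: real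
  proof -
    \<comment> \<open>Partial fractions: both terms decrease in x.\<close>
    have eq: "(2 + x) / (1 + 2 * x)\<^sup>2 = 1 / (2 * (1 + 2 * x)) + 3 / 2 / (1 + 2 * x)\<^sup>2" if "0 \<le> x" for x :: real
      using that by (simp add: divide_simps) (simp add: algebra_simps power2_eq_square)
    have "(1 + 2 * y)\<^sup>2 \<le> (1 + 2 * x)\<^sup>2" using that by (intro power_mono) auto
    thus ?thesis using that unfolding eq[OF that(1)] eq[OF order_trans[OF that]]
      by (intro add_mono divide_left_mono mult_pos_pos) auto
  qed
  have ddmono: "ddpeak x \<le> ddpeak y" if "\<bar>x\<bar> \<le> y" "y \<le> 1 / 4" for x y
  proof -
    have "pi * \<bar>x\<bar> \<le> pi * y" "pi * y \<le> pi * (1 / 4)" using that by (intro mult_left_mono; simp)+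
    hence b: "0 \<le> 2 * pi * \<bar>x\<bar>" "2 * pi * \<bar>x\<bar> \<le> 2 * pi * y" "2 * pi * y \<le> pi / 2" using that by auto
    have "cos (2 * pi * x) = cos (2 * pi * \<bar>x\<bar>)" by (cases "0 \<le> x") auto
    moreover have "cos (2 * pi * y) \<le> cos (2 * pi * \<bar>x\<bar>)" using b by (intro cos_monotone_0_pi_le) linarith+
    moreover have "0 \<le> cos (2 * pi * y)" using b by (intro cos_ge_zero) linarith+
    ultimately have "(2 + cos (2 * pi * x)) / (1 + 2 * cos (2 * pi * x))\<^sup>2 \<le>
        (2 + cos (2 * pi * y)) / (1 + 2 * cos (2 * pi * y))\<^sup>2" by (intro frac) auto
    hence "8 * pi\<^sup>2 * ((2 + cos (2 * pi * x)) / (1 + 2 * cos (2 * pi * x))\<^sup>2) \<le>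
        8 * pi\<^sup>2 * ((2 + cos (2 * pi * y)) / (1 + 2 * cos (2 * pi * y))\<^sup>2)" by (intro mult_left_mono) auto
    thus ?thesis using that by (simp only: ddp)
  qed
  have dd4: "ddpeak (1 / 4) = 16 * pi\<^sup>2" by (subst ddp) auto
  have dd6: "ddpeak (1 / 6) = 5 * pi\<^sup>2" by (subst ddp) (auto simp: cos_60 power2_eq_square)
  have dp4: "dpeak (1 / 4) = - (4 * pi)" by (subst dp) auto
  have dp6: "dpeak (1 / 6) = - (sqrt 3 * pi)" by (subst dp) (auto simp: cos_60 sin_60)
  define K where "K = 16 * pi\<^sup>2"
  define E1 where "E1 = 5 * pi\<^sup>2 / 36 + 4 * pi - sqrt 3 * pi"
  define E where "E = max ((E1 + K / 72) / 3) ((sqrt 3 * pi + 4 * pi) / 6)"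
  have step: "dpeak u - dpeak (u + 1 / 9) \<le> E1" if u: "- (1 / 9 / 2) \<le> u" "u + 1 / 9 \<le> m" for u
  proof -
    \<comment> \<open>\<open>ddpeak\<close> grows with the distance from 0, so the drop over 1/9
      grows with u and the worst step ends at 1/4.\<close>
    have "dpeak u - dpeak (u + 1 / 9) \<le> dpeak (5 / 36) - dpeak (5 / 36 + 1 / 9)"
    proof (rule DERIV_nonneg_imp_nondecreasing[where f = "\<lambda>x. dpeak x - dpeak (x + 1 / 9)"])
      show "u \<le> 5 / 36" using u lm' by simp
      fix x assume x: "u \<le> x" "x \<le> 5 / 36"
      have "\<bar>x\<bar> < 1 / real q" "\<bar>x + 1 / 9\<bar> < 1 / real q" using x u by (auto simp: q abs_if)
      note dpeak_deriv[OF this(1)] dpeak_deriv[OF this(2)]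
      hence "((\<lambda>x. dpeak x - dpeak (x + 1 / 9)) has_real_derivative - ddpeak x - - ddpeak (x + 1 / 9)) (at x)"
        by (intro DERIV_diff) (simp_all only: DERIV_shift)
      moreover have "ddpeak x \<le> ddpeak (x + 1 / 9)" using x u by (intro ddmono) auto
      ultimately show "\<exists>y. ((\<lambda>x. dpeak x - dpeak (x + 1 / 9)) has_real_derivative y) (at x) \<and> 0 \<le> y" by force
    qed
    \<comment> \<open>\<open>dpeak\<close> is known exactly at 1/6 and 1/4; the remaining piece of
      length 1/36 is estimated by \<open>ddpeak (1 / 6) = 5 * pi\<^sup>2\<close>.\<close>
    also have "dpeak (5 / 36) - dpeak (5 / 36 + 1 / 9) = (dpeak (5 / 36) - dpeak (1 / 6)) + (dpeak (1 / 6) - dpeak (1 / 4))" by simp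
    also have "dpeak (5 / 36) - dpeak (1 / 6) \<le> 5 * pi\<^sup>2 * (1 / 6 - 5 / 36)"
    proof (rule dpeak_lip_symmetric[of "1 / 6"])
      show "ddpeak z \<le> 5 * pi\<^sup>2" if "0 < z" "z < 1 / 6" for z
        using ddmono[of z "1 / 6"] that by (simp add: dd6)
    qed (auto simp: q)
    finally show ?thesis by (simp add: E1_def dp4 dp6)
  qed
  have s3: "1.732 \<le> sqrt 3" by (rule real_le_rsqrt) (simp add: power2_eq_square)
  have s3': "sqrt 3 \<le> 1.733" by (rule real_le_lsqrt) (auto simp: power2_eq_square)
  have t30: "tan (pi / (2 * 3)) = sqrt 3 / 3"
  proof -
    have "1 / sqrt 3 = sqrt 3 / (3::real)" by (simp add: divide_simps)
    thus ?thesis using tan_30 by simp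
  qed
  have E: "E < 2 * pi * (sqrt 3 / 3)"
  proof -
    have "5 * pi / 36 + 4 - sqrt 3 + 16 * pi / 72 < 2 * sqrt 3" using s3 pi_approx by simp
    hence "pi * (5 * pi / 36 + 4 - sqrt 3 + 16 * pi / 72) < pi * (2 * sqrt 3)" by (intro mult_strict_left_mono) auto
    hence "(E1 + K / 72) / 3 < 2 * pi * (sqrt 3 / 3)"
      by (simp add: E1_def K_def algebra_simps power2_eq_square)
    moreover have "pi * (sqrt 3 + 4) < pi * (4 * sqrt 3)" using s3 by (intro mult_strict_left_mono) auto
    hence "(sqrt 3 * pi + 4 * pi) / 6 < 2 * pi * (sqrt 3 / 3)" by (simp add: algebra_simps)
    ultimately show ?thesis unfolding E_def max_less_iff_conj by blast
  qed
  have q9: "(real q)\<^sup>2 = 9" "real q = 3" by (simp_all add: q)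
  have "0 \<le> K" by (simp add: K_def)
  moreover have "dpeak u - dpeak v \<le> K * (v - u)" if "- m \<le> u" "u \<le> v" "v \<le> m" for u v
    proof (rule dpeak_lip_symmetric[of m])
      show "ddpeak z \<le> K" if "0 < z" "z < m" for z
        using ddmono[of z "1 / 4"] that lm' by (simp add: dd4 K_def)
    qed (use that lm' q in auto)
  moreover have "dpeak u - dpeak (u + 1 / 9) \<le> E1" if "- m \<le> u" "u + 1 / 9 \<le> m" for u
      by (rule step_symmetric[of "1 / 9" m]) (use step that in auto)
  moreover have "(E1 + K / (9 * (9 - 1))) / 3 \<le> E" by (simp add: E_def)
  moreover have "dpeak (- l) \<le> dpeak (- (1 / 6))" "dpeak (1 / 4) \<le> dpeak m"
      using lm lm' q by (intro dpeak_antimono; simp)+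
    hence "dpeak (- l) - dpeak m \<le> sqrt 3 * pi + 4 * pi" by (simp add: dpeak_minus dp4 dp6)
    hence "(dpeak (- l) - dpeak m) / (3 * (3 - 1)) \<le> (sqrt 3 * pi + 4 * pi) / 6" by simp
    hence "(dpeak (- l) - dpeak m) / (3 * (3 - 1)) \<le> E" unfolding E_def by (rule max.coboundedI2)
  moreover have "E < 2 * pi * tan (pi / (2 * 3))" using E unfolding t30 .
  ultimately show ?thesis unfolding gap_bound_def q9(1) unfolding q9(2) by blast
qed

text \<open>If this failed, the bound \<open>apr\<close> on the asymmetry of the arc would contradict Hermite--Hadamard
  for \<open>cot\<close> (\<open>ln_sin_ratio_ge\<close>).\<close>
lemma cot_mono_key:
  assumes q: "4 \<le> q" and lm: "0 < l" "l \<le> m" "l + m = 1 / real q"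
    and apr: "ln (sin (pi * m)) - ln (sin (pi * l)) \<le> dpeak (- l) / (real q * (real q - 1))"
  shows "- (real q * cot (pi * real q * m)) \<le> cot (pi * m)"
proof (rule ccontr)
  assume "\<not> ?thesis"
  hence neg: "cot (pi * m) < - (real q * cot (pi * real q * m))" by simp
  let ?Q = "real q * (real q - 1)"
  have q4: "4 \<le> real q" using q by simp
  have Q0: "0 < ?Q" using q4 by simp
  have close: "m - l \<le> 1 / ?Q" by (rule endpoints_close[OF lm apr])
  have mq: "m < 1 / real q" "l < 1 / real q" using lm by auto
  have "pi * real q * m = pi - pi * real q * l"
  proof -
    have "real q * m = real q * (1 / real q - l)" using lm by simp
    also have "\<dots> = 1 - real q * l" using q4 by (simp add: right_diff_distrib)
    finally have "pi * (real q * m) = pi * (1 - real q * l)" by (rule arg_cong)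
    thus ?thesis by (simp add: right_diff_distrib)
  qed
  hence "cot (pi * real q * m) = - cot (pi * real q * l)" by (simp add: cot_def)
  with neg have "cot (pi * m) < real q * cot (pi * real q * l)" by simp
  \<comment> \<open>The negated claim bounds the second term from below and leaves a difference of
    cotangents, which is of order m - l.\<close>
  moreover have "dpeak (- l) = pi * (cot (pi * l) - real q * cot (pi * real q * l))"
    using dpeak_eq[of l] lm mq by (simp add: dpeak_minus algebra_simps)
  ultimately have A: "dpeak (- l) < pi * (cot (pi * l) - cot (pi * m))" by simp
  \<comment> \<open>Since q - 1 \<ge> 3. It gives m \<le> 2/(3 q) \<le> 1/6, so pi m \<le>
    0.5236.\<close>
  have "1 / ?Q \<le> (1 / 3) * (1 / real q)" using q4 by (simp add: divide_simps)
  hence m23: "m \<le> 2 / 3 * (1 / real q)" using close lm by linarith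
  have "1 / real q \<le> 1 / 4" using q4 by (intro divide_left_mono) auto
  hence m6: "m \<le> 1 / 6" using m23 by linarith
  have pm: "pi * m \<le> 0.5236" "0 < pi * l" "pi * l \<le> pi * m"
  proof -
    have "pi * m \<le> pi * (1 / 6)" using m6 by (intro mult_left_mono) auto
    also have "\<dots> \<le> 0.5236" using pi_approx by simp
    finally show "pi * m \<le> 0.5236" .
  qed (use lm in auto)
  \<comment> \<open>\<open>sin_ge_cubic\<close> with 0.93 = 1 - 0.28/4, as (pi x)^2 \<le> 0.5236^2 <
    0.28.\<close>
  have sin_low: "0.93 * (pi * x) \<le> sin (pi * x)" if "0 < x" "x \<le> m" for x
  proof -
    have "pi * x \<le> pi * m" using that by simp
    hence "pi * x \<le> 0.5236" using pm(1) by linarith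
    moreover have "0 \<le> pi * x" using that by simp
    ultimately have x: "pi * x \<le> 0.5236" "0 \<le> pi * x" by simp_all
    hence "(pi * x)\<^sup>2 \<le> 0.5236\<^sup>2" by (intro power_mono) auto
    also have "(0.5236 :: real)\<^sup>2 \<le> 0.28" by (simp add: power2_eq_square)
    finally have "0.93 \<le> 1 - (pi * x)\<^sup>2 / 4" by simp
    hence "0.93 * (pi * x) \<le> (1 - (pi * x)\<^sup>2 / 4) * (pi * x)" using x(2) by (intro mult_right_mono)
    also have "\<dots> \<le> sin (pi * x)"
    proof -
      note x(1)
      also have "(0.5236 :: real) \<le> 3" by simp
      also have "3 \<le> pi" using pi_approx by simp
      finally show ?thesis using sin_ge_cubic[OF x(2)] by (simp add: mult.commute)
    qed
    finally show ?thesis .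
  qed
  let ?S = "sin (pi * l) * sin (pi * m)"
  have sin_pos: "0 < sin (pi * x)" if "0 < x" "x \<le> m" for x
    by (rule less_le_trans[OF _ sin_low[OF that]]) (use that in simp)
  hence S0: "0 < ?S" using lm by (intro mult_pos_pos) auto
  have sin0: "0 \<le> sin (pi * l)" using sin_pos[of l] lm by simp
  define C where "C = cot (pi / (2 * real q))"
  have "pi * (m - l) * C \<le> dpeak (- l) / ?Q" using ln_sin_ratio_ge'[OF lm] apr by (simp add: C_def)
  also have "\<dots> < pi * (cot (pi * l) - cot (pi * m)) / ?Q" using A Q0 by (rule divide_strict_right_mono)
  also have "cot (pi * l) - cot (pi * m) = sin (pi * m - pi * l) / ?S"
    using S0 unfolding sin_diff cot_def by (auto simp: divide_simps)
  also have "pi * (sin (pi * m - pi * l) / ?S) / ?Q \<le> pi * ((pi * m - pi * l) / ?S) / ?Q"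
    using S0 Q0 pm by (intro divide_right_mono mult_left_mono sin_x_le_x) auto
  also have "\<dots> = pi * (m - l) * (pi / (?S * ?Q))" by (simp add: right_diff_distrib mult_ac)
  finally have "0 < pi * (m - l) * (pi / (?S * ?Q) - C)" by (simp only: right_diff_distrib)
  moreover have "pi * (m - l) * (pi / (?S * ?Q) - C) \<le> 0" if "pi / (?S * ?Q) \<le> C"
    using lm that by (intro mult_nonneg_nonpos) auto
  ultimately have "C < pi / (?S * ?Q)" by linarith
  hence lt: "C * (?S * ?Q) < pi" using S0 Q0 by (simp add: less_divide_eq)
  \<comment> \<open>With h = pi/(2 q) \<le> pi/8: cot h \<ge> cos h / h, and cos h = 1 - 2 sin^2
    (h/2) \<ge> 1 - 2 * 0.19635^2.\<close>
  have C: "0.9228 * (2 * real q / pi) \<le> C"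
  proof -
    define h where "h = pi / (2 * real q)"
    have h: "0 < h" "h \<le> 0.3927"
    proof -
      have "h \<le> pi / (2 * 4)" unfolding h_def using q4 by (intro divide_left_mono) auto
      thus "h \<le> 0.3927" using pi_approx by simp
    qed (use q4 in \<open>simp add: h_def\<close>)
    have sh: "0 < sin h" using h pi_approx by (intro sin_gt_zero) auto
    have "sin h \<le> h" using h by (intro sin_x_le_x) auto
    have "(sin (h / 2))\<^sup>2 \<le> (0.19635)\<^sup>2"
      using h sin_x_le_x[of "h / 2"] pi_approx by (intro power_mono sin_ge_zero) auto
    hence ch: "0.9228 \<le> cos h" using cos_double_sin[of "h / 2"] by (simp add: power2_eq_square)
    have "0.9228 / h \<le> cos h / sin h" using ch sh \<open>sin h \<le> h\<close> h by (intro frac_le) auto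
    moreover have "1 / h = 2 * real q / pi" by (simp add: h_def)
    ultimately show ?thesis by (simp add: C_def cot_def h_def)
  qed
  \<comment> \<open>4 l m = (l + m)^2 - (m - l)^2 \<ge> (1 - 1/9)/q^2.\<close>
  have lmq: "2 / 9 \<le> (real q)\<^sup>2 * (l * m)"
  proof -
    have "(m - l)\<^sup>2 \<le> ((1 / 3) * (1 / real q))\<^sup>2"
      using close \<open>1 / ?Q \<le> (1 / 3) * (1 / real q)\<close> lm by (intro power_mono) auto
    moreover have "4 * (l * m) = (l + m)\<^sup>2 - (m - l)\<^sup>2" by (simp add: power2_eq_square algebra_simps)
    ultimately have "(1 / real q)\<^sup>2 - ((1 / 3) * (1 / real q))\<^sup>2 \<le> 4 * (l * m)" using lm by simp
    hence "(real q)\<^sup>2 * ((1 / real q)\<^sup>2 - ((1 / 3) * (1 / real q))\<^sup>2) \<le> (real q)\<^sup>2 * (4 * (l * m))"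
      by (intro mult_left_mono) auto
    thus ?thesis using q4 by (simp add: right_diff_distrib power_mult_distrib power_divide mult_ac)
  qed
  have "(0.93 * (pi * l)) * (0.93 * (pi * m)) \<le> ?S"
    using lm pm sin0 by (intro mult_mono sin_low) auto
  hence "(0.93 * (pi * l)) * (0.93 * (pi * m)) * ?Q \<le> ?S * ?Q" using Q0 by (intro mult_right_mono) auto
  hence "0.9228 * (2 * real q / pi) * ((0.93 * (pi * l)) * (0.93 * (pi * m)) * ?Q) \<le> C * (?S * ?Q)"
  proof (rule mult_mono[OF C])
    show "0 \<le> C" by (rule order_trans[OF _ C]) (use q_pos in simp)
    show "0 \<le> 0.93 * (pi * l) * (0.93 * (pi * m)) * ?Q"
      using lm Q0 by (intro mult_nonneg_nonneg[of _ ?Q]) auto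
  qed
  moreover have "0.9228 * (2 * real q / pi) * ((0.93 * (pi * l)) * (0.93 * (pi * m)) * ?Q) =
     0.9228 * 2 * 0.93 * 0.93 * pi * (real q - 1) * ((real q)\<^sup>2 * (l * m))"
    by (simp add: power2_eq_square)
  moreover have "0.9228 * 2 * 0.93 * 0.93 * pi * 3 * (2 / 9) \<le> 0.9228 * 2 * 0.93 * 0.93 * pi * (real q - 1) * ((real q)\<^sup>2 * (l * m))"
    using lmq q4 by (intro mult_mono) auto
  \<comment> \<open>The numerical factor is about 1.06, so the lower bound for
    \<open>C * (?S * ?Q)\<close> is at least pi, contrary to \<open>lt\<close>.\<close>
  moreover have "pi * 1 \<le> pi * (0.9228 * 2 * 0.93 * 0.93 * 3 * (2 / 9))" by (intro mult_left_mono) auto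
  hence "pi \<le> 0.9228 * 2 * 0.93 * 0.93 * pi * 3 * (2 / 9)" by simp
  ultimately show False using lt by linarith
qed

text \<open>By 1/sin^2 = 1 + cot^2 the claim is |q cot (pi q z)| \<le> cot (pi z). Where the left
  cotangent is positive this is \<open>dpeak z \<le> 0\<close>; where it is negative the worst case
  is z = m, which is \<open>cot_mono_key\<close>.\<close>

lemma ddpeak_bound_4:
  assumes q: "4 \<le> q" and lm: "0 < l" "l \<le> m" "l + m = 1 / real q"
    and apr: "ln (sin (pi * m)) - ln (sin (pi * l)) \<le> dpeak (- l) / (real q * (real q - 1))"
    and z: "0 < z" "z < m"
  shows "ddpeak z \<le> pi\<^sup>2 * ((real q)\<^sup>2 - 1)"
proof -
  have mq: "m < 1 / real q" using lm by simp
  have rng: "0 < pi * real q * x" "pi * real q * x < pi" "0 < pi * x" "pi * x < pi" if "0 < x" "x \<le> m" for x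
  proof -
    have "real q * x \<le> real q * m" using that by (intro mult_left_mono) auto
    also have "\<dots> < 1" using mq q_pos by (simp add: less_divide_eq mult.commute)
    finally have "real q * x < 1" .
    hence "pi * (real q * x) < pi * 1" by (intro mult_strict_left_mono) auto
    thus "pi * real q * x < pi" by simp
    have "1 / real q \<le> 1" using q_ge2 by simp
    hence "x < 1" using that mq by linarith
    thus "pi * x < pi" by simp
  qed (use that q_pos in auto)
  let ?c = "cot (pi * real q * z)" and ?d = "cot (pi * z)"
  have "\<bar>real q * ?c\<bar> \<le> ?d"
  proof (cases "0 \<le> ?c")
    case True
    have "dpeak z \<le> dpeak 0" using z mq q_pos by (intro dpeak_antimono) auto
    hence "real q * ?c \<le> ?d" using dpeak_eq[of z] z mq pi_gt_zero by (auto simp: mult_le_0_iff)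
    thus ?thesis using True q_pos by simp
  next
    case False
    have "pi * real q * z \<le> pi * real q * m" using z by (intro mult_left_mono) auto
    hence "cot (pi * real q * m) \<le> ?c"
      using z rng[of z] rng[of m] by (intro cot_antimono) auto
    hence "- (real q * ?c) \<le> - (real q * cot (pi * real q * m))" using q_pos by simp
    also have "\<dots> \<le> cot (pi * m)" by (rule cot_mono_key[OF q lm apr])
    also have "\<dots> \<le> ?d" using z rng[of z] rng[of m] by (intro cot_antimono) auto
    finally show ?thesis using False q_pos by (simp add: abs_mult)
  qed
  hence "(real q * ?c)\<^sup>2 \<le> ?d\<^sup>2" by (rule abs_le_square_iff[THEN iffD1, OF order_trans]) simp
  hence sq: "(real q)\<^sup>2 - 1 + (real q * ?c)\<^sup>2 - ?d\<^sup>2 \<le> (real q)\<^sup>2 - 1" by simp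
  have inv: "1 / (sin y)\<^sup>2 = 1 + (cot y)\<^sup>2" if "0 < y" "y < pi" for y :: real
    using sin_gt_zero[OF that] by (simp add: cot_def power_divide divide_simps)
  have "ddpeak z = pi\<^sup>2 * ((real q)\<^sup>2 * (1 / (sin (pi * real q * z))\<^sup>2) - 1 / (sin (pi * z))\<^sup>2)"
    using ddpeak_eq[of z] z mq by simp
  also have "\<dots> = pi\<^sup>2 * ((real q)\<^sup>2 - 1 + (real q * ?c)\<^sup>2 - ?d\<^sup>2)"
    using inv rng[of z] z by (simp add: algebra_simps power_mult_distrib)
  also have "\<dots> \<le> pi\<^sup>2 * ((real q)\<^sup>2 - 1)" using sq by (intro mult_left_mono) auto
  finally show ?thesis .
qed

text \<open>The right-hand side is the minimum over \<open>(0, 1 - 1 / q)\<close> of the derivative of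
  \<open>ln (sin (pi x)) - ln (sin (pi (x + 1 / q)))\<close>.\<close>
lemma subder_gap:
  obtains E where "E < 2 * pi * tan (pi / (2 * real q))"
    "\<And>x. subder \<gamma> (cphase \<gamma>) x - subder \<gamma> (cphase \<gamma>) (x + 1 / real q) \<le> E"
proof -
  define c where "c = cphase \<gamma>"
  note adm = cphase(1)[of \<gamma>, folded c_def] and jump = cphase(2)[of \<gamma>, folded c_def]
  define a where "a = - (\<gamma> + c)"
  define b where "b = \<gamma> + c + 1 / real q"
  have ab: "0 < a" "0 < b" "a + b = 1 / real q" using adm by (auto simp: a_def b_def adm_def)
  \<comment> \<open>Distances from the peak to the nearer and to the farther end of the arc.\<close>
  define l where "l = min a b"
  define m where "m = max a b"
  have lm: "0 < l" "l \<le> m" "l + m = 1 / real q" using ab by (auto simp: l_def m_def min_def max_def)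
  have apr: "ln (sin (pi * m)) - ln (sin (pi * l)) \<le> dpeak (- l) / (real q * (real q - 1))"
    using apriori[OF adm jump] by (auto simp: l_def m_def min_def max_def a_def b_def)
  have in_m: "- m \<le> x + c" if "\<gamma> \<le> x" for x using that by (auto simp: m_def a_def max_def)
  have in_m': "x + c \<le> m" if "x \<le> \<gamma> + 1 / real q" for x using that by (auto simp: m_def b_def max_def)
  show thesis
  proof (cases "q = 2 \<or> q = 3")
    case True
    hence "gap_bound l m" using gap_bound_2[OF _ lm apr] gap_bound_3[OF _ lm apr] by blast
    then obtain K E1 E where KE: "0 \<le> K" "\<And>u v. - m \<le> u \<Longrightarrow> u \<le> v \<Longrightarrow> v \<le> m \<Longrightarrow> dpeak u - dpeak v \<le> K * (v - u)"
       "\<And>u. - m \<le> u \<Longrightarrow> u + 1 / (real q)\<^sup>2 \<le> m \<Longrightarrow> dpeak u - dpeak (u + 1 / (real q)\<^sup>2) \<le> E1"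
       "(E1 + K / ((real q)\<^sup>2 * ((real q)\<^sup>2 - 1))) / real q \<le> E"
       "(dpeak (- l) - dpeak m) / (real q * (real q - 1)) \<le> E" "E < 2 * pi * tan (pi / (2 * real q))"
      unfolding gap_bound_def by blast
    have ends: "dpeak (\<gamma> + c) - dpeak (\<gamma> + c + 1 / real q) = dpeak (- l) - dpeak m"
    proof -
      have "\<gamma> + c = - a" "\<gamma> + c + 1 / real q = b" by (auto simp: a_def b_def)
      hence "dpeak (\<gamma> + c) - dpeak (\<gamma> + c + 1 / real q) = dpeak (- a) - dpeak b" by (simp only:)
      thus ?thesis by (auto simp: dpeak_minus l_def m_def min_def max_def)
    qed
    have "subder \<gamma> c x - subder \<gamma> c (x + 1 / real q) \<le> E" for x
    proof (rule subder_step[OF adm KE(1)])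
      show "dpeak (u + c) - dpeak (v + c) \<le> K * (v - u)" if "\<gamma> \<le> u" "u \<le> v" "v \<le> \<gamma> + 1 / real q" for u v
        using KE(2)[OF in_m[OF that(1)] _ in_m'[OF that(3)]] that by simp
      show "dpeak (u + c) - dpeak (u + c + 1 / (real q)\<^sup>2) \<le> E1"
        if "\<gamma> \<le> u" "u + 1 / (real q)\<^sup>2 \<le> \<gamma> + 1 / real q" for u
        using KE(3)[OF in_m[OF that(1)]] in_m'[OF that(2)] by (simp add: add_ac)
    qed (use KE ends in auto)
    thus thesis using that[OF KE(6)] by (simp add: c_def)
  next
    case False
    hence q4: "4 \<le> q" using q2 by linarith
    \<comment> \<open>With this \<open>?K\<close> the constant of \<open>subder_semiconvex\<close>
      is pi^2. The resulting gap pi^2/q equals 2 pi h with h = pi/(2 q), below the target because h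
      < tan h.\<close>
    let ?K = "pi\<^sup>2 * ((real q)\<^sup>2 - 1)"
    have q1: "1 < (real q)\<^sup>2" using q_ge2 by (intro one_less_power) auto
    have gap: "subder \<gamma> c x - subder \<gamma> c (x + 1 / real q) \<le> pi\<^sup>2 / real q" for x
    proof -
      have "1 / real q \<le> 1" using q_ge2 by simp
      hence "subder \<gamma> c x - subder \<gamma> c (x + 1 / real q) \<le> ?K / ((real q)\<^sup>2 - 1) * (x + 1 / real q - x)"
      proof (intro subder_semiconvex[OF adm])
        show "dpeak (u + c) - dpeak (v + c) \<le> ?K * (v - u)" if "\<gamma> \<le> u" "u \<le> v" "v \<le> \<gamma> + 1 / real q" for u v
        proof -
          have "dpeak (u + c) - dpeak (v + c) \<le> ?K * ((v + c) - (u + c))"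
            by (rule dpeak_lip_symmetric[of m])
               (use ddpeak_bound_4[OF q4 lm apr] in_m[OF that(1)] in_m'[OF that(3)] that lm in auto)
          thus ?thesis by simp
        qed
      qed (use q1 in auto)
      thus ?thesis using q1 by simp
    qed
    have "pi\<^sup>2 / real q < 2 * pi * tan (pi / (2 * real q))"
    proof -
      define h where "h = pi / (2 * real q)"
      have h: "0 < h" "h < pi / 2"
      proof -
        show "0 < h" using q_pos by (simp add: h_def)
        show "h < pi / 2" unfolding h_def using q_ge2 by (intro divide_strict_left_mono) auto
      qed
      have "h * cos h < sin h" using h by (intro x_cos_less_sin) auto
      hence "h < tan h" using cos_gt_zero[of h] h by (simp add: tan_def less_divide_eq)
      hence "2 * pi * h < 2 * pi * tan h" by simp
      thus ?thesis by (simp add: h_def power2_eq_square)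
    qed
    thus thesis using that gap by (simp add: c_def)
  qed
qed

section \<open>The sub-action\<close>

text \<open>The primitive vanishing at 0; the integral over a reversed interval is 0, hence the
  separate case of negative x.\<close>

definition psi :: "real \<Rightarrow> real \<Rightarrow> real" where
  "psi \<gamma> x = (if 0 \<le> x then integral {0..x} (subder \<gamma> (cphase \<gamma>))
              else - integral {x..0} (subder \<gamma> (cphase \<gamma>)))"

lemma psi_diff:
  assumes "x \<le> y"
  shows "psi \<gamma> y - psi \<gamma> x = integral {x..y} (subder \<gamma> (cphase \<gamma>))"
proof -
  have c: "integral {u..v} (subder \<gamma> (cphase \<gamma>)) + integral {v..w} (subder \<gamma> (cphase \<gamma>)) =
      integral {u..w} (subder \<gamma> (cphase \<gamma>))" if "u \<le> v" "v \<le> w" for u v w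
    using that by (intro Henstock_Kurzweil_Integration.integral_combine subder_integrable cphase)
  consider "0 \<le> x" | "x < 0" "0 \<le> y" | "y < 0" by linarith
  thus ?thesis
  proof cases
    case 1 thus ?thesis using c[of 0 x y] assms by (simp add: psi_def)
  next
    case 2 thus ?thesis using c[of x 0 y] assms by (simp add: psi_def)
  next
    case 3 thus ?thesis using c[of x y 0] assms by (simp add: psi_def)
  qed
qed

text \<open>This is what the phase was chosen for: \<open>jump\<close> vanishes at
  \<open>cphase \<gamma>\<close>.\<close>

lemma psi_periodic: "psi \<gamma> (x + 1) = psi \<gamma> x"
proof -
  have "psi \<gamma> (x + 1) - psi \<gamma> x = integral {x..x + 1} (subder \<gamma> (cphase \<gamma>))" by (rule psi_diff) simp
  also have "\<dots> = jump \<gamma> (cphase \<gamma>)"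
    unfolding jump_def by (rule integral_period) (auto intro: subder_periodic subder_integrable cphase)
  finally show ?thesis by (simp add: cphase)
qed

lemma psi_of_int: "psi \<gamma> (x + of_int k) = psi \<gamma> x"
  by (rule periodic_of_int) (rule psi_periodic)

lemma psi_lipschitz:
  obtains M where "0 \<le> M" "\<And>x y. \<bar>psi \<gamma> x - psi \<gamma> y\<bar> \<le> M * \<bar>x - y\<bar>"
proof -
  define c where "c = cphase \<gamma>"
  define M where "M = (dpeak (\<gamma> + c) - dpeak (\<gamma> + c + 1 / real q)) / (real q - 1)"
  have M: "\<bar>subder \<gamma> c x\<bar> \<le> M" for x unfolding M_def c_def by (rule subder_bounded[OF cphase(1)])
  have *: "\<bar>psi \<gamma> y - psi \<gamma> x\<bar> \<le> M * \<bar>y - x\<bar>" if "x \<le> y" for x y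
  proof -
    have "\<bar>integral {x..y} (subder \<gamma> c)\<bar> \<le> integral {x..y} (\<lambda>_. M)"
      unfolding real_norm_def[symmetric]
      by (rule integral_norm_bound_integral) (use M in \<open>auto intro: subder_integrable cphase simp: c_def\<close>)
    thus ?thesis using psi_diff[OF that, of \<gamma>] that by (simp add: c_def mult.commute)
  qed
  show thesis
  proof (rule that)
    show "0 \<le> M" using M[of 0] by linarith
    show "\<bar>psi \<gamma> x - psi \<gamma> y\<bar> \<le> M * \<bar>x - y\<bar>" for x y
      using *[of x y] *[of y x] by (cases "x \<le> y") (auto simp: abs_minus_commute)
  qed
qed

lemma psi_continuous: "continuous_on UNIV (psi \<gamma>)"
proof -
  obtain M where M: "0 \<le> M" "\<And>x y. \<bar>psi \<gamma> x - psi \<gamma> y\<bar> \<le> M * \<bar>x - y\<bar>" by (rule psi_lipschitz[of \<gamma>]) blast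
  have "M-lipschitz_on UNIV (psi \<gamma>)" by (rule lipschitz_onI) (use M in \<open>auto simp: dist_real_def\<close>)
  thus ?thesis by (rule lipschitz_on_continuous_on)
qed

lemma psi_bounded: obtains B where "\<And>x. \<bar>psi \<gamma> x\<bar> \<le> B"
proof -
  obtain M where M: "0 \<le> M" "\<And>x y. \<bar>psi \<gamma> x - psi \<gamma> y\<bar> \<le> M * \<bar>x - y\<bar>" by (rule psi_lipschitz[of \<gamma>]) blast
  have "\<bar>psi \<gamma> x\<bar> \<le> M" for x
  proof -
    have "psi \<gamma> x = psi \<gamma> (frac x)" using psi_of_int[of \<gamma> "frac x" "\<lfloor>x\<rfloor>"] by (simp add: frac_def)
    moreover have "psi \<gamma> 0 = 0" by (simp add: psi_def)
    ultimately have "\<bar>psi \<gamma> x\<bar> \<le> M * frac x" using M(2)[of "frac x" 0] by simp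
    also have "\<dots> \<le> M * 1" using M(1) frac_lt_1[of x] by (intro mult_left_mono) auto
    finally show ?thesis by simp
  qed
  thus thesis by (rule that)
qed

lemma psi_branch:
  assumes "\<gamma> \<le> x" "x \<le> \<gamma> + 1 / real q"
  shows "psi \<gamma> (real q * x) - psi \<gamma> (real q * \<gamma>) =
     peak (x + cphase \<gamma>) - peak (\<gamma> + cphase \<gamma>) + psi \<gamma> x - psi \<gamma> \<gamma>"
proof -
  have "real q * x \<le> real q * (\<gamma> + 1 / real q)" using assms by (intro mult_left_mono) auto
  also have "\<dots> = real q * \<gamma> + 1" using q_pos by (simp add: distrib_left)
  finally have b: "real q * \<gamma> \<le> real q * x" "real q * x \<le> real q * \<gamma> + 1" using assms by (auto intro: mult_left_mono)
  show ?thesis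
    using subder_integral_branch[OF cphase(1) b] psi_diff[OF b(1), of \<gamma>] psi_diff[OF assms(1), of \<gamma>] q_pos by simp
qed

text \<open>On \<open>(0, 1)\<close>, the function \<open>f + psi\<close> differs from this one by a function of \<open>T x\<close> only,
  because \<open>\<bar>sin (pi q y)\<bar>\<close> is \<open>1 / q\<close>-periodic.\<close>
definition ridge :: "real \<Rightarrow> real \<Rightarrow> real" where
  "ridge \<gamma> y = psi \<gamma> (y - cphase \<gamma>) - ln (sin (pi * y))"

text \<open>\<open>psi\<close> is known only as an integral, so its part is bounded by integrating
  \<open>subder_gap\<close> and the logarithmic part by the mean value theorem.\<close>

lemma ridge_step_decreasing:
  assumes "0 < x" "x < y" "y < 1 - 1 / real q"
  shows "ridge \<gamma> y - ridge \<gamma> (y + 1 / real q) < ridge \<gamma> x - ridge \<gamma> (x + 1 / real q)"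
proof -
  obtain E where E: "E < 2 * pi * tan (pi / (2 * real q))"
    "\<And>x. subder \<gamma> (cphase \<gamma>) x - subder \<gamma> (cphase \<gamma>) (x + 1 / real q) \<le> E" by (rule subder_gap[of \<gamma>]) blast
  let ?D = "subder \<gamma> (cphase \<gamma>)" and ?c = "cphase \<gamma>"
  let ?r = "\<lambda>x. ln (sin (pi * (x + 1 / real q))) - ln (sin (pi * x))"
  have "integral {x - ?c..y - ?c} (\<lambda>t. ?D t - ?D (t + 1 / real q)) \<le> integral {x - ?c..y - ?c} (\<lambda>_. E)"
    using subder_integrable[OF cphase(1)[of \<gamma>]] E(2)
    by (intro integral_le integrable_diff) (auto intro!: integrable_on_bounded_borel[OF _ subder_bounded[OF cphase(1)]])
  also have "\<dots> = E * (y - x)" using assms by (simp add: mult.commute)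
  also have "integral {x - ?c..y - ?c} (\<lambda>t. ?D t - ?D (t + 1 / real q)) =
     integral {x - ?c..y - ?c} ?D - integral {x - ?c..y - ?c} (\<lambda>t. ?D (t + 1 / real q))"
    by (intro Henstock_Kurzweil_Integration.integral_diff subder_integrable cphase)
       (auto intro!: integrable_on_bounded_borel[OF _ subder_bounded[OF cphase(1)]])
  also have "integral {x - ?c..y - ?c} (\<lambda>t. ?D (t + 1 / real q)) = integral {x - ?c + 1 / real q..y - ?c + 1 / real q} ?D"
    by (intro integral_shift_real subder_integrable cphase)
  also have "\<dots> = psi \<gamma> (y - ?c + 1 / real q) - psi \<gamma> (x - ?c + 1 / real q)"
    using assms by (intro psi_diff[symmetric]) simp
  also have "integral {x - ?c..y - ?c} ?D = psi \<gamma> (y - ?c) - psi \<gamma> (x - ?c)"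
    using assms by (intro psi_diff[symmetric]) simp
  finally have 1: "(psi \<gamma> (y - ?c) - psi \<gamma> (x - ?c)) - (psi \<gamma> (y - ?c + 1 / real q) - psi \<gamma> (x - ?c + 1 / real q)) \<le> E * (y - x)" .
  have pos: "0 < sin (pi * z)" "0 < sin (pi * (z + 1 / real q))" if "x \<le> z" "z \<le> y" for z
  proof -
    have "0 < 1 / real q" using q_pos by simp
    hence "0 < z" "z < 1" "0 < z + 1 / real q" "z + 1 / real q < 1" using that assms by linarith+
    thus "0 < sin (pi * z)" "0 < sin (pi * (z + 1 / real q))" by (auto intro!: sin_gt_zero)
  qed
  have "\<exists>z. z > x \<and> z < y \<and> ?r y - ?r x = (y - x) * (pi * (cot (pi * (z + 1 / real q)) - cot (pi * z)))"
  proof (rule MVT2[OF assms(2)])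
    fix z assume z: "x \<le> z" "z \<le> y"
    have "(?r has_real_derivative (cos (pi * (z + 1 / real q)) * pi) / sin (pi * (z + 1 / real q)) - (cos (pi * z) * pi) / sin (pi * z)) (at z)"
      using pos[OF z] by (auto intro!: derivative_eq_intros simp: divide_inverse)
    thus "(?r has_real_derivative pi * (cot (pi * (z + 1 / real q)) - cot (pi * z))) (at z)"
      by (simp add: cot_def right_diff_distrib mult.commute)
  qed
  then obtain z where z: "x < z" "z < y" "?r y - ?r x = (y - x) * (pi * (cot (pi * (z + 1 / real q)) - cot (pi * z)))" by blast
  \<comment> \<open>The difference is sin (2 h) / (sin u sin (u + 2 h)), and the denominator is at
    most cos^2 h, with equality when z and z + 1/q are symmetric about 1/2.\<close>
  have "2 * tan (pi / (2 * real q)) \<le> cot (pi * z) - cot (pi * (z + 1 / real q))"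
  proof -
    define h where "h = pi / (2 * real q)"
    have h: "0 < h" "h < pi / 2" unfolding h_def
    proof -
      show "0 < pi / (2 * real q)" using q_pos by simp
      show "pi / (2 * real q) < pi / 2" using q_ge2 by (intro divide_strict_left_mono) auto
    qed
    have ch: "0 < cos h" "0 < sin h" using h by (auto intro!: cos_gt_zero sin_gt_zero)
    define u where "u = pi * z"
    have u: "pi * (z + 1 / real q) = u + 2 * h" by (simp add: u_def h_def distrib_left)
    have s: "0 < sin u" "0 < sin (u + 2 * h)" using pos[of z] z by (auto simp: u u_def)
    have "sin u * sin (u + 2 * h) = (cos (u - (u + 2 * h)) - cos (u + (u + 2 * h))) / 2" by (rule sin_times_sin)
    also have "u - (u + 2 * h) = - (2 * h)" by simp
    also have "(cos (- (2 * h)) - cos (u + (u + 2 * h))) / 2 \<le> (cos (2 * h) + 1) / 2"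
    proof -
      have "(A - B) / 2 \<le> (A + 1) / 2" if "- 1 \<le> B" for A B :: real using that by simp
      from this[OF cos_ge_minus_one] show ?thesis unfolding cos_minus .
    qed
    also have "\<dots> = (cos h)\<^sup>2" by (simp add: cos_double_cos)
    finally have le: "sin u * sin (u + 2 * h) \<le> (cos h)\<^sup>2" .
    have "2 * tan h = sin (2 * h) / (cos h)\<^sup>2" using ch by (simp add: tan_def sin_double power2_eq_square)
    also have "\<dots> \<le> sin (2 * h) / (sin u * sin (u + 2 * h))"
      using le s ch by (intro divide_left_mono mult_pos_pos) (auto simp: sin_double)
    also have "\<dots> = sin ((u + 2 * h) - u) / (sin u * sin (u + 2 * h))" by simp
    also have "\<dots> = cot u - cot (u + 2 * h)"
      unfolding sin_diff cot_def using s by (simp add: divide_simps)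
    finally show ?thesis by (simp add: u u_def h_def)
  qed
  hence "(y - x) * (pi * (cot (pi * (z + 1 / real q)) - cot (pi * z))) \<le> (y - x) * (pi * - (2 * tan (pi / (2 * real q))))"
    using assms by (intro mult_left_mono) auto
  moreover have "E * (y - x) < 2 * pi * tan (pi / (2 * real q)) * (y - x)"
    using E(1) assms by (intro mult_strict_right_mono) auto
  ultimately have "?r y - ?r x + E * (y - x) < 0" using z(3) by (simp add: algebra_simps)
  thus ?thesis using 1 by (simp add: ridge_def algebra_simps)
qed

lemma ridge_fibre_convex:
  assumes "0 < x" "x < 1 / real q" "i < j" "j < q - 1"
  shows "ridge \<gamma> (x + real j / real q) - ridge \<gamma> (x + real (Suc j) / real q) <
         ridge \<gamma> (x + real i / real q) - ridge \<gamma> (x + real (Suc i) / real q)"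
proof -
  have j: "real j \<le> real q - 2" using assms(4) q2 by linarith
  have "x + real j / real q < 1 / real q + (real q - 2) / real q"
    using assms(2) j q_pos by (intro add_less_le_mono divide_right_mono) auto
  also have "\<dots> = 1 - 1 / real q" using q_pos by (simp add: diff_divide_distrib)
  finally have "x + real j / real q < 1 - 1 / real q" .
  moreover have "x + real i / real q < x + real j / real q" using assms q_pos by (simp add: divide_strict_right_mono)
  moreover have "x + real (Suc k) / real q = x + real k / real q + 1 / real q" for k by (simp add: add_divide_distrib)
  moreover have "0 < x + real i / real q" using assms by (simp add: add_pos_nonneg)
  ultimately show ?thesis using ridge_step_decreasing[of "x + real i / real q" "x + real j / real q" \<gamma>] by metis
qed

text \<open>Decides which end of a fibre is higher: by telescoping, the difference of the end values
  strictly decreases, and \<open>ridge_root\<close> locates its zero.\<close>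

lemma ridge_ends_decreasing:
  assumes "0 < x" "x < y" "y < 1 / real q"
  shows "ridge \<gamma> y - ridge \<gamma> (y + real (q - 1) / real q) < ridge \<gamma> x - ridge \<gamma> (x + real (q - 1) / real q)"
proof -
  have tele: "ridge \<gamma> z - ridge \<gamma> (z + real (q - 1) / real q) =
     (\<Sum>i<q-1. ridge \<gamma> (z + real i / real q) - ridge \<gamma> (z + real (Suc i) / real q))" for z
    using sum_lessThan_telescope'[of "\<lambda>i. ridge \<gamma> (z + real i / real q)" "q - 1"] by simp
  show ?thesis unfolding tele
  proof (rule sum_strict_mono)
    fix i assume "i \<in> {..<q-1}"
    hence i: "real i \<le> real q - 2" using q2 by auto
    have "y + real i / real q < 1 / real q + (real q - 2) / real q"
      using assms(3) i q_pos by (intro add_less_le_mono divide_right_mono) auto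
    also have "\<dots> = 1 - 1 / real q" using q_pos by (simp add: diff_divide_distrib)
    finally have "y + real i / real q < 1 - 1 / real q" .
    moreover have e: "z + real (Suc i) / real q = z + real i / real q + 1 / real q" for z by (simp add: add_divide_distrib)
    have "0 < x + real i / real q" using assms by (simp add: add_pos_nonneg)
    ultimately show "ridge \<gamma> (y + real i / real q) - ridge \<gamma> (y + real (Suc i) / real q) <
        ridge \<gamma> (x + real i / real q) - ridge \<gamma> (x + real (Suc i) / real q)"
      unfolding e using assms by (intro ridge_step_decreasing) auto
  qed (use q2 in \<open>auto simp: lessThan_empty_iff\<close>)
qed

text \<open>The constant of the cohomological equation, read off at x = \<gamma>; it bounds the
  integral of \<open>fc\<close> for every invariant measure
  (\<open>integral_fc_max_iff\<close>).\<close>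

definition topval :: "real \<Rightarrow> real" where
  "topval \<gamma> = peak (\<gamma> + cphase \<gamma>) + psi \<gamma> \<gamma> - psi \<gamma> (real q * \<gamma>)"

lemma fc_peak:
  assumes "\<bar>x + c\<bar> < 1 / real q"
  shows "fc q c x = ereal (peak (x + c))"
proof (cases "x + c = 0")
  case True
  thus ?thesis using q_pos by (simp add: fc_def dratio_def peak_0)
next
  case False
  have "\<bar>real q * (x + c)\<bar> = real q * \<bar>x + c\<bar>" by (simp only: abs_mult abs_of_nat)
  also have "\<dots> < real q * (1 / real q)" using assms q_pos by (intro mult_strict_left_mono)
  finally have "\<bar>real q * (x + c)\<bar> < 1" using q_pos by simp
  hence nz: "sin (pi * (real q * (x + c))) \<noteq> 0" using False q_pos by (intro sin_nz) auto
  have "1 / real q \<le> 1" using q_ge2 by simp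
  hence nz': "sin (pi * (x + c)) \<noteq> 0" using assms False by (intro sin_nz) auto
  show ?thesis using nz nz' peak_eq[OF False assms] by (simp add: fc_def dratio_def mult.assoc)
qed

lemma cphase_bounds:
  "- (1 / real q) < \<gamma> + cphase \<gamma>" "\<gamma> + cphase \<gamma> < 0"
  using cphase(1)[of \<gamma>] by (auto simp: adm_def)

lemma subaction_eq:
  assumes "\<gamma> \<le> x" "x \<le> \<gamma> + 1 / real q"
  shows "fc q (cphase \<gamma>) x = ereal (topval \<gamma> - psi \<gamma> x + psi \<gamma> (real q * x))"
proof -
  have "\<bar>x + cphase \<gamma>\<bar> < 1 / real q" using cphase_bounds[of \<gamma>] assms by auto
  thus ?thesis using psi_branch[OF assms] by (simp add: fc_peak topval_def)
qed

text \<open>The two ends of the arc have the same image under T, so \<open>psi_branch\<close>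
  compares them. Shifted by c they are \<open>b\<close> and, up to a full turn,
  \<open>b + real (q - 1) / real q\<close>.\<close>

lemma ridge_root:
  fixes \<gamma> :: real
  defines "b \<equiv> \<gamma> + cphase \<gamma> + 1 / real q"
  shows "ridge \<gamma> b = ridge \<gamma> (b + real (q - 1) / real q)"
proof -
  define a where "a = - (\<gamma> + cphase \<gamma>)"
  have a: "0 < a" "a < 1 / real q" using cphase_bounds[of \<gamma>] by (auto simp: a_def)
  have b1: "b + real (q - 1) / real q = 1 - a" "1 / real q - a = b"
    using q_pos q2 by (auto simp: b_def a_def of_nat_diff diff_divide_distrib)
  have "sin (pi * (1 - a)) = sin (pi * a)" by (simp add: right_diff_distrib)
  moreover have "psi \<gamma> (1 - a - cphase \<gamma>) = psi \<gamma> \<gamma>" using psi_periodic[of \<gamma> \<gamma>] by (simp add: a_def add.commute)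
  ultimately have R: "ridge \<gamma> (b + real (q - 1) / real q) = psi \<gamma> \<gamma> - ln (sin (pi * a))"
    unfolding b1 ridge_def by simp
  have L: "ridge \<gamma> b = psi \<gamma> (\<gamma> + 1 / real q) - ln (sin (pi * b))"
  proof -
    have "b - cphase \<gamma> = \<gamma> + 1 / real q" by (simp add: b_def)
    thus ?thesis by (simp add: ridge_def)
  qed
  have "psi \<gamma> (real q * (\<gamma> + 1 / real q)) = psi \<gamma> (real q * \<gamma>)"
    using psi_periodic[of \<gamma> "real q * \<gamma>"] q_pos by (simp add: distrib_left)
  hence "0 = peak (\<gamma> + 1 / real q + cphase \<gamma>) - peak (\<gamma> + cphase \<gamma>) + psi \<gamma> (\<gamma> + 1 / real q) - psi \<gamma> \<gamma>"
    using psi_branch[of \<gamma> "\<gamma> + 1 / real q"] by simp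
  moreover have "\<gamma> + 1 / real q + cphase \<gamma> = b" "\<gamma> + cphase \<gamma> = - a" by (auto simp: a_def b_def)
  ultimately have "0 = peak b - peak (- a) + psi \<gamma> (\<gamma> + 1 / real q) - psi \<gamma> \<gamma>" by (simp only:)
  moreover have "peak b - peak (- a) = ln (sin (pi * a)) - ln (sin (pi * b))" using peak_diff_end[OF a] b1 by simp
  ultimately show ?thesis unfolding L R by linarith
qed

lemma subaction_less:
  assumes x: "\<gamma> + 1 / real q < x" "x < \<gamma> + 1"
  shows "fc q (cphase \<gamma>) x < ereal (topval \<gamma> - psi \<gamma> x + psi \<gamma> (real q * x))"
proof -
  define c where "c = cphase \<gamma>"
  define b where "b = \<gamma> + c + 1 / real q"
  define y where "y = x + c"
  \<comment> \<open>y = z + i/q is the i-th point of its fibre, with 0 < z < 1/q once the zeros of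
    the numerator are excluded.\<close>
  define i where "i = nat \<lfloor>real q * y\<rfloor>"
  define z where "z = y - real i / real q"
  have b: "0 < b" "b < 1 / real q" using cphase_bounds[of \<gamma>] by (auto simp: b_def c_def)
  have y: "b < y" "y < b + real (q - 1) / real q" "0 < y" "y < 1"
    using x b q_pos q2 cphase_bounds[of \<gamma>] by (auto simp: y_def b_def c_def of_nat_diff diff_divide_distrib)
  have sy: "0 < sin (pi * y)" using y by (intro sin_gt_zero) auto
  show ?thesis
  proof (cases "sin (pi * real q * y) = 0")
    case True
    hence "fc q c x = - \<infinity>" using sy by (simp add: fc_def dratio_def y_def)
    thus ?thesis by (simp add: c_def)
  next
    case nz: False
    have i: "real i \<le> real q * y" "real q * y < real i + 1"
      using y q_pos unfolding i_def by (auto simp: of_nat_nat)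
    have "real q * y < real q * 1" using y q_pos by (intro mult_strict_left_mono) auto
    hence iq: "i \<le> q - 1" using i by linarith
    have "real q * y \<noteq> real i"
    proof
      assume "real q * y = real i"
      hence "pi * real q * y = real i * pi" by simp
      thus False using nz by (simp only: sin_npi)
    qed
    hence "0 < real q * z" "real q * z < 1" using i q_pos by (auto simp: z_def right_diff_distrib)
    hence z: "0 < z" "z < 1 / real q" using q_pos by (auto simp: zero_less_mult_iff field_simps)
    have yz: "y = z + real i / real q" by (simp add: z_def)
    have gap: "ridge \<gamma> (z + real k / real q) < max (ridge \<gamma> z) (ridge \<gamma> (z + real (q - 1) / real q))"
      if "0 < k" "k < q - 1" for k
      using discrete_strict_convex[of "q - 1" "\<lambda>i. ridge \<gamma> (z + real i / real q)" k]
        ridge_fibre_convex[OF z] that by simp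
    have ends: "ridge \<gamma> (z + real (q - 1) / real q) < ridge \<gamma> z" if "z < b"
      using ridge_ends_decreasing[of z b \<gamma>] ridge_root[of \<gamma>] that z b by (simp add: b_def c_def)
    have ends': "ridge \<gamma> z < ridge \<gamma> (z + real (q - 1) / real q)" if "b < z"
      using ridge_ends_decreasing[of b z \<gamma>] ridge_root[of \<gamma>] that z b by (simp add: b_def c_def)
    have ends0: "ridge \<gamma> (z + real (q - 1) / real q) = ridge \<gamma> z" if "z = b"
      using ridge_root[of \<gamma>] that by (simp add: b_def c_def)
    \<comment> \<open>The fibre point in the arc shifted by c: the first one if z \<le> b, otherwise
      the last one moved back by a full turn.\<close>
    define Y where "Y = (if z \<le> b then z else z - 1 / real q)"
    have Yr: "\<gamma> \<le> Y - c" "Y - c \<le> \<gamma> + 1 / real q" using z b by (auto simp: Y_def b_def)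
    have Ynz: "Y \<noteq> 0" "\<bar>Y\<bar> < 1 / real q" using z b by (auto simp: Y_def)
    have hY: "ridge \<gamma> y < psi \<gamma> (Y - c) - ln \<bar>sin (pi * Y)\<bar>"
    proof (cases "z \<le> b")
      case True
      have "i \<noteq> 0" using y True yz by (intro notI) simp
      have "ridge \<gamma> y < ridge \<gamma> z"
      proof (cases "i = q - 1")
        case True
        hence "z < b" using y yz by simp
        thus ?thesis using ends True yz by simp
      next
        case False
        hence "ridge \<gamma> y < max (ridge \<gamma> z) (ridge \<gamma> (z + real (q - 1) / real q))"
          using gap[of i] \<open>i \<noteq> 0\<close> iq yz by simp
        thus ?thesis using ends ends0 True by (cases "z = b") auto
      qed
      moreover have "0 < sin (pi * z)"
      proof -
        have "1 / real q \<le> 1" using q_ge2 by simp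
        hence "z < 1" using z by linarith
        thus ?thesis using z by (intro sin_gt_zero) auto
      qed
      ultimately show ?thesis using True by (simp add: Y_def ridge_def c_def)
    next
      case False
      have "i \<noteq> q - 1" using y False yz by (intro notI) simp
      hence "ridge \<gamma> y < ridge \<gamma> (z + real (q - 1) / real q)"
        using gap[of i] ends' False iq yz by (cases "i = 0") auto
      moreover have Z: "z + real (q - 1) / real q = Y + 1"
        using False q2 q_pos by (simp add: Y_def of_nat_diff diff_divide_distrib)
      have "psi \<gamma> (Y + 1 - c) = psi \<gamma> (Y - c)" using psi_periodic[of \<gamma> "Y - c"] by (simp add: algebra_simps)
      moreover have "sin (pi * (Y + 1)) = \<bar>sin (pi * Y)\<bar>"
      proof -
        have "1 / real q \<le> 1" using q_ge2 by simp
        hence Y: "- 1 < Y" "Y < 0" using False z b by (auto simp: Y_def)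
        have "pi * (Y + 1) < pi * 1" using Y by (intro mult_strict_left_mono) auto
        hence "0 < sin (pi * (Y + 1))" using Y by (intro sin_gt_zero) auto
        thus ?thesis by (simp add: distrib_left)
      qed
      ultimately show ?thesis unfolding Z by (simp add: ridge_def c_def)
    qed
    obtain k :: int where k: "y = Y + of_int k / real q"
    proof (cases "z \<le> b")
      case True thus ?thesis using that[of "int i"] yz by (simp add: Y_def)
    next
      case False thus ?thesis using that[of "int i + 1"] yz by (simp add: Y_def add_divide_distrib)
    qed
    have qk: "real q * (Y - c) + of_int k = real q * x" unfolding k y_def[symmetric]
    proof -
      have "real q * y = real q * Y + of_int k" unfolding k using q_pos by (simp add: distrib_left)
      thus "real q * (Y - c) + of_int k = real q * x" by (simp add: y_def algebra_simps)
    qed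
    have "\<bar>sin (pi * real q * y)\<bar> = \<bar>sin (pi * real q * Y)\<bar>"
    proof -
      have "pi * real q * y = pi * real q * Y + of_int k * pi" unfolding k using q_pos by (simp add: distrib_left)
      moreover have s0: "sin (of_int k * pi) = 0" using sin_zero_iff_int2 by blast
      moreover have "\<bar>cos (of_int k * pi)\<bar> = 1"
        using sin_cos_squared_add[of "of_int k * pi"] s0 by (simp add: abs_square_eq_1)
      ultimately show ?thesis by (simp add: sin_add abs_mult)
    qed
    note sq = this
    have sY: "sin (pi * Y) \<noteq> 0"
    proof -
      have "1 / real q \<le> 1" using q_ge2 by simp
      thus ?thesis using Ynz by (intro sin_nz) auto
    qed
    have "fc q c x = ereal (ln \<bar>sin (pi * real q * y)\<bar> - ln (sin (pi * y)))"
      using nz sy by (simp add: fc_def dratio_def y_def ln_div)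
    also have "\<dots> < ereal (ln \<bar>sin (pi * real q * Y)\<bar> - ln \<bar>sin (pi * Y)\<bar> + psi \<gamma> (Y - c) - psi \<gamma> x)"
      using hY sq by (simp add: ridge_def y_def c_def)
    also have "ln \<bar>sin (pi * real q * Y)\<bar> - ln \<bar>sin (pi * Y)\<bar> = peak Y"
      using peak_eq[OF Ynz] sY nz sq by (simp add: ln_div)
    also have "peak Y = topval \<gamma> - psi \<gamma> (Y - c) + psi \<gamma> (real q * (Y - c))"
      using psi_branch[OF Yr] by (simp add: topval_def c_def)
    also have "psi \<gamma> (real q * (Y - c)) = psi \<gamma> (real q * x)"
      using psi_of_int[of \<gamma> "real q * (Y - c)" k] unfolding qk by simp
    finally show ?thesis by (simp add: c_def algebra_simps)
  qed
qed

section \<open>Orbits trapped in the arc\<close>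

text \<open>The closed arc lifted to the line; the floor selects the representative of x in
  [\<gamma>, \<gamma> + 1).\<close>

definition arcset :: "real \<Rightarrow> real set" where
  "arcset \<gamma> = {x. x - of_int \<lfloor>x - \<gamma>\<rfloor> \<le> \<gamma> + 1 / real q}"

definition exceptional :: "real set" where
  "exceptional = {\<gamma>. \<forall>k. real q ^ k * \<gamma> \<in> arcset \<gamma>}"

lemma inv_q: "0 < 1 / real q" "1 / real q \<le> 1 / 2"
  using q_ge2 by (auto simp: field_simps)

lemma arcset_iff: "x \<in> arcset \<gamma> \<longleftrightarrow> (\<exists>m::int. \<gamma> \<le> x - of_int m \<and> x - of_int m \<le> \<gamma> + 1 / real q)"
proof
  assume "x \<in> arcset \<gamma>"
  moreover have "\<gamma> \<le> x - of_int \<lfloor>x - \<gamma>\<rfloor>" by linarith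
  ultimately show "\<exists>m::int. \<gamma> \<le> x - of_int m \<and> x - of_int m \<le> \<gamma> + 1 / real q"
    unfolding arcset_def by blast
next
  assume "\<exists>m::int. \<gamma> \<le> x - of_int m \<and> x - of_int m \<le> \<gamma> + 1 / real q"
  then obtain m :: int where m: "\<gamma> \<le> x - of_int m" "x - of_int m \<le> \<gamma> + 1 / real q" by blast
  have "\<lfloor>x - \<gamma>\<rfloor> = m" using m inv_q by linarith
  thus "x \<in> arcset \<gamma>" using m by (simp add: arcset_def)
qed

lemma arcset_add_int: "x + of_int k \<in> arcset \<gamma> \<longleftrightarrow> x \<in> arcset \<gamma>"
proof -
  have "\<lfloor>x + of_int k - \<gamma>\<rfloor> = \<lfloor>x - \<gamma>\<rfloor> + k" by linarith
  thus ?thesis by (simp add: arcset_def)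
qed

lemma closed_arcset: "closed (arcset \<gamma>)"
proof -
  have "- arcset \<gamma> = (\<Union>m::int. {\<gamma> + 1 / real q + of_int m<..<\<gamma> + 1 + of_int m})"
  proof (intro set_eqI iffI)
    fix x assume "x \<in> - arcset \<gamma>"
    hence "\<gamma> + 1 / real q < x - of_int \<lfloor>x - \<gamma>\<rfloor>" by (auto simp: arcset_def)
    moreover have "x - of_int \<lfloor>x - \<gamma>\<rfloor> < \<gamma> + 1" by linarith
    ultimately have "x \<in> {\<gamma> + 1 / real q + of_int \<lfloor>x - \<gamma>\<rfloor><..<\<gamma> + 1 + of_int \<lfloor>x - \<gamma>\<rfloor>}" by auto
    thus "x \<in> (\<Union>m::int. {\<gamma> + 1 / real q + of_int m<..<\<gamma> + 1 + of_int m})" by blast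
  next
    fix x assume "x \<in> (\<Union>m::int. {\<gamma> + 1 / real q + of_int m<..<\<gamma> + 1 + of_int m})"
    then obtain m :: int where m: "\<gamma> + 1 / real q + of_int m < x" "x < \<gamma> + 1 + of_int m" by auto
    hence "\<lfloor>x - \<gamma>\<rfloor> = m" using inv_q by linarith
    thus "x \<in> - arcset \<gamma>" using m by (auto simp: arcset_def)
  qed
  thus ?thesis unfolding closed_def by auto
qed

definition trapped :: "real \<Rightarrow> real set" where
  "trapped \<gamma> = {x \<in> {\<gamma>..\<gamma> + 1 / real q}. \<forall>n. real q ^ n * x \<in> arcset \<gamma>}"

text \<open>T in the fundamental domain [\<gamma>, \<gamma> + 1), where the arc is an interval and
  can be ordered.\<close>

definition circ :: "real \<Rightarrow> real \<Rightarrow> real" where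
  "circ \<gamma> x = real q * x - of_int \<lfloor>real q * x - \<gamma>\<rfloor>"

text \<open>The point \<open>(branch \<gamma> ^^ Suc n) 0\<close> stays in the arc for n further
  steps, so the nested compact sets of points surviving n steps are nonempty.\<close>

lemma trapped_nonempty: "trapped \<gamma> \<noteq> {}"
proof -
  define K where "K n = {\<gamma>..\<gamma> + 1 / real q} \<inter> (\<Inter>i\<le>n. (\<lambda>x. real q ^ i * x) -` arcset \<gamma>)" for n
  have "compact (K n)" for n
    unfolding K_def
    by (intro compact_Int_closed closed_INT ballI continuous_closed_vimage closed_arcset continuous_intros) auto
  moreover have "K n \<noteq> {}" for n
  proof -
    have ex: "\<exists>m::int. real q ^ i * (branch \<gamma> ^^ (n + i)) x = (branch \<gamma> ^^ n) x + of_int m" for i n x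
    proof (induction i arbitrary: n)
      case (Suc i)
      let ?y = "(branch \<gamma> ^^ n) x"
      obtain m :: int where m: "real q ^ i * (branch \<gamma> ^^ (Suc n + i)) x = (branch \<gamma> ^^ Suc n) x + of_int m" using Suc by blast
      have "real q * branch \<gamma> ?y = ?y - of_int \<lfloor>?y - real q * \<gamma>\<rfloor>" using q_pos by (simp add: branch_def)
      hence "real q ^ Suc i * (branch \<gamma> ^^ (n + Suc i)) x = ?y + of_int (int q * m - \<lfloor>?y - real q * \<gamma>\<rfloor>)"
        using m by (simp add: algebra_simps)
      thus ?case by blast
    qed (auto intro!: exI[of _ 0])
    let ?x = "(branch \<gamma> ^^ Suc n) 0"
    have "real q ^ i * ?x \<in> arcset \<gamma>" if "i \<le> n" for i
    proof -
      obtain m :: int where m: "real q ^ i * (branch \<gamma> ^^ (Suc (n - i) + i)) 0 = (branch \<gamma> ^^ Suc (n - i)) 0 + of_int m"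
        using ex by blast
      have "(branch \<gamma> ^^ Suc (n - i)) 0 \<in> arcset \<gamma>"
        unfolding arcset_iff using branch_iter_ge[of \<gamma> "n - i" 0] branch_iter_less[of "n - i" \<gamma> 0]
        by (intro exI[of _ 0]) (auto simp: branch_ge less_imp_le[OF branch_less])
      thus ?thesis using m that arcset_add_int by simp
    qed
    hence "?x \<in> K n" unfolding K_def by (auto simp: branch_ge less_imp_le[OF branch_less] simp del: funpow.simps(2)) (auto simp: branch_ge less_imp_le[OF branch_less])
    thus ?thesis by blast
  qed
  moreover have "K n \<subseteq> K m" if "m \<le> n" for m n using that by (auto simp: K_def)
  ultimately have "(\<Inter>n. K n) \<noteq> {}" by (intro compact_nest) auto
  moreover have "(\<Inter>n. K n) = trapped \<gamma>" by (auto simp: K_def trapped_def)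
  ultimately show ?thesis by simp
qed

lemma circ_trapped:
  assumes "x \<in> trapped \<gamma>"
  shows "circ \<gamma> x \<in> trapped \<gamma>"
proof -
  have a: "real q ^ n * x \<in> arcset \<gamma>" for n using assms by (auto simp: trapped_def)
  have "real q ^ 1 * x \<in> arcset \<gamma>" by (rule a)
  hence "circ \<gamma> x \<le> \<gamma> + 1 / real q" by (simp add: arcset_def circ_def)
  moreover have "\<gamma> \<le> circ \<gamma> x" unfolding circ_def by linarith
  moreover have "real q ^ n * circ \<gamma> x \<in> arcset \<gamma>" for n
  proof -
    have "real q ^ Suc n * x = real q ^ n * circ \<gamma> x + of_int (int q ^ n * \<lfloor>real q * x - \<gamma>\<rfloor>)"
      by (simp add: circ_def algebra_simps)
    thus ?thesis using a[of "Suc n"] arcset_add_int by metis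
  qed
  ultimately show ?thesis by (simp add: trapped_def)
qed

text \<open>The orbit of \<gamma> leaves the arc at some time k \<ge> 1, and so do nearby orbits.
  The same k serves the right end \<gamma> + 1/q, since q^k / q is an integer.\<close>

lemma trapped_margin:
  assumes "\<gamma> \<notin> exceptional"
  obtains e where "0 < e" "trapped \<gamma> \<subseteq> {\<gamma> + e<..<\<gamma> + 1 / real q - e}"
proof -
  obtain k where k: "real q ^ k * \<gamma> \<notin> arcset \<gamma>" using assms by (auto simp: exceptional_def)
  have "k \<noteq> 0"
  proof
    assume "k = 0"
    moreover have "\<gamma> \<in> arcset \<gamma>" unfolding arcset_iff using inv_q by (intro exI[of _ 0]) auto
    ultimately show False using k by simp
  qed
  then obtain j where j: "k = Suc j" by (cases k) auto
  have "open ((\<lambda>x. real q ^ k * x) -` (- arcset \<gamma>))"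
    using closed_arcset[of \<gamma>] by (intro open_vimage continuous_intros) (simp add: open_Compl)
  moreover have "\<gamma> \<in> (\<lambda>x. real q ^ k * x) -` (- arcset \<gamma>)" using k by simp
  ultimately have "\<exists>e>0. \<forall>y. dist y \<gamma> < e \<longrightarrow> y \<in> (\<lambda>x. real q ^ k * x) -` (- arcset \<gamma>)"
    unfolding open_dist by (rule bspec)
  then obtain e where e: "0 < e" "\<And>y. dist y \<gamma> < e \<Longrightarrow> real q ^ k * y \<notin> arcset \<gamma>" by auto
  show thesis
  proof (rule that[of "e / 2"])
    show "trapped \<gamma> \<subseteq> {\<gamma> + e / 2<..<\<gamma> + 1 / real q - e / 2}"
    proof
      fix x assume x: "x \<in> trapped \<gamma>"
      hence r: "\<gamma> \<le> x" "x \<le> \<gamma> + 1 / real q" "real q ^ k * x \<in> arcset \<gamma>" by (auto simp: trapped_def)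
      have "\<not> dist x \<gamma> < e" using e(2) r by blast
      moreover have "\<not> dist (x - 1 / real q) \<gamma> < e"
      proof
        assume "dist (x - 1 / real q) \<gamma> < e"
        hence "real q ^ k * (x - 1 / real q) \<notin> arcset \<gamma>" by (rule e(2))
        moreover have "real q ^ k * x = real q ^ k * (x - 1 / real q) + of_int (int q ^ j)"
          using q_pos by (simp add: j right_diff_distrib)
        ultimately show False using r(3) arcset_add_int by metis
      qed
      ultimately show "x \<in> {\<gamma> + e / 2<..<\<gamma> + 1 / real q - e / 2}" using r e(1) by (auto simp: dist_real_def)
    qed
  qed (use e in simp)
qed

lemma carry_cases:
  assumes "x \<in> trapped \<gamma>" "y \<in> trapped \<gamma>" "x < y"
  shows "circ \<gamma> y - circ \<gamma> x = real q * (y - x) \<or> circ \<gamma> y - circ \<gamma> x = real q * (y - x) - 1"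
proof -
  have "y - x \<le> 1 / real q" using assms by (auto simp: trapped_def)
  hence "real q * (y - x) \<le> real q * (1 / real q)" by (intro mult_left_mono) auto
  hence "real q * y \<le> real q * x + 1" using q_pos by (simp add: right_diff_distrib)
  moreover have "real q * x \<le> real q * y" using assms by (intro mult_left_mono) auto
  ultimately have "\<lfloor>real q * y - \<gamma>\<rfloor> = \<lfloor>real q * x - \<gamma>\<rfloor> \<or> \<lfloor>real q * y - \<gamma>\<rfloor> = \<lfloor>real q * x - \<gamma>\<rfloor> + 1"
    by linarith
  thus ?thesis by (auto simp: circ_def algebra_simps)
qed

text \<open>By the margin e, points of the set are less than 1/q - 2 e apart, so a carry leaves
  their images more than 2 q e apart. Images closer than d = 2 q e therefore exclude a carry, and
  distances were multiplied by exactly q.\<close>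

lemma trapped_expanding:
  assumes "\<gamma> \<notin> exceptional"
  obtains d where "0 < d"
    "\<And>x y n. x \<in> trapped \<gamma> \<Longrightarrow> y \<in> trapped \<gamma> \<Longrightarrow> \<bar>(circ \<gamma> ^^ n) x - (circ \<gamma> ^^ n) y\<bar> < d \<Longrightarrow>
       \<bar>x - y\<bar> \<le> \<bar>(circ \<gamma> ^^ n) x - (circ \<gamma> ^^ n) y\<bar> / real q ^ n"
proof -
  obtain e where e: "0 < e" "trapped \<gamma> \<subseteq> {\<gamma> + e<..<\<gamma> + 1 / real q - e}" by (rule trapped_margin[OF assms])
  let ?d = "2 * real q * e"
  have step1: "\<bar>x - y\<bar> = \<bar>circ \<gamma> x - circ \<gamma> y\<bar> / real q"
    if "x \<in> trapped \<gamma>" "y \<in> trapped \<gamma>" "\<bar>circ \<gamma> x - circ \<gamma> y\<bar> < ?d" "x < y" for x y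
  proof -
    have "\<gamma> + e < x" "y < \<gamma> + 1 / real q - e" using e(2) that(1,2) by auto
    hence "y - x < 1 / real q - 2 * e" by linarith
    hence "real q * (y - x) < real q * (1 / real q - 2 * e)" using q_pos by (intro mult_strict_left_mono)
    hence "real q * (y - x) - 1 < - ?d" using q_pos by (simp add: right_diff_distrib)
    hence "circ \<gamma> y - circ \<gamma> x = real q * (y - x)" using carry_cases[OF that(1,2,4)] that(3) by linarith
    hence "\<bar>circ \<gamma> x - circ \<gamma> y\<bar> = real q * \<bar>x - y\<bar>"
      using that(4) by (simp add: abs_minus_commute[of "circ \<gamma> x"] abs_minus_commute[of x] abs_mult)
    thus ?thesis using q_pos by simp
  qed
  have step: "\<bar>x - y\<bar> \<le> \<bar>circ \<gamma> x - circ \<gamma> y\<bar> / real q"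
    if "x \<in> trapped \<gamma>" "y \<in> trapped \<gamma>" "\<bar>circ \<gamma> x - circ \<gamma> y\<bar> < ?d" for x y
    using step1[of x y] step1[of y x] that
    by (cases x y rule: linorder_cases) (auto simp: abs_minus_commute)
  show thesis
  proof (rule that[of ?d])
    show "0 < ?d" using e q_pos by simp
    show "\<bar>x - y\<bar> \<le> \<bar>(circ \<gamma> ^^ n) x - (circ \<gamma> ^^ n) y\<bar> / real q ^ n"
      if "x \<in> trapped \<gamma>" "y \<in> trapped \<gamma>" "\<bar>(circ \<gamma> ^^ n) x - (circ \<gamma> ^^ n) y\<bar> < ?d" for x y n
      using that
    proof (induction n arbitrary: x y)
      case (Suc n)
      let ?z = "\<bar>(circ \<gamma> ^^ Suc n) x - (circ \<gamma> ^^ Suc n) y\<bar>"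
      have "\<bar>circ \<gamma> x - circ \<gamma> y\<bar> \<le> \<bar>(circ \<gamma> ^^ n) (circ \<gamma> x) - (circ \<gamma> ^^ n) (circ \<gamma> y)\<bar> / real q ^ n"
        using Suc.prems by (intro Suc.IH circ_trapped) (auto simp: funpow_swap1)
      hence 1: "\<bar>circ \<gamma> x - circ \<gamma> y\<bar> \<le> ?z / real q ^ n" by (simp add: funpow_swap1)
      also have "\<dots> \<le> ?z / 1" using q_ge2 by (intro divide_left_mono) auto
      also have "\<dots> < ?d" using Suc.prems by simp
      finally have "\<bar>x - y\<bar> \<le> \<bar>circ \<gamma> x - circ \<gamma> y\<bar> / real q" using Suc.prems by (intro step)
      also have "\<dots> \<le> (?z / real q ^ n) / real q" using 1 q_pos by (intro divide_right_mono) auto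
      finally show ?case by (simp add: mult.commute)
    qed auto
  qed
qed

text \<open>Pigeonhole: among more points than bins of length d, two share a bin at time n, so they
  started within d/q^n. For large n this is below the least distance of the chosen points.\<close>

lemma trapped_finite:
  assumes "\<gamma> \<notin> exceptional"
  shows "finite (trapped \<gamma>)"
proof (rule ccontr)
  assume inf: "infinite (trapped \<gamma>)"
  obtain d where d: "0 < d"
    "\<And>x y n. x \<in> trapped \<gamma> \<Longrightarrow> y \<in> trapped \<gamma> \<Longrightarrow> \<bar>(circ \<gamma> ^^ n) x - (circ \<gamma> ^^ n) y\<bar> < d \<Longrightarrow>
       \<bar>x - y\<bar> \<le> \<bar>(circ \<gamma> ^^ n) x - (circ \<gamma> ^^ n) y\<bar> / real q ^ n"
    by (rule trapped_expanding[OF assms]) blast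
  define bin where "bin x = \<lfloor>(x - \<gamma>) / d\<rfloor>" for x
  define N where "N = card {0..\<lfloor>1 / d\<rfloor>}"
  obtain F where F: "finite F" "card F = Suc N" "F \<subseteq> trapped \<gamma>"
    using infinite_arbitrarily_large[OF inf] by blast
  define D where "D = (\<lambda>(x, y). \<bar>x - y\<bar>) ` {(x, y) \<in> F \<times> F. x \<noteq> y}"
  have "finite D" unfolding D_def using F(1)
    by (intro finite_imageI) (rule finite_subset[of _ "F \<times> F"], auto)
  have key: "\<exists>x\<in>F. \<exists>y\<in>F. x \<noteq> y \<and> \<bar>x - y\<bar> \<le> d / real q ^ n" for n
  proof -
    have it: "(circ \<gamma> ^^ n) x \<in> trapped \<gamma>" if "x \<in> F" for x
      using that F(3) by (induction n) (auto intro: circ_trapped)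
    have "(\<lambda>x. bin ((circ \<gamma> ^^ n) x)) ` F \<subseteq> {0..\<lfloor>1 / d\<rfloor>}"
    proof safe
      fix x assume "x \<in> F"
      hence "\<gamma> \<le> (circ \<gamma> ^^ n) x" "(circ \<gamma> ^^ n) x \<le> \<gamma> + 1 / real q"
        using it[of x] by (auto simp: trapped_def)
      hence "0 \<le> (circ \<gamma> ^^ n) x - \<gamma>" "(circ \<gamma> ^^ n) x - \<gamma> \<le> 1" using inv_q by linarith+
      hence "0 \<le> ((circ \<gamma> ^^ n) x - \<gamma>) / d" "((circ \<gamma> ^^ n) x - \<gamma>) / d \<le> 1 / d"
        using d(1) by (auto intro: divide_right_mono)
      thus "bin ((circ \<gamma> ^^ n) x) \<in> {0..\<lfloor>1 / d\<rfloor>}" unfolding bin_def by (auto intro: floor_mono)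
    qed
    hence "card ((\<lambda>x. bin ((circ \<gamma> ^^ n) x)) ` F) < card F"
      using card_mono[of "{0..\<lfloor>1 / d\<rfloor>}"] F(2) by (auto simp: N_def less_Suc_eq_le)
    hence "\<not> inj_on (\<lambda>x. bin ((circ \<gamma> ^^ n) x)) F" by (rule pigeonhole)
    then obtain x y where xy: "x \<in> F" "y \<in> F" "x \<noteq> y" "bin ((circ \<gamma> ^^ n) x) = bin ((circ \<gamma> ^^ n) y)"
      by (auto simp: inj_on_def)
    define u v where "u = ((circ \<gamma> ^^ n) x - \<gamma>) / d" and "v = ((circ \<gamma> ^^ n) y - \<gamma>) / d"
    have "\<bar>u - v\<bar> < 1" using xy(4) unfolding bin_def u_def[symmetric] v_def[symmetric] by linarith
    moreover have "(circ \<gamma> ^^ n) x - (circ \<gamma> ^^ n) y = d * (u - v)"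
      using d(1) by (simp add: u_def v_def diff_divide_distrib[symmetric])
    ultimately have lt: "\<bar>(circ \<gamma> ^^ n) x - (circ \<gamma> ^^ n) y\<bar> < d"
      using d(1) mult_strict_left_mono[of "\<bar>u - v\<bar>" 1 d] by (simp add: abs_mult)
    have "\<bar>x - y\<bar> \<le> \<bar>(circ \<gamma> ^^ n) x - (circ \<gamma> ^^ n) y\<bar> / real q ^ n"
      using xy F(3) lt by (intro d(2)) auto
    also have "\<dots> \<le> d / real q ^ n" using lt by (intro divide_right_mono) auto
    finally show ?thesis using xy by blast
  qed
  have "D \<noteq> {}" using key[of 0] by (auto simp: D_def)
  moreover have "0 < r" if "r \<in> D" for r using that by (auto simp: D_def)
  ultimately have "0 < Min D" using \<open>finite D\<close> by simp
  moreover have "(\<lambda>n. d / real q ^ n) \<longlonglongrightarrow> 0" using q_ge2 by (intro LIMSEQ_divide_realpow_zero) auto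
  ultimately obtain n where "d / real q ^ n < Min D"
    by (metis (mono_tags, lifting) eventually_sequentially order_refl order_tendstoD(2))
  moreover obtain x y where "x \<in> F" "y \<in> F" "x \<noteq> y" "\<bar>x - y\<bar> \<le> d / real q ^ n" using key[of n] by blast
  moreover from this have "\<bar>x - y\<bar> \<in> D" by (auto simp: D_def)
  hence "Min D \<le> \<bar>x - y\<bar>" using \<open>finite D\<close> by simp
  ultimately show False by linarith
qed

lemma trapped_bij:
  assumes "\<gamma> \<notin> exceptional"
  shows "inj_on (circ \<gamma>) (trapped \<gamma>)" "circ \<gamma> ` trapped \<gamma> = trapped \<gamma>"
proof -
  obtain d where d: "0 < d"
    "\<And>x y n. x \<in> trapped \<gamma> \<Longrightarrow> y \<in> trapped \<gamma> \<Longrightarrow> \<bar>(circ \<gamma> ^^ n) x - (circ \<gamma> ^^ n) y\<bar> < d \<Longrightarrow>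
       \<bar>x - y\<bar> \<le> \<bar>(circ \<gamma> ^^ n) x - (circ \<gamma> ^^ n) y\<bar> / real q ^ n"
    by (rule trapped_expanding[OF assms]) blast
  show inj: "inj_on (circ \<gamma>) (trapped \<gamma>)"
  proof (rule inj_onI)
    fix x y assume "x \<in> trapped \<gamma>" "y \<in> trapped \<gamma>" "circ \<gamma> x = circ \<gamma> y"
    thus "x = y" using d(2)[of x y 1] d(1) by simp
  qed
  show "circ \<gamma> ` trapped \<gamma> = trapped \<gamma>"
    using inj trapped_finite[OF assms] circ_trapped by (intro endo_inj_surj) auto
qed

text \<open>Neighbouring points of the finite invariant set stay neighbours, at a distance growing by
  the factor \<open>q\<close>, until the pair wraps around the gap. So every point reaches the maximum.\<close>
lemma trapped_reaches_max:
  assumes good: "\<gamma> \<notin> exceptional" and x: "x \<in> trapped \<gamma>"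
  shows "\<exists>n. (circ \<gamma> ^^ n) x = Max (trapped \<gamma>)"
proof (rule ccontr)
  let ?X = "trapped \<gamma>" and ?S = "circ \<gamma>"
  note fin = trapped_finite[OF good]
  assume no: "\<nexists>n. (?S ^^ n) x = Max ?X"
  have it: "(?S ^^ n) x \<in> ?X" for n using x by (induction n) (auto intro: circ_trapped)
  have "(?S ^^ 0) x \<noteq> Max ?X" using no by blast
  hence "x < Max ?X" using Max_ge[OF fin x] by simp
  hence "{z \<in> ?X. x < z} \<noteq> {}" using Max_in[OF fin] x by auto
  define y where "y = Min {z \<in> ?X. x < z}"
  have y: "y \<in> ?X" "x < y" "\<And>w. w \<in> ?X \<Longrightarrow> \<not> (x < w \<and> w < y)"
    using Min_in[of "{z \<in> ?X. x < z}"] Min_le[of "{z \<in> ?X. x < z}"] fin \<open>{z \<in> ?X. x < z} \<noteq> {}\<close>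
    by (auto simp: y_def not_less)
  have main: "\<exists>z\<in>?X. z - (?S ^^ n) x = real q ^ n * (y - x) \<and> (\<forall>w\<in>?X. \<not> ((?S ^^ n) x < w \<and> w < z))" for n
  proof (induction n)
    case 0
    show ?case using y by (intro bexI[of _ y]) auto
  next
    case (Suc n)
    let ?u = "(?S ^^ n) x"
    obtain z where z: "z \<in> ?X" "z - ?u = real q ^ n * (y - x)" "\<And>w. w \<in> ?X \<Longrightarrow> \<not> (?u < w \<and> w < z)"
      using Suc by blast
    have uz: "?u < z"
    proof -
      have "0 < real q ^ n * (y - x)" using y q_pos by simp
      thus ?thesis using z(2) by linarith
    qed
    note carry = carry_cases[of _ \<gamma>]
    have le1: "real q * w - real q * v \<le> 1" if "v \<in> ?X" "w \<in> ?X" for v w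
    proof -
      have "w - v \<le> 1 / real q" using that by (auto simp: trapped_def)
      hence "real q * (w - v) \<le> real q * (1 / real q)" by (intro mult_left_mono) auto
      thus ?thesis using q_pos by (simp add: right_diff_distrib)
    qed
    have mono: "real q * v < real q * w" if "v < w" for v w using that q_pos by simp
    consider "?S z - ?S ?u = real q * (z - ?u)" | "?S z - ?S ?u = real q * (z - ?u) - 1"
      using carry[OF it[of n] z(1) uz] by blast
    thus ?case
    proof cases
      case 1
      \<comment> \<open>A point between the images has a preimage outside [?u, z], and
        \<open>carry_cases\<close> together with the length of one turn (\<open>le1\<close>) leaves
        no room for it.\<close>
      have "\<not> (?S ?u < w \<and> w < ?S z)" if "w \<in> ?X" for w
      proof
        assume w: "?S ?u < w \<and> w < ?S z"
        have "w \<in> ?S ` ?X" using that trapped_bij(2)[OF good] by simp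
        then obtain v where v: "v \<in> ?X" "w = ?S v" by blast
        have "v \<noteq> ?u" "v \<noteq> z" using w v by auto
        then consider "v < ?u" | "z < v" using z(3)[OF v(1)] by fastforce
        thus False
        proof cases
          case 1
          thus False using carry[OF v(1) it[of n] 1] carry[OF v(1) z(1) less_trans[OF 1 uz]] w v(2) mono[OF 1] mono[OF uz] le1[OF it[of n] v(1)] le1[OF v(1) z(1)] le1[OF it[of n] z(1)]
             \<open>?S z - ?S ?u = real q * (z - ?u)\<close> by (auto simp: right_diff_distrib)
        next
          case 2
          thus False using carry[OF z(1) v(1) 2] carry[OF it[of n] v(1) less_trans[OF uz 2]] w v(2) mono[OF 2] mono[OF uz] le1[OF it[of n] v(1)] le1[OF v(1) z(1)] le1[OF it[of n] z(1)]
             \<open>?S z - ?S ?u = real q * (z - ?u)\<close> by (auto simp: right_diff_distrib)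
        qed
      qed
      moreover have "?S z - ?S ?u = real q ^ Suc n * (y - x)" using 1 z(2) by simp
      ultimately show ?thesis using circ_trapped[OF z(1)] by (intro bexI[of _ "?S z"]) auto
    next
      case c: 2
      \<comment> \<open>After a carry \<open>?S ?u\<close> is the top of the set: one turn allows no
        second carry, so no image lies above it.\<close>
      have "w \<le> ?S ?u" if "w \<in> ?X" for w
      proof (rule ccontr)
        assume "\<not> w \<le> ?S ?u"
        hence w: "?S ?u < w" by simp
        have "w \<in> ?S ` ?X" using that trapped_bij(2)[OF good] by simp
        then obtain v where v: "v \<in> ?X" "w = ?S v" by blast
        have "v \<noteq> ?u" "v \<noteq> z" using w v c le1[OF it[of n] z(1)] by (auto simp: right_diff_distrib)
        then consider "v < ?u" | "z < v" using z(3)[OF v(1)] by fastforce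
        thus False
        proof cases
          case 1
          thus False using carry[OF v(1) it[of n] 1] carry[OF v(1) z(1) less_trans[OF 1 uz]] w v(2) mono[OF 1] mono[OF uz] c le1[OF it[of n] v(1)] le1[OF v(1) z(1)] le1[OF it[of n] z(1)]
            by (auto simp: right_diff_distrib)
        next
          case 2
          thus False using carry[OF z(1) v(1) 2] carry[OF it[of n] v(1) less_trans[OF uz 2]] w v(2) mono[OF 2] mono[OF uz] c le1[OF it[of n] v(1)] le1[OF v(1) z(1)] le1[OF it[of n] z(1)]
            by (auto simp: right_diff_distrib)
        qed
      qed
      hence "?S ?u = Max ?X" using it[of "Suc n"] fin by (intro Max_eqI[symmetric]) auto
      hence "(?S ^^ Suc n) x = Max ?X" by simp
      thus ?thesis using no by blast
    qed
  qed
  have "1 < real q" using q_ge2 by simp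
  then obtain n where "1 / (y - x) < real q ^ n" using real_arch_pow by blast
  hence "1 < real q ^ n * (y - x)" using y(2) by (simp add: field_simps)
  moreover obtain z where z: "z \<in> ?X" "z - (?S ^^ n) x = real q ^ n * (y - x)" using main by blast
  have "z \<le> \<gamma> + 1 / real q" "\<gamma> \<le> (?S ^^ n) x" using z(1) it[of n] by (auto simp: trapped_def)
  hence "z - (?S ^^ n) x \<le> 1" using inv_q by linarith
  ultimately show False using z(2) by linarith
qed

section \<open>Maximizing measures\<close>

lemma fc_add_int: "fc q c (x + of_int k) = fc q c x"
proof -
  have "pi * (x + of_int k + c) = pi * (x + c) + pi * of_int k"
    "pi * real q * (x + of_int k + c) = pi * real q * (x + c) + pi * of_int (int q * k)"
    by (simp_all add: algebra_simps)
  hence "\<bar>sin (pi * (x + of_int k + c))\<bar> = \<bar>sin (pi * (x + c))\<bar>"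
    "\<bar>sin (pi * real q * (x + of_int k + c))\<bar> = \<bar>sin (pi * real q * (x + c))\<bar>"
    by (simp_all only: abs_sin_add_int)
  hence "dratio q c (x + of_int k) = dratio q c x"
    unfolding dratio_def abs_divide by (metis abs_eq_0)
  thus ?thesis by (simp add: fc_def)
qed

lemma fc_le: "fc q c x \<le> ereal (ln (real q))"
proof -
  have "dratio q c x \<le> real q"
  proof (cases "sin (pi * (x + c)) = 0")
    case False
    have "\<bar>sin (pi * real q * (x + c))\<bar> \<le> real q * \<bar>sin (pi * (x + c))\<bar>"
      using abs_sin_mult_le[of q "pi * (x + c)"] by (simp add: mult_ac)
    thus ?thesis using False by (simp add: dratio_def pos_divide_le_eq)
  qed (simp add: dratio_def)
  moreover have "0 \<le> dratio q c x" by (simp add: dratio_def)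
  ultimately show ?thesis using q_pos by (simp add: fc_def)
qed

lemma fc_measurable [measurable]: "fc q c \<in> borel_measurable borel"
proof -
  have [measurable]: "dratio q c \<in> borel_measurable borel"
    unfolding dratio_def[abs_def] by measurable
  show ?thesis unfolding fc_def[abs_def] by measurable
qed

lemma psi_measurable [measurable]: "psi \<gamma> \<in> borel_measurable borel"
  using psi_continuous by (rule borel_measurable_continuous_onI)

lemma psi_mult_add_int: "psi \<gamma> (real q * (x + of_int k)) = psi \<gamma> (real q * x)"
  using psi_of_int[of \<gamma> "real q * x" "int q * k"] by (simp add: distrib_left)

text \<open>The slack in the sub-action inequality; it takes values in \<open>ennreal\<close> since
  \<open>fc\<close> may be -\<infinity>.\<close>

definition defect :: "real \<Rightarrow> real \<Rightarrow> ennreal" where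
  "defect \<gamma> x = e2ennreal (ereal (topval \<gamma> - psi \<gamma> x + psi \<gamma> (real q * x)) - fc q (cphase \<gamma>) x)"

lemma subaction_arcset:
  assumes "x \<in> arcset \<gamma>"
  shows "fc q (cphase \<gamma>) x = ereal (topval \<gamma> - psi \<gamma> x + psi \<gamma> (real q * x))"
proof -
  obtain m :: int where m: "\<gamma> \<le> x - of_int m" "x - of_int m \<le> \<gamma> + 1 / real q" using assms by (auto simp: arcset_iff)
  have "x = (x - of_int m) + of_int m" by simp
  thus ?thesis using subaction_eq[OF m] fc_add_int psi_of_int psi_mult_add_int by metis
qed

lemma subaction_not_arcset:
  assumes "x \<notin> arcset \<gamma>"
  shows "fc q (cphase \<gamma>) x < ereal (topval \<gamma> - psi \<gamma> x + psi \<gamma> (real q * x))"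
proof -
  define m where "m = \<lfloor>x - \<gamma>\<rfloor>"
  have m: "\<gamma> + 1 / real q < x - of_int m" using assms by (simp add: arcset_def m_def)
  have m': "x - of_int m < \<gamma> + 1" unfolding m_def by linarith
  have "x = (x - of_int m) + of_int m" by simp
  thus ?thesis using subaction_less[OF m m'] fc_add_int psi_of_int psi_mult_add_int by metis
qed

lemma subaction_le: "fc q (cphase \<gamma>) x \<le> ereal (topval \<gamma> - psi \<gamma> x + psi \<gamma> (real q * x))"
  by (cases "x \<in> arcset \<gamma>") (simp_all add: subaction_arcset less_imp_le[OF subaction_not_arcset])

lemma defect_eq_0_iff: "defect \<gamma> x = 0 \<longleftrightarrow> x \<in> arcset \<gamma>"
proof
  assume "x \<in> arcset \<gamma>"
  thus "defect \<gamma> x = 0" by (simp add: defect_def subaction_arcset)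
next
  assume d: "defect \<gamma> x = 0"
  show "x \<in> arcset \<gamma>"
  proof (rule ccontr)
    assume "x \<notin> arcset \<gamma>"
    hence "0 < ereal (topval \<gamma> - psi \<gamma> x + psi \<gamma> (real q * x)) - fc q (cphase \<gamma>) x"
      using subaction_not_arcset[of x \<gamma>] by (cases "fc q (cphase \<gamma>) x") auto
    moreover have "ereal (topval \<gamma> - psi \<gamma> x + psi \<gamma> (real q * x)) - fc q (cphase \<gamma>) x \<le> 0"
      using d unfolding defect_def by (metis e2ennreal_neg enn2ereal_e2ennreal linorder_linear order_refl zero_ennreal.rep_eq)
    ultimately show False by simp
  qed
qed

lemma psi_Tmap: "psi \<gamma> (Tmap q x) = psi \<gamma> (real q * x)"
  using psi_of_int[of \<gamma> "Tmap q x" "\<lfloor>real q * x\<rfloor>"] by (simp add: Tmap_def frac_def)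

lemma Tmap_measurable [measurable]: "Tmap q \<in> borel_measurable borel"
  unfolding Tmap_def[abs_def] frac_def by measurable

text \<open>The two \<open>psi\<close> terms have equal integrals by invariance and cancel.\<close>

lemma integral_fc_eq:
  assumes "invariant_prob q \<mu>"
  shows "integral_fc q (cphase \<gamma>) \<mu> = ereal (topval \<gamma>) - enn2ereal (\<integral>\<^sup>+ x. defect \<gamma> x \<partial>\<mu>)"
proof -
  let ?c = "cphase \<gamma>" and ?p = "psi \<gamma>"
  interpret prob_space \<mu> using assms by (simp add: invariant_prob_def)
  have sets [measurable_cong]: "sets \<mu> = sets borel" and inv: "distr \<mu> borel (Tmap q) = \<mu>"
    using assms by (auto simp: invariant_prob_def)
  obtain B where B: "\<And>x. \<bar>?p x\<bar> \<le> B" by (rule psi_bounded[of \<gamma>]) blast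
  define K where "K = ln (real q) - topval \<gamma>"
  \<comment> \<open>A shift that makes all \<open>psi\<close> terms nonnegative, so that the whole
    identity can be integrated in \<open>ennreal\<close> even where \<open>fc\<close> is
    -\<infinity>.\<close>
  define N where "N = B + \<bar>K\<bar>"
  have N: "0 \<le> ?p x + N" "0 \<le> ?p x + N + K" for x using B[of x] by (auto simp: N_def abs_le_iff)
  have ip: "integrable \<mu> ?p" by (rule integrable_const_bound[of _ B]) (use B in auto)
  have iT: "(\<integral>x. ?p (real q * x) \<partial>\<mu>) = (\<integral>x. ?p x \<partial>\<mu>)" "integrable \<mu> (\<lambda>x. ?p (real q * x))"
  proof -
    have "(\<integral>x. ?p x \<partial>\<mu>) = (\<integral>x. ?p x \<partial>(distr \<mu> borel (Tmap q)))" by (simp add: inv)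
    also have "\<dots> = (\<integral>x. ?p (Tmap q x) \<partial>\<mu>)" by (rule integral_distr) auto
    finally show "(\<integral>x. ?p (real q * x) \<partial>\<mu>) = (\<integral>x. ?p x \<partial>\<mu>)" by (simp add: psi_Tmap)
    show "integrable \<mu> (\<lambda>x. ?p (real q * x))" by (rule integrable_const_bound[of _ B]) (use B in auto)
  qed
  define I where "I = (\<integral>x. ?p x \<partial>\<mu>)"
  have nn1: "(\<integral>\<^sup>+ x. ennreal (?p (real q * x) + N) \<partial>\<mu>) = ennreal (I + N)"
    using ip iT N by (subst nn_integral_eq_integral) (auto simp: I_def prob_space)
  have nn2: "(\<integral>\<^sup>+ x. ennreal (?p x + N + K) \<partial>\<mu>) = ennreal (I + N + K)"
    using ip N by (subst nn_integral_eq_integral) (auto simp: I_def prob_space)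
  have "- B \<le> I"
  proof -
    have "(\<integral>x. - B \<partial>\<mu>) \<le> (\<integral>x. ?p x \<partial>\<mu>)" using ip B by (intro integral_mono) (auto simp: abs_le_iff minus_le_iff)
    thus ?thesis by (simp add: I_def prob_space)
  qed
  hence IN: "0 \<le> I + N" "0 \<le> I + N + K" by (auto simp: N_def)
  define G where "G = (\<integral>\<^sup>+ x. e2ennreal (ereal (ln (real q)) - fc q ?c x) \<partial>\<mu>)"
  define W where "W = (\<integral>\<^sup>+ x. defect \<gamma> x \<partial>\<mu>)"
  have pt: "e2ennreal (ereal (ln (real q)) - fc q ?c x) + ennreal (?p (real q * x) + N) =
      defect \<gamma> x + ennreal (?p x + N + K)" for x
  proof (cases "fc q ?c x")
    case (real r)
    have "r \<le> ln (real q)" using fc_le[of ?c x] real by simp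
    moreover have "r \<le> topval \<gamma> - ?p x + ?p (real q * x)" using subaction_le[of \<gamma> x] real by simp
    ultimately show ?thesis using real N[of x] N(1)[of "real q * x"]
      by (simp add: defect_def e2ennreal_ereal ennreal_plus[symmetric] K_def del: ennreal_plus)
  next
    case PInf thus ?thesis using fc_le[of ?c x] by simp
  next
    case MInf thus ?thesis by (simp add: defect_def e2ennreal_infty top_ennreal_def[symmetric])
  qed
  have "G + ennreal (I + N) = (\<integral>\<^sup>+ x. e2ennreal (ereal (ln (real q)) - fc q ?c x) + ennreal (?p (real q * x) + N) \<partial>\<mu>)"
    unfolding nn1[symmetric] G_def by (rule nn_integral_add[symmetric]) measurable
  also have "\<dots> = W + ennreal (I + N + K)"
    unfolding pt W_def nn2[symmetric] by (rule nn_integral_add) (unfold defect_def, measurable)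
  finally have GW: "G + ennreal (I + N) = W + ennreal (I + N + K)" .
  have "ereal (ln (real q)) - enn2ereal G = ereal (topval \<gamma>) - enn2ereal W"
  proof (cases G)
    case (real g)
    have "W \<noteq> \<top>" using GW real by (metis ennreal_add_eq_top ennreal_neq_top)
    then obtain w where w: "W = ennreal w" "0 \<le> w" by (cases W) auto
    have "g + (I + N) = w + (I + N + K)"
      using GW IN real w by (simp add: ennreal_plus[symmetric] del: ennreal_plus)
    thus ?thesis using real w by (simp add: K_def)
  next
    case top
    hence "W = \<top>" using GW by (metis ennreal_add_eq_top ennreal_neq_top)
    thus ?thesis using top by simp
  qed
  thus ?thesis by (simp add: integral_fc_def G_def W_def)
qed

lemma integral_fc_max_iff:
  assumes "invariant_prob q \<mu>"
  shows "integral_fc q (cphase \<gamma>) \<mu> \<le> ereal (topval \<gamma>)"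
    and "integral_fc q (cphase \<gamma>) \<mu> = ereal (topval \<gamma>) \<longleftrightarrow> (AE x in \<mu>. x \<in> arcset \<gamma>)"
proof -
  let ?W = "\<integral>\<^sup>+ x. defect \<gamma> x \<partial>\<mu>"
  have [measurable_cong]: "sets \<mu> = sets borel" using assms by (auto simp: invariant_prob_def)
  have "(?W = 0) = (AE x in \<mu>. defect \<gamma> x = 0)"
    by (rule nn_integral_0_iff_AE) (unfold defect_def, measurable)
  hence W: "(?W = 0) = (AE x in \<mu>. x \<in> arcset \<gamma>)" by (simp add: defect_eq_0_iff)
  show "integral_fc q (cphase \<gamma>) \<mu> \<le> ereal (topval \<gamma>)"
    unfolding integral_fc_eq[OF assms] by (cases ?W) auto
  show "integral_fc q (cphase \<gamma>) \<mu> = ereal (topval \<gamma>) \<longleftrightarrow> (AE x in \<mu>. x \<in> arcset \<gamma>)"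
    unfolding integral_fc_eq[OF assms] W[symmetric] by (cases ?W) auto
qed

lemma Tmap_frac: "Tmap q (frac y) = frac (circ \<gamma> y)"
proof -
  have "real q * frac y = circ \<gamma> y + of_int (\<lfloor>real q * y - \<gamma>\<rfloor> - int q * \<lfloor>y\<rfloor>)"
    by (simp add: circ_def frac_def algebra_simps)
  thus ?thesis unfolding Tmap_def by (metis frac_add_of_int)
qed

lemma Tmap_iter_frac: "(Tmap q ^^ n) (frac y) = frac ((circ \<gamma> ^^ n) y)"
  by (induction n) (auto simp: Tmap_frac[of _ \<gamma>])

lemma Tmap_iter: "\<exists>m::int. (Tmap q ^^ n) x = real q ^ n * x + of_int m"
proof (induction n)
  case (Suc n)
  then obtain m :: int where m: "(Tmap q ^^ n) x = real q ^ n * x + of_int m" by blast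
  have "(Tmap q ^^ Suc n) x = real q * ((Tmap q ^^ n) x) + of_int (- \<lfloor>real q * ((Tmap q ^^ n) x)\<rfloor>)"
    by (simp add: Tmap_def frac_def)
  also have "\<dots> = real q ^ Suc n * x + of_int (int q * m - \<lfloor>real q * ((Tmap q ^^ n) x)\<rfloor>)"
    unfolding m by (simp add: algebra_simps)
  finally show ?case by blast
qed (auto intro!: exI[of _ 0])

text \<open>Invariance pulls the arc condition back along every iterate, and countably many null
  sets are discarded. The rest passes from [0, 1) to the representative in [\<gamma>, \<gamma> +
  1).\<close>

lemma invariant_on_trapped:
  assumes inv: "invariant_prob q \<mu>" and arc: "AE x in \<mu>. x \<in> arcset \<gamma>"
  shows "AE x in \<mu>. x \<in> frac ` trapped \<gamma>"
proof -
  interpret prob_space \<mu> using inv by (simp add: invariant_prob_def)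
  have sets [measurable_cong]: "sets \<mu> = sets borel" and dist: "distr \<mu> borel (Tmap q) = \<mu>"
    and one: "emeasure \<mu> {0..<1} = 1" using inv by (auto simp: invariant_prob_def)
  have [measurable]: "arcset \<gamma> \<in> sets borel" using closed_arcset by (rule borel_closed)
  have "AE x in \<mu>. (Tmap q ^^ n) x \<in> arcset \<gamma>" for n
  proof (induction n)
    case (Suc n)
    have [measurable]: "(Tmap q ^^ n) \<in> borel_measurable borel"
    proof (induction n)
      case (Suc n)
      have "(\<lambda>x. Tmap q ((Tmap q ^^ n) x)) \<in> borel_measurable borel" using Suc by measurable
      thus ?case by (simp add: o_def)
    qed (simp add: id_def)
    have "AE x in distr \<mu> borel (Tmap q). (Tmap q ^^ n) x \<in> arcset \<gamma>" unfolding dist by (rule Suc)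
    hence "AE x in \<mu>. (Tmap q ^^ n) (Tmap q x) \<in> arcset \<gamma>" by (subst (asm) AE_distr_iff) auto
    thus ?case by (simp add: funpow_swap1)
  qed (use arc in simp)
  hence "AE x in \<mu>. \<forall>n. (Tmap q ^^ n) x \<in> arcset \<gamma>" by (simp add: AE_all_countable)
  moreover have "AE x in \<mu>. x \<in> {0..<1}"
    using one by (subst AE_in_set_eq_1) (auto simp: emeasure_eq_measure sets)
  ultimately show ?thesis
  proof eventually_elim
    case (elim x)
    have o: "real q ^ n * x \<in> arcset \<gamma>" for n
      using Tmap_iter[of n x] elim(1) arcset_add_int by metis
    define m where "m = \<lfloor>x - \<gamma>\<rfloor>"
    have "x \<in> arcset \<gamma>" using o[of 0] by simp
    moreover have "\<gamma> \<le> x - of_int m" unfolding m_def by linarith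
    moreover have "real q ^ n * (x - of_int m) \<in> arcset \<gamma>" for n
    proof -
      have "real q ^ n * x = real q ^ n * (x - of_int m) + of_int (int q ^ n * m)" by (simp add: algebra_simps)
      thus ?thesis using o[of n] arcset_add_int by metis
    qed
    ultimately have "x - of_int m \<in> trapped \<gamma>" by (simp add: trapped_def arcset_def m_def)
    moreover have "frac (x - of_int m) = x"
    proof -
      have "frac (x + of_int (- m)) = frac x" by (rule frac_add_of_int)
      thus ?thesis using elim(2) frac_unique_iff[of x x] by simp
    qed
    ultimately show ?case by force
  qed
qed

text \<open>The trapped set is a single cycle, so the uniform measure on it is the only invariant
  measure on the arc. This gives both existence and uniqueness for the \<open>THE\<close> in
  \<open>nu\<close>.\<close>

lemma periodic_maximizer:
  assumes good: "\<gamma> \<notin> exceptional"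
  shows "cphase \<gamma> \<notin> Pset q"
proof -
  let ?X = "trapped \<gamma>" and ?T = "Tmap q"
  note fin = trapped_finite[OF good]
  have "Max ?X \<in> ?X" using fin trapped_nonempty by (rule Max_in)
  note cycle = transitive_finite_cycle[OF trapped_bij(1)[OF good] eq_refl[OF trapped_bij(2)[OF good]] this
    trapped_reaches_max[OF good]]
  obtain n where n: "0 < n" "(circ \<gamma> ^^ n) (Max ?X) = Max ?X" "?X = {(circ \<gamma> ^^ k) (Max ?X) | k. k < n}"
    by (rule cycle) simp_all
  define p where "p = frac (Max ?X)"
  define P where "P = frac ` ?X"
  have P: "P = {(?T ^^ k) p | k. k < n}"
    unfolding P_def p_def Tmap_iter_frac[of _ _ \<gamma>] by (subst n(3)) auto
  have pn: "(?T ^^ n) p = p" unfolding p_def Tmap_iter_frac[of _ _ \<gamma>] n(2) ..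
  have finP: "finite P" "P \<noteq> {}" using fin trapped_nonempty by (auto simp: P_def)
  have P01: "P \<subseteq> {0..<1}" by (auto simp: P_def frac_lt_1)
  have TP: "?T ` P = P"
  proof -
    have "?T ` P = frac ` circ \<gamma> ` ?X" by (simp add: P_def image_image Tmap_frac[of _ \<gamma>])
    thus ?thesis by (simp add: P_def trapped_bij(2)[OF good])
  qed
  have injP: "inj_on ?T P" by (rule eq_card_imp_inj_on) (use finP TP in auto)
  define M where "M = distr (measure_pmf (pmf_of_set P)) borel (\<lambda>x. x)"
  have invM: "invariant_prob q M"
    unfolding invariant_prob_def
  proof (intro conjI)
    show "prob_space M" unfolding M_def by (intro measure_pmf.prob_space_distr) auto
    show "sets M = sets borel" by (simp add: M_def)
    have "emeasure M {0..<1} = emeasure (measure_pmf (pmf_of_set P)) {0..<1}"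
      unfolding M_def by (subst emeasure_distr) auto
    also have "\<dots> = 1"
      using P01 finP by (subst measure_pmf.emeasure_eq_1_AE) (auto simp: AE_measure_pmf_iff)
    finally show "emeasure M {0..<1} = 1" .
    have "distr M borel ?T = distr (measure_pmf (pmf_of_set P)) borel ?T"
      unfolding M_def by (subst distr_distr) (auto simp: o_def)
    also have "\<dots> = distr (measure_pmf (map_pmf ?T (pmf_of_set P))) borel (\<lambda>x. x)"
      unfolding map_pmf_rep_eq by (subst distr_distr) (auto simp: o_def)
    also have "map_pmf ?T (pmf_of_set P) = pmf_of_set P"
      using map_pmf_of_set_inj[OF injP finP(2,1)] TP by simp
    finally show "distr M borel ?T = M" by (simp add: M_def)
  qed
  have sup_arc: "P \<subseteq> arcset \<gamma>"
  proof
    fix x assume "x \<in> P"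
    then obtain y where y: "y \<in> ?X" "x = y + of_int (- \<lfloor>y\<rfloor>)" by (auto simp: P_def frac_def)
    have "real q ^ 0 * y \<in> arcset \<gamma>" using y(1) unfolding trapped_def by blast
    thus "x \<in> arcset \<gamma>" unfolding y(2) arcset_add_int by simp
  qed
  have arcM: "AE x in M. x \<in> arcset \<gamma>"
    unfolding M_def using sup_arc finP closed_arcset[THEN borel_closed]
    by (subst AE_distr_iff) (auto simp: AE_measure_pmf_iff)
  \<comment> \<open>T permutes P, so an invariant measure carried by P gives x and T x the same
    mass, hence all points of the cycle.\<close>
  have const: "emeasure \<mu> A = of_nat (card (A \<inter> P)) / of_nat (card P)"
    if inv: "invariant_prob q \<mu>" and arc: "AE x in \<mu>. x \<in> arcset \<gamma>" and A: "A \<in> sets borel" for \<mu> A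
  proof -
    interpret prob_space \<mu> using inv by (simp add: invariant_prob_def)
    have sets [measurable_cong]: "sets \<mu> = sets borel" and dist: "distr \<mu> borel ?T = \<mu>"
      using inv by (auto simp: invariant_prob_def)
    have sp: "space \<mu> = UNIV" using sets_eq_imp_space_eq[OF sets] by simp
    have sup: "AE x in \<mu>. x \<in> P" using invariant_on_trapped[OF inv arc] by (simp add: P_def)
    have shift: "emeasure \<mu> {?T x} = emeasure \<mu> {x}" if x: "x \<in> P" for x
    proof -
      have "emeasure \<mu> {?T x} = emeasure (distr \<mu> borel ?T) {?T x}" by (simp add: dist)
      also have "\<dots> = emeasure \<mu> (?T -` {?T x})" by (subst emeasure_distr) (auto simp: sp)
      also have "\<dots> = emeasure \<mu> {x}"
      proof (rule emeasure_eq_AE)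
        show "AE y in \<mu>. (y \<in> ?T -` {?T x}) = (y \<in> {x})"
          using sup by eventually_elim (use injP x in \<open>auto dest: inj_onD\<close>)
        show "?T -` {?T x} \<in> sets \<mu>" using measurable_sets[OF Tmap_measurable, of "{?T x}"] by (simp add: sets)
      qed (simp add: sets)
      finally show ?thesis .
    qed
    have iterP: "(?T ^^ k) p \<in> P" for k
    proof (induction k)
      case 0 thus ?case using \<open>Max ?X \<in> ?X\<close> by (simp add: P_def p_def)
    next
      case (Suc k) thus ?case using TP by auto
    qed
    have "emeasure \<mu> {(?T ^^ k) p} = emeasure \<mu> {p}" for k
      by (induction k) (use shift iterP in auto)
    hence pt: "emeasure \<mu> {x} = emeasure \<mu> {p}" if "x \<in> P" for x using that unfolding P by auto
    have E: "emeasure \<mu> S = of_nat (card (S \<inter> P)) * emeasure \<mu> {p}" if "S \<in> sets borel" for S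
      using emeasure_finite_support[OF sets finP(1) sup that] pt by simp
    have "emeasure \<mu> UNIV = 1" using emeasure_space_1 sp by simp
    hence "of_nat (card P) * emeasure \<mu> {p} = 1" using E[of UNIV] by simp
    moreover have "(of_nat (card P) :: ennreal) \<noteq> 0" "(of_nat (card P) :: ennreal) \<noteq> \<top>" using finP by auto
    ultimately have "emeasure \<mu> {p} = 1 / of_nat (card P)"
      by (metis ennreal_mult_divide_eq mult.commute)
    thus ?thesis using E[OF A] by (simp add: ennreal_times_divide)
  qed
  have eqM: "\<mu> = M" if "invariant_prob q \<mu>" "AE x in \<mu>. x \<in> arcset \<gamma>" for \<mu>
  proof (rule measure_eqI)
    show "sets \<mu> = sets M" using that(1) by (simp add: invariant_prob_def M_def)
    fix A assume "A \<in> sets \<mu>"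
    hence "A \<in> sets borel" using that(1) by (simp add: invariant_prob_def)
    thus "emeasure \<mu> A = emeasure M A" using const[OF that] const[OF invM arcM] by simp
  qed
  have "maximizing q (cphase \<gamma>) \<mu> \<longleftrightarrow> \<mu> = M" for \<mu>
  proof
    assume "maximizing q (cphase \<gamma>) \<mu>"
    hence inv: "invariant_prob q \<mu>" and "integral_fc q (cphase \<gamma>) M \<le> integral_fc q (cphase \<gamma>) \<mu>"
      using invM by (auto simp: maximizing_def)
    hence "ereal (topval \<gamma>) \<le> integral_fc q (cphase \<gamma>) \<mu>" using integral_fc_max_iff(2)[OF invM] arcM by metis
    hence "integral_fc q (cphase \<gamma>) \<mu> = ereal (topval \<gamma>)" using integral_fc_max_iff(1)[OF inv] by (intro antisym)
    thus "\<mu> = M" using integral_fc_max_iff(2)[OF inv] eqM[OF inv] by blast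
  next
    assume "\<mu> = M"
    thus "maximizing q (cphase \<gamma>) \<mu>"
      using invM integral_fc_max_iff(1) integral_fc_max_iff(2)[OF invM] arcM unfolding maximizing_def by metis
  qed
  hence nu: "nu q (cphase \<gamma>) = M" by (simp add: nu_def)
  have "(of_nat (card P) :: ennreal) \<noteq> 0" "(of_nat (card P) :: ennreal) \<noteq> \<top>" using finP by auto
  hence "(of_nat (card P) :: ennreal) / of_nat (card P) = 1"
    by (intro ennreal_divide_self) (auto simp: less_top[symmetric])
  hence "emeasure M P = 1"
    using const[OF invM arcM, of P] finP by (simp add: borel_closed finite_imp_closed)
  moreover have "p \<in> {0..<1}" by (simp add: p_def frac_lt_1)
  ultimately have "supported_on_periodic_orbit q M"
    unfolding supported_on_periodic_orbit_def using n(1) pn P by blast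
  thus ?thesis by (simp add: Pset_def nu)
qed

section \<open>Dimension of the exceptional set\<close>

text \<open>The number of full turns to be removed to bring q^k \<gamma> into [\<gamma>, \<gamma> +
  1).\<close>

definition wind :: "nat \<Rightarrow> real \<Rightarrow> int" where
  "wind k \<gamma> = \<lfloor>real q ^ k * \<gamma> - \<gamma>\<rfloor>"

text \<open>For an exceptional \<open>\<gamma>\<close>, this is the integer part of the displacement of \<open>\<gamma>\<close> under the \<open>k\<close>-th
  iterate of the degree-one circle map that equals \<open>T\<close> on the arc and collapses its complement.\<close>
primrec turns :: "nat \<Rightarrow> real \<Rightarrow> int" where
  "turns 0 \<gamma> = 0"
| "turns (Suc k) \<gamma> = turns k \<gamma> + wind (Suc k) \<gamma> - int q * wind k \<gamma>"

lemma exceptional_wind: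
  assumes "\<gamma> \<in> exceptional"
  shows "\<gamma> \<le> real q ^ k * \<gamma> - of_int (wind k \<gamma>)" "real q ^ k * \<gamma> - of_int (wind k \<gamma>) \<le> \<gamma> + 1 / real q"
proof -
  show "\<gamma> \<le> real q ^ k * \<gamma> - of_int (wind k \<gamma>)" unfolding wind_def by linarith
  have "real q ^ k * \<gamma> \<in> arcset \<gamma>" using assms by (auto simp: exceptional_def)
  thus "real q ^ k * \<gamma> - of_int (wind k \<gamma>) \<le> \<gamma> + 1 / real q" by (simp add: arcset_def wind_def)
qed

text \<open>The lifted orbits \<open>x k + turns k\<close> stay ordered: with equal turns
  multiplication by q keeps the order, and otherwise one unit of turns outweighs the spread q *
  (1/q) = 1 of the images.\<close>

lemma turns_mono:
  assumes ex: "\<gamma> \<in> exceptional" "\<gamma>' \<in> exceptional" and le: "\<gamma> \<le> \<gamma>'" "\<gamma>' < \<gamma> + 1 / 2"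
  shows "turns k \<gamma> \<le> turns k \<gamma>'"
proof -
  define x where "x k = real q ^ k * \<gamma> - of_int (wind k \<gamma>)" for k
  define x' where "x' k = real q ^ k * \<gamma>' - of_int (wind k \<gamma>')" for k
  have b: "\<gamma> \<le> x k" "x k \<le> \<gamma> + 1 / real q" "\<gamma>' \<le> x' k" "x' k \<le> \<gamma>' + 1 / real q" for k
    using exceptional_wind ex by (auto simp: x_def x'_def)
  have S: "x (Suc k) + of_int (turns (Suc k) \<gamma>) = real q * x k + of_int (turns k \<gamma>)"
    "x' (Suc k) + of_int (turns (Suc k) \<gamma>') = real q * x' k + of_int (turns k \<gamma>')" for k
    by (simp_all add: x_def x'_def algebra_simps)
  have "turns k \<gamma> \<le> turns k \<gamma>' \<and> x k + of_int (turns k \<gamma>) \<le> x' k + of_int (turns k \<gamma>')"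
  proof (induction k)
    case 0
    thus ?case using le by (simp add: x_def x'_def wind_def)
  next
    case (Suc k)
    have X: "x (Suc k) + of_int (turns (Suc k) \<gamma>) \<le> x' (Suc k) + of_int (turns (Suc k) \<gamma>')"
    proof (cases "turns k \<gamma> = turns k \<gamma>'")
      case True
      hence "real q * x k \<le> real q * x' k" using Suc by (intro mult_left_mono) auto
      thus ?thesis unfolding S using True by simp
    next
      case False
      hence t: "turns k \<gamma> + 1 \<le> turns k \<gamma>'" using Suc by linarith
      have "real q * x k \<le> real q * (\<gamma> + 1 / real q)" using b by (intro mult_left_mono) auto
      hence "real q * x k \<le> real q * \<gamma> + 1" using q_pos by (simp add: distrib_left)
      moreover have "real q * \<gamma> \<le> real q * x' k" using b(3)[of k] le by (intro mult_left_mono) auto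
      moreover have "real_of_int (turns k \<gamma>) + 1 \<le> real_of_int (turns k \<gamma>')" using t by linarith
      ultimately show ?thesis unfolding S by linarith
    qed
    \<comment> \<open>The two orbit points differ by less than 1/2 + 1/q \<le> 1, so ordered lifts
      force ordered integer parts.\<close>
    have "real_of_int (turns (Suc k) \<gamma>) < real_of_int (turns (Suc k) \<gamma>') + 1"
      using X b(1)[of "Suc k"] b(4)[of "Suc k"] le inv_q by linarith
    hence "turns (Suc k) \<gamma> \<le> turns (Suc k) \<gamma>'" by linarith
    with X show ?case by blast
  qed
  thus ?thesis by blast
qed

text \<open>Each increment is \<open>q * x k - x (k + 1)\<close> with bounded x, so
  \<open>turns\<close> grows only linearly, whereas \<open>wind\<close> grows exponentially in
  general.\<close>

lemma turns_bound:
  assumes "\<gamma> \<in> exceptional" "\<bar>\<gamma>\<bar> \<le> J"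
  shows "\<bar>real_of_int (turns k \<gamma>)\<bar> \<le> real k * ((real q + 1) * (J + 1))"
proof (induction k)
  case (Suc k)
  define x where "x k = real q ^ k * \<gamma> - of_int (wind k \<gamma>)" for k
  have x: "\<bar>x k\<bar> \<le> J + 1" for k
    using exceptional_wind[OF assms(1), of k] assms(2) inv_q unfolding x_def by linarith
  have "real_of_int (turns (Suc k) \<gamma>) = real_of_int (turns k \<gamma>) + (real q * x k - x (Suc k))"
    by (simp add: x_def algebra_simps)
  moreover have "\<bar>real q * x k\<bar> \<le> real q * (J + 1)" unfolding abs_mult using x by (simp add: mult_left_mono)
  ultimately have "\<bar>real_of_int (turns (Suc k) \<gamma>)\<bar> \<le> real k * ((real q + 1) * (J + 1)) + (real q * (J + 1) + (J + 1))"
    using Suc x[of "Suc k"] by linarith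
  thus ?case by (simp add: algebra_simps)
qed simp

text \<open>By \<open>turns_mono\<close> the sequences of nearby points are ordered termwise, so
  equal sums force equal terms: one integer of size O(n^2) encodes the sequence up to n.\<close>

definition turn_sum :: "nat \<Rightarrow> real \<Rightarrow> int" where
  "turn_sum n \<gamma> = (\<Sum>k\<le>n. turns k \<gamma>)"

text \<open>Equal turns give equal \<open>wind\<close> up to n, so q^n \<gamma> and q^n \<gamma>'
  lie in corresponding lifts of their arcs, at most (\<gamma>' - \<gamma>) + 1/q apart.\<close>

lemma turn_sum_eq_imp_close:
  assumes ex: "\<gamma> \<in> exceptional" "\<gamma>' \<in> exceptional" and le: "\<bar>\<gamma> - \<gamma>'\<bar> < 1 / 2"
    and eq: "turn_sum n \<gamma> = turn_sum n \<gamma>'" and n: "1 \<le> n"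
  shows "\<bar>\<gamma> - \<gamma>'\<bar> \<le> 1 / real q ^ n"
proof -
  have *: "\<bar>\<gamma> - \<gamma>'\<bar> \<le> 1 / real q ^ n"
    if ex: "\<gamma> \<in> exceptional" "\<gamma>' \<in> exceptional" and le: "\<gamma> \<le> \<gamma>'" "\<gamma>' < \<gamma> + 1 / 2"
      and eq: "turn_sum n \<gamma> = turn_sum n \<gamma>'" for \<gamma> \<gamma>'
  proof -
    have t: "turns k \<gamma> = turns k \<gamma>'" if "k \<le> n" for k
      using sum_mono_inv[OF eq[unfolded turn_sum_def] turns_mono[OF ex le]] that by simp
    have w: "wind k \<gamma> = wind k \<gamma>'" if "k \<le> n" for k
      using that
    proof (induction k)
      case (Suc k)
      thus ?case using t[of k] t[of "Suc k"] by simp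
    qed (simp add: wind_def)
    have "real q ^ n * \<gamma>' - real q ^ n * \<gamma> \<le> (\<gamma>' - \<gamma>) + 1 / real q"
      using exceptional_wind[OF ex(1), of n] exceptional_wind[OF ex(2), of n] w[of n] by simp
    hence A: "(real q ^ n - 1) * (\<gamma>' - \<gamma>) \<le> 1 / real q" by (simp add: algebra_simps)
    have P: "real q \<le> real q ^ n"
      by (rule power_increasing[of 1 n "real q", unfolded power_one_right]) (use n q_ge2 in auto)
    have "2 * (real q ^ n - 1) \<le> real q * (real q ^ n - 1)"
      by (intro mult_right_mono) (use P q_ge2 in linarith)+
    moreover have "p \<le> 2 * (p - 1)" if "a \<le> p" "2 \<le> a" for a p :: real using that by simp
    from this[OF P q_ge2] have "real q ^ n \<le> 2 * (real q ^ n - 1)" .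
    ultimately have B: "real q ^ n \<le> real q * (real q ^ n - 1)" by (rule order_trans[rotated])
    have "real q ^ n * (\<gamma>' - \<gamma>) \<le> real q * (real q ^ n - 1) * (\<gamma>' - \<gamma>)"
      using B le by (intro mult_right_mono) auto
    also have "\<dots> = real q * ((real q ^ n - 1) * (\<gamma>' - \<gamma>))" by simp
    also have "\<dots> \<le> real q * (1 / real q)" using A by (intro mult_left_mono) auto
    finally have "real q ^ n * (\<gamma>' - \<gamma>) \<le> 1" using q_pos by simp
    thus ?thesis using le q_pos by (simp add: field_simps)
  qed
  show ?thesis
  proof (cases "\<gamma> \<le> \<gamma>'")
    case True
    show ?thesis by (rule *[OF ex True _ eq]) (use le in linarith)
  next
    case False
    hence "\<bar>\<gamma>' - \<gamma>\<bar> \<le> 1 / real q ^ n" by (intro * ex eq[symmetric]) (use le in linarith)+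
    thus ?thesis by (simp only: abs_minus_commute)
  qed
qed

section \<open>Covering and closedness of the exceptional phases\<close>

lemma hausdorff_pre_window:
  assumes s: "0 < s" and \<delta>: "0 < \<delta>"
  shows "hausdorff_pre s \<delta> (cphase ` (exceptional \<inter> {t..t + 1 / 4})) = 0"
proof -
  obtain d H where dH: "0 < d" "0 < H"
    "\<And>\<gamma> \<gamma>'. \<bar>\<gamma> - \<gamma>'\<bar> \<le> d \<Longrightarrow> \<bar>cphase \<gamma> - cphase \<gamma>'\<bar> \<le> H * sqrt \<bar>\<gamma> - \<gamma>'\<bar>"
    by (rule cphase_holder) blast
  define R where "R = nat \<lceil>(real q + 1) * (\<bar>t\<bar> + 1 + 1)\<rceil>"
  define S where "S n = (n + 1) * (n * R)" for n
  define a where "a = 1 / sqrt (real q)"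
  have a: "0 < a" "a < 1" using q_ge2 by (auto simp: a_def)
  have sq: "sqrt (1 / real q ^ n) = a ^ n" for n by (simp add: a_def real_sqrt_divide real_sqrt_power power_divide)
  have pre: "hausdorff_pre s \<delta> (cphase ` (exceptional \<inter> {t..t + 1 / 4})) \<le> ennreal (real (2 * S n + 1) * (H * a ^ n) powr s)"
    if n: "1 \<le> n" "1 / real q ^ n \<le> d" "H * a ^ n \<le> \<delta>" for n
  proof -
    \<comment> \<open>One set per value of \<open>turn_sum n\<close>, which lies between - S n and S
      n; the shift by \<open>S n\<close> makes the index natural.\<close>
    let ?U = "\<lambda>i. cphase ` {\<gamma> \<in> exceptional \<inter> {t..t + 1 / 4}. turn_sum n \<gamma> = int i - int (S n)}"
    show ?thesis
    proof (rule hausdorff_pre_finite_cover[where U = ?U])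
      show "cphase ` (exceptional \<inter> {t..t + 1 / 4}) \<subseteq> (\<Union>i<2 * S n + 1. ?U i)"
      proof safe
        fix \<gamma> assume g: "\<gamma> \<in> exceptional" "\<gamma> \<in> {t..t + 1 / 4}"
        have "\<bar>\<gamma>\<bar> \<le> \<bar>t\<bar> + 1" using g(2) by auto
        hence tb: "\<bar>real_of_int (turns k \<gamma>)\<bar> \<le> real n * real R" if "k \<le> n" for k
        proof -
          have "\<bar>real_of_int (turns k \<gamma>)\<bar> \<le> real k * ((real q + 1) * (\<bar>t\<bar> + 1 + 1))"
            by (rule turns_bound[OF g(1) \<open>\<bar>\<gamma>\<bar> \<le> \<bar>t\<bar> + 1\<close>])
          also have "\<dots> \<le> real n * real R"
            using that unfolding R_def by (intro mult_mono real_nat_ceiling_ge) auto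
          finally show ?thesis .
        qed
        have "\<bar>real_of_int (turn_sum n \<gamma>)\<bar> \<le> (\<Sum>k\<le>n. \<bar>real_of_int (turns k \<gamma>)\<bar>)"
          unfolding turn_sum_def of_int_sum by (rule sum_abs)
        also have "\<dots> \<le> (\<Sum>k\<le>n. real n * real R)" using tb by (intro sum_mono) auto
        also have "\<dots> = real (S n)" by (simp add: S_def algebra_simps)
        finally have "\<bar>turn_sum n \<gamma>\<bar> \<le> int (S n)" by linarith
        hence "nat (turn_sum n \<gamma> + int (S n)) < 2 * S n + 1" "turn_sum n \<gamma> = int (nat (turn_sum n \<gamma> + int (S n))) - int (S n)"
          by auto
        thus "cphase \<gamma> \<in> (\<Union>i<2 * S n + 1. ?U i)" using g by blast
      qed
      show "dist x y \<le> H * a ^ n" if "x \<in> ?U i" "y \<in> ?U i" for i x y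
      proof -
        note xy = that
        obtain \<gamma> where x: "x = cphase \<gamma>" "\<gamma> \<in> {\<gamma> \<in> exceptional \<inter> {t..t + 1 / 4}. turn_sum n \<gamma> = int i - int (S n)}"
          using xy(1) by (rule imageE)
        obtain \<gamma>' where y: "y = cphase \<gamma>'" "\<gamma>' \<in> {\<gamma> \<in> exceptional \<inter> {t..t + 1 / 4}. turn_sum n \<gamma> = int i - int (S n)}"
          using xy(2) by (rule imageE)
        have g: "x = cphase \<gamma>" "y = cphase \<gamma>'" "\<gamma> \<in> exceptional" "\<gamma>' \<in> exceptional"
          "\<gamma> \<in> {t..t + 1 / 4}" "\<gamma>' \<in> {t..t + 1 / 4}" "turn_sum n \<gamma> = turn_sum n \<gamma>'" using x y by auto
        \<comment> \<open>This is why the window has length 1/4.\<close>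
        have "\<bar>\<gamma> - \<gamma>'\<bar> < 1 / 2" using g(5,6) by (auto simp: abs_if)
        hence c: "\<bar>\<gamma> - \<gamma>'\<bar> \<le> 1 / real q ^ n" using g n(1) by (intro turn_sum_eq_imp_close) auto
        hence "\<bar>cphase \<gamma> - cphase \<gamma>'\<bar> \<le> H * sqrt \<bar>\<gamma> - \<gamma>'\<bar>" using n(2) by (intro dH(3)) linarith
        also have "\<dots> \<le> H * sqrt (1 / real q ^ n)" using c dH(2) by (intro mult_left_mono real_sqrt_le_mono) auto
        finally show ?thesis by (simp add: g sq dist_real_def)
      qed
    qed (use dH a n s in auto)
  qed
  have lim0: "(\<lambda>n. H * a ^ n) \<longlonglongrightarrow> 0"
    using a by (intro tendsto_mult_right_zero LIMSEQ_power_zero) auto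
  have ev1: "eventually (\<lambda>n. H * a ^ n \<le> \<delta>) sequentially"
    using order_tendstoD(2)[OF lim0 \<delta>] by (rule eventually_mono) auto
  have limq: "(\<lambda>n. 1 / real q ^ n) \<longlonglongrightarrow> 0" using q_ge2 by (intro LIMSEQ_divide_realpow_zero) auto
  have ev2: "eventually (\<lambda>n. 1 / real q ^ n \<le> d) sequentially"
    using order_tendstoD(2)[OF limq dH(1)] by (rule eventually_mono) auto
  define b where "b = a powr s"
  have b: "0 < b" "b < 1" using a s powr_less_mono2[of s a 1] by (auto simp: b_def)
  have "(\<lambda>n. real (2 * S n + 1) * (H * a ^ n) powr s) \<longlonglongrightarrow> 0"
  proof -
    \<comment> \<open>Quadratically many sets against geometrically shrinking diameters.\<close>
    have "(\<lambda>n. (2 * ((real n + 1) * (real n * real R)) + 1) * (H powr s * b ^ n)) \<longlonglongrightarrow> 0"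
      using b by real_asymp
    moreover have "(H * a ^ n) powr s = H powr s * b ^ n" for n
      using dH a by (simp add: powr_mult b_def powr_powr powr_realpow[symmetric] mult.commute)
    moreover have "real (2 * S n + 1) = 2 * ((real n + 1) * (real n * real R)) + 1" for n
      by (simp add: S_def algebra_simps)
    ultimately show ?thesis by (simp only:)
  qed
  hence "(\<lambda>n. ennreal (real (2 * S n + 1) * (H * a ^ n) powr s)) \<longlonglongrightarrow> ennreal 0" by (rule tendsto_ennrealI)
  moreover have "eventually (\<lambda>n. hausdorff_pre s \<delta> (cphase ` (exceptional \<inter> {t..t + 1 / 4})) \<le>
      ennreal (real (2 * S n + 1) * (H * a ^ n) powr s)) sequentially"
    using ev1 ev2 eventually_ge_at_top[of 1] by eventually_elim (rule pre)
  ultimately have "hausdorff_pre s \<delta> (cphase ` (exceptional \<inter> {t..t + 1 / 4})) \<le> ennreal 0"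
    by (intro tendsto_lowerbound) auto
  thus ?thesis by simp
qed

lemma hausdorff_pre_exceptional:
  assumes "0 < s" "0 < \<delta>"
  shows "hausdorff_pre s \<delta> (cphase ` exceptional) = 0"
proof -
  have "cphase ` exceptional \<subseteq> (\<Union>i. cphase ` (exceptional \<inter> {of_int (int_decode i) / 4..of_int (int_decode i) / 4 + 1 / 4}))"
  proof
    fix x assume "x \<in> cphase ` exceptional"
    then obtain \<gamma> where g: "\<gamma> \<in> exceptional" "x = cphase \<gamma>" by blast
    define i where "i = int_encode \<lfloor>4 * \<gamma>\<rfloor>"
    have dec: "int_decode i = \<lfloor>4 * \<gamma>\<rfloor>" by (simp add: i_def)
    have "real_of_int \<lfloor>4 * \<gamma>\<rfloor> \<le> 4 * \<gamma>" "4 * \<gamma> \<le> real_of_int \<lfloor>4 * \<gamma>\<rfloor> + 1" by linarith+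
    hence "\<gamma> \<in> {of_int (int_decode i) / 4..of_int (int_decode i) / 4 + 1 / 4}"
      unfolding dec atLeastAtMost_iff by linarith
    thus "x \<in> (\<Union>i. cphase ` (exceptional \<inter> {of_int (int_decode i) / 4..of_int (int_decode i) / 4 + 1 / 4}))"
      using g by blast
  qed
  hence "hausdorff_pre s \<delta> (cphase ` exceptional) \<le>
      hausdorff_pre s \<delta> (\<Union>i. cphase ` (exceptional \<inter> {of_int (int_decode i) / 4..of_int (int_decode i) / 4 + 1 / 4}))"
    by (rule hausdorff_pre_mono)
  also have "\<dots> = 0" by (intro hausdorff_pre_UN_null hausdorff_pre_window assms)
  finally show ?thesis by simp
qed

text \<open>The arc moves with \<gamma>; subtracting \<gamma> turns each condition into the preimage
  of the fixed closed set \<open>arcset 0\<close> under a continuous map.\<close>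

lemma closed_exceptional: "closed exceptional"
proof -
  have "real q ^ k * \<gamma> \<in> arcset \<gamma> \<longleftrightarrow> real q ^ k * \<gamma> - \<gamma> \<in> arcset 0" for k \<gamma>
  proof -
    have "(\<gamma> \<le> x - of_int m \<and> x - of_int m \<le> \<gamma> + 1 / real q) = (0 \<le> x - \<gamma> - of_int m \<and> x - \<gamma> - of_int m \<le> 0 + 1 / real q)" for x m
      by auto
    thus ?thesis unfolding arcset_iff by simp
  qed
  hence "exceptional = (\<Inter>k. (\<lambda>\<gamma>. real q ^ k * \<gamma> - \<gamma>) -` arcset 0)" by (auto simp: exceptional_def)
  thus ?thesis by (auto intro!: closed_INT continuous_closed_vimage closed_arcset continuous_intros)
qed

text \<open>\<open>exceptional\<close> is not bounded, but \<gamma> + \<open>cphase \<gamma>\<close>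
  is, so preimages of a convergent sequence stay bounded and have a convergent subsequence.\<close>

lemma closed_cphase_exceptional: "closed (cphase ` exceptional)"
  unfolding closed_sequential_limits
proof (intro allI impI, elim conjE)
  fix f l assume f: "\<forall>n. f n \<in> cphase ` exceptional" "f \<longlonglongrightarrow> l"
  have "\<forall>n. \<exists>\<gamma>. \<gamma> \<in> exceptional \<and> f n = cphase \<gamma>" using f(1) by blast
  from choice[OF this] obtain g where g: "\<And>n. g n \<in> exceptional" "\<And>n. f n = cphase (g n)" by blast
  have "bounded (range f)" using f(2) by (rule convergent_imp_bounded)
  then obtain B where B: "\<And>n. \<bar>f n\<bar> \<le> B" by (auto simp: bounded_iff)
  have "\<bar>g n\<bar> \<le> B + 1" for n
    using B[of n] cphase_bounds[of "g n"] inv_q g(2)[of n] by linarith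
  hence "bounded (range g)" by (auto simp: bounded_iff)
  then obtain h r where h: "strict_mono (r :: nat \<Rightarrow> nat)" "(g \<circ> r) \<longlonglongrightarrow> h"
    using bounded_imp_convergent_subsequence by blast
  have "h \<in> exceptional" by (rule closed_sequentially[OF closed_exceptional _ h(2)]) (simp add: g(1))
  moreover have "(\<lambda>n. cphase ((g \<circ> r) n)) \<longlonglongrightarrow> cphase h"
    using cphase_continuous h(2)
    by (intro isCont_tendsto_compose[of h cphase]) (simp_all add: continuous_on_eq_continuous_at o_def)
  hence "(f \<circ> r) \<longlonglongrightarrow> cphase h" by (simp add: g(2) o_def)
  hence "l = cphase h" by (rule LIMSEQ_unique[OF LIMSEQ_subseq_LIMSEQ[OF f(2) h(1)]])
  ultimately show "l \<in> cphase ` exceptional" by blast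
qed

lemma closure_Pset_subset: "closure (Pset q) \<subseteq> cphase ` exceptional"
proof (rule closure_minimal[OF _ closed_cphase_exceptional])
  show "Pset q \<subseteq> cphase ` exceptional"
  proof
    fix c assume c: "c \<in> Pset q"
    obtain \<gamma> where "cphase \<gamma> = c" using cphase_surj by blast
    thus "c \<in> cphase ` exceptional" using periodic_maximizer[of \<gamma>] c by blast
  qed
qed

lemma hausdorff_pre_closure_Pset: "0 < s \<Longrightarrow> 0 < \<delta> \<Longrightarrow> hausdorff_pre s \<delta> (closure (Pset q)) = 0"
  using hausdorff_pre_mono[OF closure_Pset_subset, of s \<delta>] hausdorff_pre_exceptional[of s \<delta>] by simp

end

theorem theorem4p6:
  fixes q :: nat
  assumes "q \<ge> 2"
  shows "nowhere_dense (closure (Pset q)) \<and> hausdorff_dim (closure (Pset q)) = 0"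
proof -
  interpret times_q q by unfold_locales (rule assms)
  let ?Z = "closure (Pset q)"
  have "nowhere_dense ?Z"
    unfolding nowhere_dense_def closure_closure
    by (intro hausdorff_null_interior hausdorff_pre_closure_Pset) auto
  moreover have "hausdorff_measure s ?Z = 0" if "0 < s" for s
    unfolding hausdorff_measure_def using hausdorff_pre_closure_Pset[OF that] by (simp add: SUP_eq_const)
  hence mem: "s \<in> {s. 0 \<le> s \<and> hausdorff_measure s ?Z = 0}" if "0 < s" for s using that by simp
  have "hausdorff_dim ?Z = 0"
    unfolding hausdorff_dim_def
  proof (rule antisym)
    show "0 \<le> Inf {s. 0 \<le> s \<and> hausdorff_measure s ?Z = 0}"
    proof (rule cInf_greatest)
      show "{s. 0 \<le> s \<and> hausdorff_measure s ?Z = 0} \<noteq> {}" using mem[OF zero_less_one] by blast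
    qed auto
    \<comment> \<open>Every s > 0 belongs to the set while s = 0 need not, so the infimum is only
      approached.\<close>
    show "Inf {s. 0 \<le> s \<and> hausdorff_measure s ?Z = 0} \<le> 0"
    proof (rule field_le_epsilon)
      fix e :: real assume "0 < e"
      thus "Inf {s. 0 \<le> s \<and> hausdorff_measure s ?Z = 0} \<le> 0 + e"
        using mem[of e] by (auto intro!: cInf_lower bdd_belowI[of _ 0])
    qed
  qed
  ultimately show ?thesis by blast
qed

end
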